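(* Consider the Gumbel-max watermark model of the context with constant watermark fraction $\varepsilon_n\equiv\varepsilon\in(0,1]$, and suppose Assumption (A) holds. Fix $\Delta\in(0,1)$, $s\in(0,1)$ and take $c_n^+=0$. Then $$\sup_{\text{measurable } S} R_{\mathcal{P}_\Delta}(S)=D_{\mathrm{KL}}\big(\mu_0,\ (1-\varepsilon)\mu_0+\varepsilon\,\mu_{1,\mathbf{P}^\star_\Delta}\big)=R_{\mathcal{P}_\Delta}(S_n^+(s)),$$ where the supremum is over measurable statistics $S$ of the pivotal statistics $Y_{1:n}$, and $$\mathbf{P}^\star_\Delta=\Big(\underbrace{1-\Delta,\dots,1-\Delta}_{\lfloor 1/(1-\Delta)\rfloor\text{ times}},\ 1-(1-\Delta)\lfloor\tfrac{1}{1-\Delta}\rfloor,\ 0,\dots,0\Big).$$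
   Context: $\mathcal{W}$ is a finite vocabulary. For a probability vector $\mathbf{P}=(P_w)_{w\in\mathcal{W}}$, $\mu_{1,\mathbf{P}}$ is the distribution on $[0,1]$ with CDF $F_{1,\mathbf{P}}(r)=\sum_w P_w r^{1/P_w}$; $\mu_0=U(0,1)$; $D_{\mathrm{KL}}$ is Kullback–Leibler divergence. Watermark model: for $t=1,\dots,n$ a random next-token distribution $\mathbf{P}_t$ is produced, $\xi_t=(U_{t,w})_{w}$ has i.i.d. $U(0,1)$ entries, the decoder is $\mathcal{S}(\mathbf{P},\xi)=\arg\max_w \frac{\log U_w}{P_w}$, the observed token is $w_t$ and $Y_t=U_{t,w_t}$. Let $\mathcal{F}_{t-1}=\sigma(\{w_j,\xi_j,\mathbf{P}_{j+1}\}_{j=1}^{t-1})$. Assumption (A): (a) $\xi_1,\dots,\xi_n$ are i.i.d. and $\xi_t$ is independent of $\mathcal{F}_{t-1}$; (b) with probability $\varepsilon$, $w_t=\mathcal{S}(\mathbf{P}_t,\xi_t)$; otherwise $w_t$ is drawn from $\mathbf{P}_t$ and, conditionally on $\mathcal{F}_{t-1}$, is independent of $\xi_t$. $H_0$: $Y_1,\dots,Y_n$ i.i.d. $U(0,1)$; $H_1^{\mathrm{mix}}$: the law of $Y_{1:n}$ under the model; $\mathbb{P}_0,\mathbb{P}_1$ denote the corresponding probabilities. $\mathcal{P}_\Delta=\{\mathbf{P}:\max_w P_w\le 1-\Delta\}$. Efficiency: for a detection rule rejecting $H_0$ when a statistic $S(Y_{1:n})$ exceeds a critical value, let $\gamma_{n,\alpha}$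 satisfy $\mathbb{P}_0(S(Y_{1:n})\ge\gamma_{n,\alpha})=\alpha$ for all $n\ge1$ (fixed $\alpha\in(0,1)$); for a class $\mathcal{P}$ the $\mathcal{P}$-efficiency rate $R_{\mathcal{P}}(S)$ is defined by $\lim_{n\to\infty}\sup_{\mathbf{P}_t\in\mathcal{P}}\frac1n\log\mathbb{P}_1(S(Y_{1:n})\le\gamma_{n,\alpha})=-R_{\mathcal{P}}(S)$, the supremum being over the next-token distributions $\mathbf{P}_t$ all lying in $\mathcal{P}$. Tr-GoF statistic: $\mathrm{p}_t=1-Y_t$, sorted $\mathrm{p}_{(1)}<\dots<\mathrm{p}_{(n)}$, $\mathrm{p}_{(n+1)}=1$, $S_n^+(s)=\sup_{t\in\{1,\dots,n\}:\mathrm{p}_{(t+1)}\ge c_n^+}K_s^+(t/n,\mathrm{p}_{(t)})$ with $K_s^+(u,v)=K_s(u,v)$ if $0<v<u<1$ and $0$ otherwise, $K_s(u,v)=v\phi_s(u/v)+(1-v)\phi_s(\frac{1-u}{1-v})$, and for $s\ne0,1$, $\phi_s(x)=\frac{1-s+sx-x^s}{s(1-s)}$.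
   Formalization: Exact-level critical values are required only for all large n (at n=1 the statistic S_1^+ is identically 0, so level α is impossible), and the vocabulary is assumed to have at least ⌊1/(1−Δ)⌋+1 tokens, so that P*_Δ as displayed is a vector on it. *)

theory Defs
  imports "HOL-Probability.Probability"
begin

definition prob_vec :: "('w::finite \<Rightarrow> real) \<Rightarrow> bool" where
  "prob_vec P \<longleftrightarrow> (\<forall>w. 0 \<le> P w) \<and> (\<Sum>w\<in>UNIV. P w) = 1"

definition P_Delta :: "real \<Rightarrow> ('w::finite \<Rightarrow> real) set" where
  "P_Delta \<Delta> = {P. prob_vec P \<and> (\<forall>w. P w \<le> 1 - \<Delta>)}"

text \<open>Gumbel-max decoder argmax_w (log U_w)/P_w; tokens with P_w = 0 have
  (log U_w)/P_w = -infinity and are never selected.\<close>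
definition decoder :: "('w::finite \<Rightarrow> real) \<Rightarrow> ('w \<Rightarrow> real) \<Rightarrow> 'w" where
  "decoder P \<xi> = arg_max_on (\<lambda>w. ln (\<xi> w) / P w) {w. 0 < P w}"

definition mu0 :: "real measure" where
  "mu0 = uniform_measure lborel {0..1}"

text \<open>F_{1,P}(r) = sum_w P_w r^(1/P_w) on [0,1] (terms with P_w = 0 vanish, as r^infinity = 0
  for r < 1 and they carry weight 0), extended by 0 below 0 and 1 above 1.
  Indexed over an arbitrary index set I so that it applies to vectors of any length.\<close>
definition F1 :: "('i \<Rightarrow> real) \<Rightarrow> 'i set \<Rightarrow> real \<Rightarrow> real" where
  "F1 P I r = (if r \<le> 0 then 0 else if 1 \<le> r then 1
               else (\<Sum>w\<in>{w\<in>I. 0 < P w}. P w * r powr (1 / P w)))"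

definition Fmix :: "real \<Rightarrow> ('i \<Rightarrow> real) \<Rightarrow> 'i set \<Rightarrow> real \<Rightarrow> real" where
  "Fmix \<epsilon> P I r = (1 - \<epsilon>) * max 0 (min 1 r) + \<epsilon> * F1 P I r"

definition mix_measure :: "real \<Rightarrow> ('i \<Rightarrow> real) \<Rightarrow> 'i set \<Rightarrow> real measure" where
  "mix_measure \<epsilon> P I = interval_measure (Fmix \<epsilon> P I)"

definition Pstar_len :: "real \<Rightarrow> nat" where
  "Pstar_len \<Delta> = nat \<lfloor>1 / (1 - \<Delta>)\<rfloor>"

definition Pstar :: "real \<Rightarrow> nat \<Rightarrow> real" where
  "Pstar \<Delta> i = (if i < Pstar_len \<Delta> then 1 - \<Delta>
                 else if i = Pstar_len \<Delta> then 1 - (1 - \<Delta>) * real (Pstar_len \<Delta>)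
                 else 0)"

text \<open>D_KL(mu, nu) = integral of log(dmu/dnu) dmu.  The library's KL_divergence b M N is
  integral over N of log_b (dN/dM), i.e. D_KL(N, M).\<close>
definition D_KL :: "real measure \<Rightarrow> real measure \<Rightarrow> real" where
  "D_KL \<mu> \<nu> = KL_divergence (exp 1) \<nu> \<mu>"

text \<open>Coordinate k (k = 0,1,2,...) holds (P_{k+1}, xi_{k+1}, w_{k+1}).\<close>
definition vec_space :: "('w::finite \<Rightarrow> real) measure" where
  "vec_space = PiM UNIV (\<lambda>_. borel)"

definition step_space :: "(('w::finite \<Rightarrow> real) \<times> ('w \<Rightarrow> real) \<times> 'w) measure" where
  "step_space = vec_space \<Otimes>\<^sub>M vec_space \<Otimes>\<^sub>M count_space UNIV"

definition traj_space :: "(nat \<Rightarrow> ('w::finite \<Rightarrow> real) \<times> ('w \<Rightarrow> real) \<times> 'w) measure" where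
  "traj_space = PiM UNIV (\<lambda>_. step_space)"

definition NTP :: "nat \<Rightarrow> (nat \<Rightarrow> ('w \<Rightarrow> real) \<times> ('w \<Rightarrow> real) \<times> 'w) \<Rightarrow> 'w \<Rightarrow> real" where
  "NTP k \<omega> = fst (\<omega> k)"

definition Xi :: "nat \<Rightarrow> (nat \<Rightarrow> ('w \<Rightarrow> real) \<times> ('w \<Rightarrow> real) \<times> 'w) \<Rightarrow> 'w \<Rightarrow> real" where
  "Xi k \<omega> = fst (snd (\<omega> k))"

definition Tok :: "nat \<Rightarrow> (nat \<Rightarrow> ('w \<Rightarrow> real) \<times> ('w \<Rightarrow> real) \<times> 'w) \<Rightarrow> 'w" where
  "Tok k \<omega> = snd (snd (\<omega> k))"

definition Yv :: "nat \<Rightarrow> (nat \<Rightarrow> ('w \<Rightarrow> real) \<times> ('w \<Rightarrow> real) \<times> 'w) \<Rightarrow> real" where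
  "Yv k \<omega> = Xi k \<omega> (Tok k \<omega>)"

text \<open>Hist k = F_{k} (paper's F_{t-1} for t = k+1): generated by (w_j, xi_j, P_j) for j < k
  together with P_{k+1} (coordinate k).\<close>
definition Hist :: "nat \<Rightarrow> (nat \<Rightarrow> ('w::finite \<Rightarrow> real) \<times> ('w \<Rightarrow> real) \<times> 'w) measure" where
  "Hist k = vimage_algebra (space traj_space) (\<lambda>\<omega>. (restrict \<omega> {..<k}, NTP k \<omega>))
              (PiM {..<k} (\<lambda>_. step_space) \<Otimes>\<^sub>M vec_space)"

definition HistXi :: "nat \<Rightarrow> (nat \<Rightarrow> ('w::finite \<Rightarrow> real) \<times> ('w \<Rightarrow> real) \<times> 'w) measure" where
  "HistXi k = vimage_algebra (space traj_space) (\<lambda>\<omega>. (restrict \<omega> {..<k}, NTP k \<omega>, Xi k \<omega>))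
              (PiM {..<k} (\<lambda>_. step_space) \<Otimes>\<^sub>M vec_space \<Otimes>\<^sub>M vec_space)"

definition gw_model :: "real \<Rightarrow> real \<Rightarrow> (nat \<Rightarrow> ('w::finite \<Rightarrow> real) \<times> ('w \<Rightarrow> real) \<times> 'w) measure \<Rightarrow> bool" where
  "gw_model \<epsilon> \<Delta> M \<longleftrightarrow>
     prob_space M \<and> sets M = sets traj_space \<and>
     (\<forall>k. AE \<omega> in M. NTP k \<omega> \<in> P_Delta \<Delta>) \<and>
     \<comment> \<open>(a): xi_t has i.i.d. U(0,1) entries and is independent of F_{t-1}\<close>
     (\<forall>k. distr M vec_space (Xi k) = PiM UNIV (\<lambda>_. uniform_measure lborel {0..1})) \<and>
     (\<forall>k. \<forall>A\<in>sets (Hist k). \<forall>B\<in>sets vec_space.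
         measure M (A \<inter> (Xi k -` B \<inter> space M)) = measure M A * measure M (Xi k -` B \<inter> space M)) \<and>
     \<comment> \<open>(b): given (F_{t-1}, xi_t), w_t = S(P_t, xi_t) with prob. eps, else w_t ~ P_t\<close>
     (\<forall>k. \<forall>A\<in>sets (HistXi k). \<forall>w.
         measure M (A \<inter> {\<omega>\<in>space M. Tok k \<omega> = w}) =
         (\<integral>\<omega>\<in>A. (\<epsilon> * (if decoder (NTP k \<omega>) (Xi k \<omega>) = w then 1 else 0)
                    + (1 - \<epsilon>) * NTP k \<omega> w) \<partial>M))"

type_synonym statistic = "nat \<Rightarrow> (nat \<Rightarrow> real) \<Rightarrow> real"

definition measurable_statistic :: "statistic \<Rightarrow> bool" where
  "measurable_statistic S \<longleftrightarrow> (\<forall>n. S n \<in> borel_measurable (PiM {..<n} (\<lambda>_. borel)))"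

definition H0_law :: "nat \<Rightarrow> (nat \<Rightarrow> real) measure" where
  "H0_law n = PiM {..<n} (\<lambda>_. uniform_measure lborel {0..1})"

definition critical_values :: "real \<Rightarrow> statistic \<Rightarrow> (nat \<Rightarrow> real) \<Rightarrow> bool" where
  "critical_values \<alpha> S \<gamma> \<longleftrightarrow>
     (\<forall>\<^sub>F n in sequentially. measure (H0_law n) {y\<in>space (H0_law n). \<gamma> n \<le> S n y} = \<alpha>)"

definition sup_type2 :: "'w::finite itself \<Rightarrow> real \<Rightarrow> real \<Rightarrow> statistic \<Rightarrow> (nat \<Rightarrow> real) \<Rightarrow> nat \<Rightarrow> real" where
  "sup_type2 _ \<epsilon> \<Delta> S \<gamma> n =
     (SUP M\<in>{M :: (nat \<Rightarrow> ('w \<Rightarrow> real) \<times> ('w \<Rightarrow> real) \<times> 'w) measure. gw_model \<epsilon> \<Delta> M}.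
        measure M {\<omega>\<in>space M. S n (restrict (\<lambda>k. Yv k \<omega>) {..<n}) \<le> \<gamma> n})"

definition efficiency_rate :: "'w::finite itself \<Rightarrow> real \<Rightarrow> real \<Rightarrow> statistic \<Rightarrow> (nat \<Rightarrow> real) \<Rightarrow> real \<Rightarrow> bool" where
  "efficiency_rate W \<epsilon> \<Delta> S \<gamma> R \<longleftrightarrow>
     ((\<lambda>n. ln (sup_type2 W \<epsilon> \<Delta> S \<gamma> n) / real n) \<longlonglongrightarrow> - R)"

definition phi :: "real \<Rightarrow> real \<Rightarrow> real" where
  "phi s x = (1 - s + s * x - x powr s) / (s * (1 - s))"

definition K_div :: "real \<Rightarrow> real \<Rightarrow> real \<Rightarrow> real" where
  "K_div s u v = v * phi s (u / v) + (1 - v) * phi s ((1 - u) / (1 - v))"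

definition K_plus :: "real \<Rightarrow> real \<Rightarrow> real \<Rightarrow> real" where
  "K_plus s u v = (if 0 < v \<and> v < u \<and> u < 1 then K_div s u v else 0)"

definition p_ord :: "nat \<Rightarrow> (nat \<Rightarrow> real) \<Rightarrow> nat \<Rightarrow> real" where
  "p_ord n y t = (if t = n + 1 then 1 else sort (map (\<lambda>i. 1 - y i) [0..<n]) ! (t - 1))"

definition TrGoF :: "real \<Rightarrow> (nat \<Rightarrow> real) \<Rightarrow> statistic" where
  "TrGoF s c n y = Max {K_plus s (real t / real n) (p_ord n y t) | t. t \<in> {1..n} \<and> c n \<le> p_ord n y (t + 1)}"

end

theory Submission
  imports Defs
begin

text \<open>Conditionally on the past, \<open>Y\<^sub>t\<close> has distribution function \<open>(1 - \<epsilon>) r + \<epsilon> F1 P r\<close>. Since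
  \<open>x \<mapsto> x r^(1/x)\<close> is convex, \<open>F1 P\<close> is maximal on \<open>P_Delta\<close> at \<open>P*\<close>; let \<open>f\<close> be the (increasing)
  density of the resulting mixture, so that \<open>D = - \<integral> ln f\<close>. As \<open>1/f\<close> is decreasing, stochastic
  dominance gives \<open>E (1 / f (Y\<^sub>t) | past) \<le> 1\<close> for every model, hence \<open>E (\<Prod>\<^sub>t 1 / f (Y\<^sub>t)) \<le> 1\<close>.
  Critical values of Tr-GoF tend to 0, so acceptance forces the empirical law of the \<open>Y\<^sub>t\<close> to be almost
  stochastically below uniform, which bounds \<open>\<Sum>\<^sub>t ln f (Y\<^sub>t)\<close> by about \<open>- n D\<close>; Markov's inequality yields
  the exponent \<open>D\<close> uniformly. Stein's lemma for the i.i.d. model with \<open>P\<^sub>t = P*\<close> gives the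
  converse. Critical values exist as the null law of Tr-GoF has no atom except 0, of mass at most
  \<open>1/n\<close> by cyclic rotation.\<close>

section \<open>The uniform law and mixture densities\<close>

text \<open>Two obstacles shape the estimate. The next-token distributions may depend on the past,
  so each step has to be bounded conditionally; since one extremal law is stochastically smallest
  whatever the past is, a single test function \<open>1/f\<close> serves all of them. The other
  obstacle is that for \<open>\<epsilon> = 1\<close> the density \<open>f\<close> vanishes at 0 and
  \<open>ln f\<close> is unbounded there, so closeness of distribution functions does not control
  the empirical mean of \<open>ln f\<close>. Passing from \<open>ln f (r)\<close> to
  \<open>ln f (r + d)\<close> absorbs a uniform error of size \<open>d\<close>, and monotonicity of
  \<open>ln f\<close> makes a one-sided error bound sufficient, which is all that Tr-GoF provides.
  With \<open>c n = 0\<close> the truncation is vacuous for p-values in [0, 1], so every rank is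
  scanned. The null mass at 0 must be bounded because the intermediate value theorem reaches a level
  \<open>\<alpha>\<close> only above the jump of the distribution function at 0.\<close>

lemma prob_space_mu0: "prob_space mu0"
  unfolding mu0_def by (rule prob_space_uniform_measure) auto

interpretation mu0: prob_space mu0
  by (rule prob_space_mu0)

abbreviation obs_space :: "nat \<Rightarrow> (nat \<Rightarrow> real) measure" where
  "obs_space n \<equiv> PiM {..<n} (\<lambda>_. borel)"

lemma sets_mu0 [simp, measurable_cong]: "sets mu0 = sets borel"
  by (simp add: mu0_def)

lemma space_mu0 [simp]: "space mu0 = UNIV"
  by (simp add: mu0_def)

lemma mu0_eq_density: "mu0 = density lborel (indicator {0..1})"
  by (simp add: mu0_def uniform_measure_def divide_ennreal_def)

lemma nn_integral_mu0:
  assumes [measurable]: "f \<in> borel_measurable borel"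
  shows "(\<integral>\<^sup>+x. f x \<partial>mu0) = (\<integral>\<^sup>+x. f x * indicator {0..1} x \<partial>lborel)"
  unfolding mu0_eq_density by (subst nn_integral_density) (auto simp: mult.commute)

lemma AE_mu0: "AE x in mu0. 0 < x \<and> x < 1"
proof -
  have "AE x in lborel. x \<noteq> (0::real)" "AE x in lborel. x \<noteq> (1::real)"
    by (rule AE_lborel_singleton)+
  then have "AE x in lborel. 0 < (indicator {0..1} x :: ennreal) \<longrightarrow> 0 < x \<and> x < (1::real)"
    by eventually_elim (auto simp: indicator_def split: if_splits)
  then show ?thesis
    unfolding mu0_eq_density by (subst AE_density) auto
qed

lemma emeasure_mu0:
  assumes "A \<in> sets borel"
  shows "emeasure mu0 A = emeasure lborel (A \<inter> {0..1})"
  using assms by (simp add: mu0_def emeasure_uniform_measure Int_commute divide_ennreal_def)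

lemma emeasure_mu0_atMost: "emeasure mu0 {..x} = ennreal (max 0 (min 1 x))"
proof -
  have "{..x} \<inter> {0..1} = (if x < 0 then {} else {0..min 1 x})" by auto
  then show ?thesis by (auto simp: emeasure_mu0 min_def max_def)
qed

lemma emeasure_mu0_singleton: "emeasure mu0 {x} = 0"
proof -
  have "emeasure mu0 {x} \<le> emeasure lborel {x}"
    unfolding emeasure_mu0[OF borel_singleton[OF sets.empty_sets]] by (intro emeasure_mono) auto
  then show ?thesis by simp
qed

lemma emeasure_mu0_lessThan: "emeasure mu0 {..<x} = ennreal (max 0 (min 1 x))"
proof -
  have "emeasure mu0 {..x} = emeasure mu0 ({..<x} \<union> {x})"
    by (rule arg_cong[where f="emeasure mu0"]) auto
  also have "\<dots> = emeasure mu0 {..<x} + emeasure mu0 {x}"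
    by (rule plus_emeasure[symmetric]) auto
  finally show ?thesis by (simp add: emeasure_mu0_singleton emeasure_mu0_atMost)
qed

text \<open>The derivative of \<open>Fmix\<close> on (0, 1): the weight in
  \<open>P w * r powr (1 / P w)\<close> cancels against the exponent brought down. The formula stays
  in force outside [0, 1], where shifted arguments above 1 are later inserted.\<close>

definition dens :: "real \<Rightarrow> ('i \<Rightarrow> real) \<Rightarrow> 'i set \<Rightarrow> real \<Rightarrow> real" where
  "dens e P I r = (1 - e) + e * (\<Sum>w\<in>{w\<in>I. 0 < P w}. r powr (1 / P w - 1))"

lemma dens_nonneg: "0 \<le> e \<Longrightarrow> e \<le> 1 \<Longrightarrow> 0 \<le> dens e P I r"
  by (auto simp: dens_def intro!: sum_nonneg add_nonneg_nonneg mult_nonneg_nonneg)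

lemma measurable_dens [measurable]: "dens e P I \<in> borel_measurable borel"
  unfolding dens_def by measurable

lemma sum_pos_part:
  fixes P :: "'i \<Rightarrow> real"
  assumes "finite I" "\<And>i. i \<in> I \<Longrightarrow> 0 \<le> P i"
  shows "(\<Sum>w\<in>{w\<in>I. 0 < P w}. P w) = sum P I"
  using assms by (intro sum.mono_neutral_left) (auto simp: not_less intro: antisym)

abbreviation dens_law :: "real \<Rightarrow> ('i \<Rightarrow> real) \<Rightarrow> 'i set \<Rightarrow> real measure" where
  "dens_law e P I \<equiv> density mu0 (\<lambda>r. ennreal (dens e P I r))"

text \<open>Each exponent \<open>1 / P w - 1\<close> exceeds -1, so the powers integrate from 0 term
  by term; arguments beyond 1 are cut to \<open>y = min 1 x\<close>.\<close>

lemma emeasure_density_dens: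
  assumes I: "finite I" "\<And>i. i \<in> I \<Longrightarrow> 0 \<le> P i" "sum P I = 1" and e: "0 \<le> e" "e \<le> 1"
  shows "emeasure (dens_law e P I) {..x} = ennreal (Fmix e P I x)"
proof -
  let ?g = "\<lambda>y::real. (1 - e) * y + e * (\<Sum>w\<in>{w\<in>I. 0 < P w}. P w * y powr (1 / P w))"
  have "emeasure (dens_law e P I) {..x}
      = (\<integral>\<^sup>+r. ennreal (dens e P I r) * indicator ({..x} \<inter> {0..1}) r \<partial>lborel)"
    by (subst emeasure_density) (auto simp: nn_integral_mu0 mult.assoc simp flip: indicator_inter_arith)
  also have "\<dots> = ennreal (Fmix e P I x)"
  proof (cases "x \<le> 0")
    case True
    \<comment> \<open>At most the null point 0 is left; the factor infinity spares any look at the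
      value of the density there.\<close>
    have "(\<integral>\<^sup>+r. ennreal (dens e P I r) * indicator ({..x} \<inter> {0..1}) r \<partial>lborel)
        \<le> (\<integral>\<^sup>+r. \<infinity> * indicator {0} r \<partial>(lborel :: real measure))"
      using True by (intro nn_integral_mono) (auto split: split_indicator)
    also have "\<dots> = 0" by (subst nn_integral_cmult_indicator) auto
    finally show ?thesis using True by (simp add: Fmix_def F1_def)
  next
    case False
    define y where "y = min 1 x"
    have y: "0 < y" "y \<le> 1" using False by (auto simp: y_def)
    have set: "{..x} \<inter> {0..1} = {0..y}" by (auto simp: y_def)
    have "(dens e P I has_integral ?g y) {0..y}"
      unfolding dens_def
    proof (intro has_integral_add has_integral_mult_right has_integral_sum)
      show "((\<lambda>x. 1 - e) has_integral (1 - e) * y) {0..y}"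
        using has_integral_const_real[of "1 - e" 0 y] y by (simp add: mult.commute)
      fix w assume w: "w \<in> {w \<in> I. 0 < P w}"
      then have "((\<lambda>r. r powr (1 / P w - 1)) has_integral
          y powr (1 / P w - 1 + 1) / (1 / P w - 1 + 1)) {0..y}"
        using y by (intro has_integral_powr_from_0) (auto simp: field_simps)
      then show "((\<lambda>r. r powr (1 / P w - 1)) has_integral P w * y powr (1 / P w)) {0..y}"
        using w by (simp add: field_simps)
    qed (use I in auto)
    then have "(\<integral>\<^sup>+r. ennreal (dens e P I r) * indicator {0..y} r \<partial>lborel) = ennreal (?g y)"
      using dens_nonneg[OF e, of P I] by (intro nn_integral_has_integral_lebesgue')
    also have "?g y = Fmix e P I x"
      using False sum_pos_part[OF I(1,2)] I(3) by (auto simp: Fmix_def F1_def y_def min_def)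
    finally show ?thesis by (simp only: set)
  qed
  finally show ?thesis .
qed

lemma Fmix_nonneg:
  assumes "finite I" "\<And>i. i \<in> I \<Longrightarrow> 0 \<le> P i" "0 \<le> e" "e \<le> 1"
  shows "0 \<le> Fmix e P I x"
  unfolding Fmix_def F1_def using assms
  by (auto intro!: sum_nonneg add_nonneg_nonneg mult_nonneg_nonneg)

text \<open>\<open>mix_measure\<close> is an \<open>interval_measure\<close>, which is understood
  only for monotone right-continuous functions with the right limits. These properties are inherited
  from the cdf of the density, which equals \<open>Fmix\<close>, and uniqueness of a law with given
  cdf identifies the two measures.\<close>

lemma
  assumes I: "finite I" "\<And>i. i \<in> I \<Longrightarrow> 0 \<le> P i" "sum P I = 1" and e: "0 \<le> e" "e \<le> 1"
  shows real_distribution_density_dens: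
      "real_distribution (dens_law e P I)" (is ?A)
    and cdf_density_dens: "cdf (dens_law e P I) = Fmix e P I" (is ?C)
    and mix_measure_eq: "mix_measure e P I = dens_law e P I" (is ?B)
proof -
  let ?N = "dens_law e P I"
  have "AE x in ?N. x \<le> 1"
    using AE_mu0 by (subst AE_density) auto
  then have "emeasure ?N (space ?N) = emeasure ?N {..1}"
    by (intro emeasure_eq_AE) auto
  also have "\<dots> = 1"
    using emeasure_density_dens[OF I e, of 1] by (simp add: Fmix_def F1_def)
  finally interpret N: prob_space ?N by (rule prob_spaceI)
  show ?A by unfold_locales auto
  then interpret N: real_distribution ?N .
  show F: ?C
    using emeasure_density_dens[OF I e] Fmix_nonneg[OF I(1,2) e]
    by (simp add: cdf_def measure_def fun_eq_iff)
  have "interval_measure (cdf ?N) = ?N"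
  proof (rule cdf_unique)
    show "real_distribution (interval_measure (cdf ?N))"
      by (intro real_distribution_interval_measure N.cdf_nondecreasing N.cdf_is_right_cont
        N.cdf_lim_at_bot N.cdf_lim_at_top_prob)
    show "cdf (interval_measure (cdf ?N)) = cdf ?N"
      by (intro cdf_interval_measure N.cdf_nondecreasing N.cdf_is_right_cont N.cdf_lim_at_bot)
  qed unfold_locales
  then show ?B by (simp add: mix_measure_def F)
qed

lemma prob_space_density_dens:
  assumes "finite I" "\<And>i. i \<in> I \<Longrightarrow> 0 \<le> P i" "sum P I = 1" "0 \<le> e" "e \<le> 1"
  shows "prob_space (dens_law e P I)"
  using real_distribution_density_dens[OF assms] by (simp add: real_distribution_def)

section \<open>Law of the pivotal statistic\<close>

type_synonym 'w step = "('w \<Rightarrow> real) \<times> ('w \<Rightarrow> real) \<times> 'w"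
type_synonym 'w traj = "nat \<Rightarrow> 'w step"

definition xi_law :: "('w::finite \<Rightarrow> real) measure" where
  "xi_law = PiM UNIV (\<lambda>_. mu0)"

lemma sets_xi_law [simp, measurable_cong]: "sets xi_law = sets vec_space"
  unfolding xi_law_def vec_space_def by (intro sets_PiM_cong) auto

lemma space_vec_space [simp]: "space vec_space = UNIV"
  by (simp add: vec_space_def space_PiM)

lemma space_xi_law [simp]: "space xi_law = UNIV"
  by (simp add: xi_law_def space_PiM)

lemma prob_space_xi_law: "prob_space xi_law"
  unfolding xi_law_def by (intro prob_space_PiM prob_space_mu0)

interpretation Q: prob_space xi_law
  by (rule prob_space_xi_law)

lemma emeasure_xi_law_UNIV [simp]: "emeasure xi_law UNIV = 1"
  using Q.emeasure_space_1 by simp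

lemma AE_xi_law: "AE \<xi> in xi_law. \<forall>w\<in>UNIV. 0 < \<xi> w \<and> \<xi> w < 1"
  unfolding xi_law_def
  by (intro AE_finite_allI AE_PiM_component[OF prob_space_mu0 _ AE_mu0]) auto

lemma measurable_vec_component: "(\<lambda>f. f w) \<in> borel_measurable vec_space"
  unfolding vec_space_def by measurable

lemma measurable_vec_apply: "f \<in> M \<rightarrow>\<^sub>M vec_space \<Longrightarrow> (\<lambda>x. f x w) \<in> borel_measurable M"
  by (rule measurable_compose[OF _ measurable_vec_component])

lemma decoder_eq:
  "decoder P \<xi> = (SOME x. x \<in> {w. 0 < P w \<and> \<not> (\<exists>v. 0 < P v \<and> ln (\<xi> w) / P w < ln (\<xi> v) / P v)})"
  by (simp add: decoder_def arg_max_on_def arg_max_def is_arg_max_def)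

text \<open>The set of maximisers \<open>T x\<close> takes values in a finite powerset, so it
  suffices that its fibres are measurable; choosing an element is then a map on a discrete space,
  measurable whatever \<open>SOME\<close> picks.\<close>

lemma measurable_decoder [measurable]:
  assumes [measurable]: "f \<in> M \<rightarrow>\<^sub>M vec_space" "g \<in> M \<rightarrow>\<^sub>M vec_space"
  shows "(\<lambda>x. decoder (f x) (g x) :: 'w::finite) \<in> M \<rightarrow>\<^sub>M count_space UNIV"
proof -
  have [measurable]: "(\<lambda>x. f x w) \<in> borel_measurable M" "(\<lambda>x. g x w) \<in> borel_measurable M" for w
    by (rule measurable_vec_apply, fact)+
  define T :: "'a \<Rightarrow> 'w set" where
    "T x = {w. 0 < f x w \<and> \<not> (\<exists>v. 0 < f x v \<and> ln (g x w) / f x w < ln (g x v) / f x v)}" for x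
  have "T \<in> M \<rightarrow>\<^sub>M count_space UNIV"
  proof (subst measurable_count_space_eq2)
    have "T -` {S} \<inter> space M = {x\<in>space M. \<forall>w. w \<in> S \<longleftrightarrow>
        (0 < f x w \<and> \<not> (\<exists>v. 0 < f x v \<and> ln (g x w) / f x w < ln (g x v) / f x v))}" for S
      by (auto simp: T_def set_eq_iff)
    also have "\<dots> S \<in> sets M" for S by measurable
    finally show "T \<in> space M \<rightarrow> UNIV \<and> (\<forall>a\<in>UNIV. T -` {a} \<inter> space M \<in> sets M)" by auto
  qed simp
  then have "(\<lambda>x. (\<lambda>S. SOME w. w \<in> S) (T x)) \<in> M \<rightarrow>\<^sub>M count_space UNIV"
    by (rule measurable_compose) simp
  then show ?thesis by (simp add: decoder_eq T_def)
qed

lemma ex_arg_max: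
  fixes f :: "'w::finite \<Rightarrow> real"
  assumes "0 < P (w0::'w)"
  shows "\<exists>w. 0 < (P w :: real) \<and> \<not> (\<exists>v. 0 < P v \<and> f w < f v)"
proof -
  let ?S = "{w. 0 < P w}"
  have "Max (f ` ?S) \<in> f ` ?S" using assms by (intro Max_in) auto
  then obtain w where w: "w \<in> ?S" "Max (f ` ?S) = f w" by auto
  then have "f v \<le> f w" if "v \<in> ?S" for v
    unfolding w(2)[symmetric] using that by (intro Max_ge) auto
  then show ?thesis using w by (force simp: not_less)
qed

text \<open>The choice in \<open>decoder\<close> is meaningful: the entries sum to 1, so the support
  is nonempty, and being finite it has a maximiser.\<close>

lemma decoder_arg_max:
  assumes "prob_vec P"
  shows "0 < P (decoder P \<xi>) \<and>
    \<not> (\<exists>v. 0 < P v \<and> ln (\<xi> (decoder P \<xi>)) / P (decoder P \<xi>) < ln (\<xi> v) / P v)"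
proof -
  have "\<exists>w. 0 < P w"
  proof (rule ccontr)
    assume "\<nexists>w. 0 < P w"
    then have "(\<Sum>w\<in>UNIV. P w) \<le> 0" by (intro sum_nonpos) (auto simp: not_less)
    then show False using assms by (simp add: prob_vec_def)
  qed
  then obtain w0 where "0 < P w0" ..
  from someI_ex[OF ex_arg_max[of P w0 "\<lambda>w. ln (\<xi> w) / P w", OF this]] show ?thesis
    unfolding decoder_eq by simp
qed

lemma nn_integral_powr_mu0:
  assumes "0 < p" "0 < r" "r \<le> 1"
  shows "(\<integral>\<^sup>+y. ennreal (y powr (1 / p - 1)) * indicator {..r} y \<partial>mu0) = ennreal (p * r powr (1 / p))"
proof -
  have "((\<lambda>y. y powr (1 / p - 1)) has_integral r powr (1 / p - 1 + 1) / (1 / p - 1 + 1)) {0..r}"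
    using assms by (intro has_integral_powr_from_0) auto
  then have "((\<lambda>y. y powr (1 / p - 1)) has_integral p * r powr (1 / p)) {0..r}"
    by (simp add: field_simps)
  from nn_integral_has_integral_lebesgue'[OF _ this]
  have "ennreal (p * r powr (1 / p)) = (\<integral>\<^sup>+y. ennreal (y powr (1 / p - 1)) * indicator {0..r} y \<partial>lborel)"
    by simp
  also have "\<dots> = (\<integral>\<^sup>+y. ennreal (y powr (1 / p - 1)) * indicator {..r} y \<partial>mu0)"
    using assms by (subst nn_integral_mu0) (auto intro!: nn_integral_cong split: split_indicator)
  finally show ?thesis by simp
qed

text \<open>For \<open>q > 0\<close> the condition places \<open>u\<close> below
  \<open>y powr (q / p)\<close>, as \<open>ln\<close> is increasing. Treating \<open><\<close> and
  \<open>\<le>\<close> together prepares the sandwich for ties; \<open>q = 0\<close> is a void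
  condition of probability \<open>y powr 0\<close>.\<close>

lemma emeasure_mu0_ln_le:
  assumes y: "0 < y" "y < 1" and pq: "0 \<le> q" "0 < p"
    and R: "R = (<) \<or> R = (\<le>)"
  shows "emeasure mu0 {u. 0 < q \<longrightarrow> R (ln u / q) (ln y / p)} = ennreal (y powr (q / p))"
proof (cases "q = 0")
  case True
  show ?thesis using y True mu0.emeasure_space_1 by simp
next
  case False
  then have q: "0 < q" using pq by simp
  define z where "z = y powr (q / p)"
  have z: "0 < z" "z < 1" using y q pq powr_less_mono2[of "q / p" y 1] by (auto simp: z_def)
  have "(ln u / q < ln y / p) = (u < z)" "(ln u / q \<le> ln y / p) = (u \<le> z)" if "0 < u" for u
  proof -
    have "ln z = q / p * ln y" using y by (simp add: z_def ln_powr)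
    then have "(ln u / q < ln y / p) = (ln u < ln z)" "(ln u / q \<le> ln y / p) = (ln u \<le> ln z)"
    proof -
      have "ln y / p = ln z / q" using \<open>ln z = q / p * ln y\<close> q by simp
      then show "(ln u / q < ln y / p) = (ln u < ln z)" "(ln u / q \<le> ln y / p) = (ln u \<le> ln z)"
        using q by (simp_all add: divide_less_cancel divide_le_cancel)
    qed
    then show "(ln u / q < ln y / p) = (u < z)" "(ln u / q \<le> ln y / p) = (u \<le> z)"
      using that z by simp_all
  qed
  then have "emeasure mu0 {u. 0 < q \<longrightarrow> R (ln u / q) (ln y / p)} = emeasure mu0 {u. R u z}"
    using R q AE_mu0 by (intro emeasure_eq_AE) (auto elim!: eventually_mono)
  also have "\<dots> = ennreal z"
    using R z emeasure_mu0_atMost[of z] emeasure_mu0_lessThan[of z]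
    by (auto simp: lessThan_def atMost_def)
  finally show ?thesis by (simp add: z_def)
qed

text \<open>The event that \<open>w\<close> beats all other tokens of positive probability, strictly
  or weakly according to \<open>R\<close>. Under ties the decoder is an unspecified choice, and its
  event lies between the two versions.\<close>

definition win :: "('w::finite \<Rightarrow> real) \<Rightarrow> 'w \<Rightarrow> real \<Rightarrow> (real \<Rightarrow> real \<Rightarrow> bool) \<Rightarrow> ('w \<Rightarrow> real) set" where
  "win P w r R = {\<xi>. \<xi> w \<le> r \<and> (\<forall>v. v \<noteq> w \<longrightarrow> 0 < P v \<longrightarrow> R (ln (\<xi> v) / P v) (ln (\<xi> w) / P w))}"

lemma sets_win:
  fixes P :: "'w::finite \<Rightarrow> real"
  assumes R: "R = (<) \<or> R = (\<le>)"
  shows "win P w r R \<in> sets vec_space"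
proof -
  have [measurable]: "Measurable.pred M (\<lambda>x. R (f x) (g x))"
    if "f \<in> borel_measurable M" "g \<in> borel_measurable M" for f g :: "'x \<Rightarrow> real" and M
    using R that by auto
  note measurable_vec_component[measurable]
  have "Measurable.pred vec_space (\<lambda>\<xi>. \<xi> w \<le> r \<and> (\<forall>v. v \<noteq> w \<longrightarrow> 0 < P v \<longrightarrow> R (ln (\<xi> v) / P v) (ln (\<xi> w) / P w)))"
    by measurable
  then show ?thesis unfolding pred_def win_def by simp
qed

text \<open>Fubini in the coordinate \<open>w\<close>: given \<open>\<xi> w = y\<close>, the other
  coordinates are independent and lose with probabilities \<open>y powr (P v / P w)\<close>. Their
  product is \<open>y powr (1 / P w - 1)\<close> because the remaining entries sum to
  \<open>1 - P w\<close>.\<close>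

lemma emeasure_xi_law_win:
  fixes P :: "'w::finite \<Rightarrow> real"
  assumes P: "prob_vec P" and w: "0 < P w" and r: "0 < r" "r \<le> 1"
    and R: "R = (<) \<or> R = (\<le>)"
  shows "emeasure xi_law (win P w r R)
    = ennreal (P w * r powr (1 / P w))"
proof -
  interpret product_sigma_finite "\<lambda>_::'w. mu0" by unfold_locales
  let ?I = "UNIV - {w}"
  define E where "E = win P w r R"
  have [measurable]: "Measurable.pred M (\<lambda>x. R (f x) (g x))"
    if "f \<in> borel_measurable M" "g \<in> borel_measurable M" for f g :: "'x \<Rightarrow> real" and M
    using R that by auto
  have E: "E \<in> sets vec_space" unfolding E_def by (rule sets_win[OF R])
  have P': "0 \<le> P v" "sum P UNIV = 1" for v using P by (auto simp: prob_vec_def)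
  define G where "G y v = {u. 0 < P v \<longrightarrow> R (ln u / P v) (ln y / P w)}" for y v
  have G[measurable]: "G y v \<in> sets borel" for y v unfolding G_def by measurable
  let ?g = "\<lambda>y v. indicator (G y v) :: real \<Rightarrow> ennreal"
  have ins: "insert w ?I = UNIV" by auto
  have "emeasure xi_law E = (\<integral>\<^sup>+\<xi>. indicator E \<xi> \<partial>PiM (insert w ?I) (\<lambda>_. mu0))"
    unfolding ins xi_law_def[symmetric] using E by simp
  also have "\<dots> = (\<integral>\<^sup>+y. (\<integral>\<^sup>+x. indicator E (x(w := y)) \<partial>PiM ?I (\<lambda>_. mu0)) \<partial>mu0)"
    proof (rule product_nn_integral_insert_rev)
    have "sets (PiM (insert w ?I) (\<lambda>_. mu0)) = sets vec_space"
      unfolding ins by (simp add: xi_law_def[symmetric])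
    then show "indicator E \<in> borel_measurable (PiM (insert w ?I) (\<lambda>_. mu0))"
      using E by (intro borel_measurable_indicator) simp
  qed auto
  also have "\<dots> = (\<integral>\<^sup>+y. ennreal (y powr (1 / P w - 1)) * indicator {..r} y \<partial>mu0)"
  proof (intro nn_integral_cong_AE, use AE_mu0 in eventually_elim)
    case (elim y)
    have "(\<integral>\<^sup>+x. indicator E (x(w := y)) \<partial>PiM ?I (\<lambda>_. mu0))
        = (\<integral>\<^sup>+x. indicator {..r} y * (\<Prod>v\<in>?I. ?g y v (x v)) \<partial>PiM ?I (\<lambda>_. mu0))"
    proof (rule nn_integral_cong)
      fix x :: "'w \<Rightarrow> real"
      have "indicator E (x(w := y)) = (indicator {..r} y * (if \<forall>v\<in>?I. x v \<in> G y v then 1 else 0) :: ennreal)"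
      proof -
        have "x(w := y) \<in> E \<longleftrightarrow> y \<le> r \<and> (\<forall>v\<in>?I. x v \<in> G y v)"
          by (simp add: E_def win_def G_def Ball_def)
        then show ?thesis by (simp add: indicator_def)
      qed
      also have "(if \<forall>v\<in>?I. x v \<in> G y v then 1 else 0) = (\<Prod>v\<in>?I. ?g y v (x v))"
      proof (cases "\<forall>v\<in>?I. x v \<in> G y v")
        case False
        then obtain v where "v \<in> ?I" "x v \<notin> G y v" by blast
        then have "(\<Prod>v\<in>?I. ?g y v (x v)) = 0" by (intro prod_zero) (auto intro!: bexI[of _ v])
        with False show ?thesis by simp
      qed simp
      finally show "indicator E (x(w := y)) = indicator {..r} y * (\<Prod>v\<in>?I. ?g y v (x v))" .
    qed
    also have "\<dots> = indicator {..r} y * (\<integral>\<^sup>+x. (\<Prod>v\<in>?I. ?g y v (x v)) \<partial>PiM ?I (\<lambda>_. mu0))"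
    proof (rule nn_integral_cmult)
      show "(\<lambda>x. \<Prod>v\<in>?I. ?g y v (x v)) \<in> borel_measurable (PiM ?I (\<lambda>_. mu0))"
      proof (rule borel_measurable_prod_ennreal)
        fix v assume v: "v \<in> ?I"
        show "(\<lambda>x. ?g y v (x v)) \<in> borel_measurable (PiM ?I (\<lambda>_. mu0))"
          by (rule measurable_compose[OF measurable_component_singleton[OF v] borel_measurable_indicator])
            (simp add: G)
      qed
    qed
    also have "(\<integral>\<^sup>+x. (\<Prod>v\<in>?I. ?g y v (x v)) \<partial>PiM ?I (\<lambda>_. mu0)) = (\<Prod>v\<in>?I. \<integral>\<^sup>+u. ?g y v u \<partial>mu0)"
      using G by (intro product_nn_integral_prod borel_measurable_indicator) auto
    also have "\<dots> = (\<Prod>v\<in>?I. ennreal (y powr (P v / P w)))"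
    proof (intro prod.cong refl)
      fix v
      show "(\<integral>\<^sup>+u. ?g y v u \<partial>mu0) = ennreal (y powr (P v / P w))"
        using emeasure_mu0_ln_le[OF _ _ P'(1) w R, of y v] elim G by (simp add: G_def)
    qed
    also have "\<dots> = ennreal (y powr (1 / P w - 1))"
    proof -
      have "(\<Sum>v\<in>?I. P v / P w) = 1 / P w - 1"
        using P' w by (simp add: sum_diff1 sum_divide_distrib[symmetric] field_simps)
      then show ?thesis using elim by (simp add: prod_ennreal powr_sum[symmetric])
    qed
    finally show ?case by (simp only: mult.commute)
  qed
  also have "\<dots> = ennreal (P w * r powr (1 / P w))"
    using w r by (rule nn_integral_powr_mu0)
  finally show ?thesis by (simp add: E_def)
qed

lemma measurable_decoder_const: "decoder P \<in> vec_space \<rightarrow>\<^sub>M count_space UNIV"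
proof -
  have "(\<lambda>_. P) \<in> vec_space \<rightarrow>\<^sub>M vec_space" by (rule measurable_const) simp
  from measurable_decoder[OF this measurable_ident_sets[OF refl]] show ?thesis .
qed

lemma measurable_eval_decoder: "(\<lambda>\<xi>. \<xi> (decoder P \<xi>)) \<in> borel_measurable vec_space"
proof -
  have "(\<lambda>\<xi>. (\<lambda>w \<xi>. \<xi> w) (decoder P \<xi>) \<xi>) \<in> borel_measurable vec_space"
    by (rule measurable_compose_countable[OF measurable_vec_component measurable_decoder_const])
  then show ?thesis by simp
qed

lemma sets_decoder_le: "{\<xi>. decoder P \<xi> = w \<and> \<xi> w \<le> r} \<in> sets vec_space"
proof -
  have "{\<xi>. decoder P \<xi> = w \<and> \<xi> w \<le> r}
      = (decoder P -` {w} \<inter> space vec_space) \<inter> ((\<lambda>\<xi>. \<xi> w) -` {..r} \<inter> space vec_space)"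
    by auto
  also have "\<dots> \<in> sets vec_space"
    by (intro sets.Int measurable_sets[OF measurable_decoder_const] measurable_sets[OF measurable_vec_component]) auto
  finally show ?thesis .
qed

text \<open>A strict winner is decoded and a decoded token is a weak winner, while both bounding
  events have the same probability. This settles ties without a separate null-set argument.\<close>

lemma emeasure_xi_law_decoder:
  fixes P :: "'w::finite \<Rightarrow> real"
  assumes P: "prob_vec P" and r: "0 < r" "r \<le> 1"
  shows "emeasure xi_law {\<xi>. decoder P \<xi> = w \<and> \<xi> w \<le> r}
    = (if 0 < P w then ennreal (P w * r powr (1 / P w)) else 0)"
proof (cases "0 < P w")
  case True
  let ?W = "win P w r"
  have W: "?W (\<le>) \<in> sets vec_space" by (rule sets_win) simp
  let ?D = "{\<xi>. decoder P \<xi> = w \<and> \<xi> w \<le> r}"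
  have D: "?D \<in> sets vec_space" by (rule sets_decoder_le)
  have "?D \<subseteq> ?W (\<le>)"
    unfolding win_def
  proof safe
    fix \<xi> v assume "w = decoder P \<xi>" "0 < P v"
    then show "ln (\<xi> v) / P v \<le> ln (\<xi> (decoder P \<xi>)) / P (decoder P \<xi>)"
      using decoder_arg_max[OF P, of \<xi>] by (meson not_less)
  qed
  then have "emeasure xi_law ?D \<le> emeasure xi_law (?W (\<le>))"
    using W by (intro emeasure_mono) simp_all
  moreover have "?W (<) \<subseteq> ?D"
    unfolding win_def
  proof safe
    fix \<xi> assume *: "\<forall>v. v \<noteq> w \<longrightarrow> 0 < P v \<longrightarrow> ln (\<xi> v) / P v < ln (\<xi> w) / P w"
    show "decoder P \<xi> = w"
    proof (rule ccontr)
      assume "decoder P \<xi> \<noteq> w"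
      with * decoder_arg_max[OF P, of \<xi>] True show False by meson
    qed
  qed
  then have "emeasure xi_law (?W (<)) \<le> emeasure xi_law ?D"
    using D by (intro emeasure_mono) simp_all
  ultimately show ?thesis
    using emeasure_xi_law_win[OF P True r, of "(<)"] emeasure_xi_law_win[OF P True r, of "(\<le>)"] True
    by simp
next
  case False
  then have "{\<xi>. decoder P \<xi> = w \<and> \<xi> w \<le> r} = {}"
    using decoder_arg_max[OF P] by auto
  then show ?thesis using False by (simp only: emeasure_empty if_False)
qed

lemma distr_xi_law_component: "distr xi_law borel (\<lambda>\<xi>. \<xi> w) = mu0"
proof -
  have "distr xi_law borel (\<lambda>\<xi>. \<xi> w) = distr xi_law mu0 (\<lambda>\<xi>. \<xi> w)"
    by (rule distr_cong) auto
  also have "\<dots> = mu0" unfolding xi_law_def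
    by (rule distr_PiM_component) (auto intro: prob_space_mu0)
  finally show ?thesis .
qed

text \<open>The cdfs are compared on (0, 1], where the event splits over the decoded token;
  elsewhere almost sure membership in (0, 1) decides.\<close>

lemma distr_xi_law_decoder:
  fixes P :: "'w::finite \<Rightarrow> real"
  assumes P: "prob_vec P"
  shows "distr xi_law borel (\<lambda>\<xi>. \<xi> (decoder P \<xi>)) = dens_law 1 P UNIV"
    (is "?L = ?R")
proof (rule cdf_unique)
  have P': "0 \<le> P v" "sum P UNIV = 1" for v using P by (auto simp: prob_vec_def)
  note m[measurable] = measurable_eval_decoder[of P]
  interpret L: prob_space ?L by (rule Q.prob_space_distr) simp
  show rL: "real_distribution ?L" by unfold_locales auto
  show rR: "real_distribution ?R" by (rule real_distribution_density_dens) (use P' in auto)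
  have R: "emeasure ?R {..r} = ennreal (F1 P UNIV r)" for r
    using emeasure_density_dens[of UNIV P 1 r] P' by (simp add: Fmix_def)
  have "emeasure ?L {..r} = ennreal (F1 P UNIV r)" if r: "0 < r" "r \<le> 1" for r
  proof -
    have D: "{\<xi>. decoder P \<xi> = w \<and> \<xi> w \<le> r} \<in> sets vec_space" for w
      by (rule sets_decoder_le)
    have "emeasure ?L {..r} = emeasure xi_law (\<Union>w. {\<xi>. decoder P \<xi> = w \<and> \<xi> w \<le> r})"
      by (subst emeasure_distr) (auto intro!: arg_cong2[where f=emeasure])
    also have "\<dots> = (\<Sum>w\<in>UNIV. emeasure xi_law {\<xi>. decoder P \<xi> = w \<and> \<xi> w \<le> r})"
      using D by (intro sum_emeasure[symmetric]) (auto simp: disjoint_family_on_def)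
    also have "\<dots> = (\<Sum>w\<in>UNIV. ennreal (P w * r powr (1 / P w)))"
      using P' by (intro sum.cong) (auto simp: emeasure_xi_law_decoder[OF P r] not_less intro: antisym)
    also have "\<dots> = ennreal (\<Sum>w\<in>UNIV. P w * r powr (1 / P w))"
      using P' by (intro sum_ennreal) auto
    also have "(\<Sum>w\<in>UNIV. P w * r powr (1 / P w)) = F1 P UNIV r"
    \<comment> \<open>At \<open>r = 1\<close> the constant branch of \<open>F1\<close> applies; it
      agrees with the total mass of \<open>P\<close>.\<close>
    proof (cases "r = 1")
      case False
      have "(\<Sum>w\<in>{w\<in>UNIV. 0 < P w}. P w * r powr (1 / P w)) = (\<Sum>i\<in>UNIV. P i * r powr (1 / P i))"
        using P' by (intro sum.mono_neutral_left) (auto simp: not_less intro: antisym)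
      then show ?thesis using False r by (simp add: F1_def)
    qed (use P' in \<open>simp add: F1_def\<close>)
    finally show ?thesis .
  qed
  then have eq: "emeasure ?L {..r} = emeasure ?R {..r}" if "0 < r" "r \<le> 1" for r
    using R that by simp
  have "AE \<xi> in xi_law. 0 < \<xi> (decoder P \<xi>) \<and> \<xi> (decoder P \<xi>) < 1"
    using AE_xi_law by eventually_elim blast
  then have AE: "AE y in ?L. 0 < y \<and> y < 1"
    using m by (subst AE_distr_iff) (simp_all cong: measurable_cong_sets)
  have "emeasure ?L {..r} = emeasure ?R {..r}" for r
  proof -
    consider "0 < r" "r \<le> 1" | "r \<le> 0" | "1 < r" by linarith
    then show ?thesis
    proof cases
      case 2
      have "emeasure ?L {..r} = emeasure ?L {}"
        using AE 2 by (intro emeasure_eq_AE) auto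
      then show ?thesis using 2 R[of r] by (simp add: F1_def)
    next
      case 3
      have "emeasure ?L {..r} = emeasure ?L {..1}"
        using AE 3 by (intro emeasure_eq_AE) auto
      then show ?thesis using 3 eq[of 1] R[of 1] R[of r] by (simp add: F1_def)
    qed (rule eq)
  qed
  then show "cdf ?L = cdf ?R" by (simp add: cdf_def measure_def fun_eq_iff)
qed

text \<open>The conditional probability of emitting \<open>w\<close> given the past,
  \<open>P\<close> and \<open>\<xi>\<close>; it is the integrand in the last clause of
  \<open>gw_model\<close>.\<close>

definition tok_weight :: "real \<Rightarrow> ('w::finite \<Rightarrow> real) \<Rightarrow> ('w \<Rightarrow> real) \<Rightarrow> 'w \<Rightarrow> real" where
  "tok_weight e P \<xi> w = e * (if decoder P \<xi> = w then 1 else 0) + (1 - e) * P w"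

lemma tok_weight_nonneg: "prob_vec P \<Longrightarrow> 0 \<le> e \<Longrightarrow> e \<le> 1 \<Longrightarrow> 0 \<le> tok_weight e P \<xi> w"
  by (auto simp: tok_weight_def prob_vec_def)

lemma sum_tok_weight: "prob_vec P \<Longrightarrow> (\<Sum>w\<in>UNIV. tok_weight e P \<xi> w) = 1"
  by (simp add: tok_weight_def prob_vec_def sum.distrib sum_distrib_left[symmetric])

lemma tok_weight_le_1: "prob_vec P \<Longrightarrow> 0 \<le> e \<Longrightarrow> e \<le> 1 \<Longrightarrow> tok_weight e P \<xi> w \<le> 1"
  using member_le_sum[of w UNIV "tok_weight e P \<xi>"] sum_tok_weight[of P e \<xi>]
  by (simp add: tok_weight_nonneg)

text \<open>Translates the Bochner set integral of the token clause into a nonnegative integral. The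
  bounds are almost sure because the next-token vectors are admissible only almost surely.\<close>

lemma (in prob_space) nn_integral_unit_weight:
  assumes A: "A \<in> sets M" and W: "W \<in> borel_measurable M" and bound: "AE x in M. 0 \<le> W x \<and> W x \<le> 1"
  shows "(\<integral>\<^sup>+x. ennreal (W x) * indicator A x \<partial>M) = ennreal (\<integral>x\<in>A. W x \<partial>M)"
    and "0 \<le> (\<integral>x\<in>A. W x \<partial>M)"
proof -
  have nonneg: "AE x in M. 0 \<le> indicator A x * W x"
    using bound by eventually_elim (simp add: indicator_def)
  have int: "integrable M (\<lambda>x. indicator A x * W x)"
  proof (rule integrable_const_bound[of _ 1])
    show "AE x in M. norm (indicator A x * W x) \<le> 1"
      using bound by eventually_elim (simp add: indicator_def)
  qed (use A W in simp)
  have "(\<integral>\<^sup>+x. ennreal (W x) * indicator A x \<partial>M) = (\<integral>\<^sup>+x. ennreal (indicator A x * W x) \<partial>M)"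
    by (intro nn_integral_cong) (simp add: indicator_def)
  also have "\<dots> = ennreal (\<integral>x. indicator A x * W x \<partial>M)"
    by (rule nn_integral_eq_integral[OF int nonneg])
  finally show "(\<integral>\<^sup>+x. ennreal (W x) * indicator A x \<partial>M) = ennreal (\<integral>x\<in>A. W x \<partial>M)"
    by (simp add: set_lebesgue_integral_def)
  show "0 \<le> (\<integral>x\<in>A. W x \<partial>M)"
    using integral_nonneg_AE[OF nonneg] by (simp add: set_lebesgue_integral_def)
qed

lemma measurable_tok_weight [measurable]:
  assumes [measurable]: "f \<in> M \<rightarrow>\<^sub>M vec_space" "g \<in> M \<rightarrow>\<^sub>M vec_space"
  shows "(\<lambda>x. tok_weight e (f x) (g x) w) \<in> borel_measurable M"
proof -
  have [measurable]: "(\<lambda>x. f x w) \<in> borel_measurable M" for w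
    by (rule measurable_vec_apply) fact
  show ?thesis unfolding tok_weight_def by measurable
qed

text \<open>With weight \<open>e\<close> the observed coordinate is the decoded one, of density
  \<open>dens 1 P UNIV\<close>; otherwise it is chosen without regard to \<open>\<xi>\<close>, hence
  uniform. Values in \<open>ennreal\<close> are allowed because the later test function is infinite
  on part of the line.\<close>

lemma nn_integral_xi_law_tok_weight:
  fixes P :: "'w::finite \<Rightarrow> real"
  assumes P: "prob_vec P" and e: "0 \<le> e" "e \<le> 1" and [measurable]: "h \<in> borel_measurable borel"
  shows "(\<integral>\<^sup>+\<xi>. (\<Sum>w\<in>UNIV. ennreal (tok_weight e P \<xi> w) * h (\<xi> w)) \<partial>xi_law)
    = (\<integral>\<^sup>+y. h y \<partial>dens_law e P UNIV)"
proof -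
  have P': "0 \<le> P v" "sum P UNIV = 1" for v using P by (auto simp: prob_vec_def)
  have dens_meas: "(\<lambda>r. ennreal (dens e P UNIV r)) \<in> borel_measurable mu0" for e
    by measurable
  have h_meas: "h \<in> borel_measurable mu0" by measurable
  have dec_meas: "(\<lambda>\<xi>. h (\<xi> (decoder P \<xi>))) \<in> borel_measurable xi_law"
    using measurable_compose[OF measurable_eval_decoder assms(4), of P]
    by (simp cong: measurable_cong_sets)
  have [measurable]: "(\<lambda>\<xi>. h (\<xi> w)) \<in> borel_measurable vec_space" for w
    by (rule measurable_compose[OF measurable_vec_component]) fact
  have "(\<Sum>w\<in>UNIV. ennreal (tok_weight e P \<xi> w) * h (\<xi> w))
      = ennreal e * h (\<xi> (decoder P \<xi>)) + (\<Sum>w\<in>UNIV. ennreal ((1 - e) * P w) * h (\<xi> w))" for \<xi>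
  proof -
    have "(\<Sum>w\<in>UNIV. ennreal (tok_weight e P \<xi> w) * h (\<xi> w))
        = (\<Sum>w\<in>UNIV. (if w = decoder P \<xi> then ennreal e * h (\<xi> w) else 0) + ennreal ((1 - e) * P w) * h (\<xi> w))"
    proof (intro sum.cong refl)
      fix w
      have "ennreal (e + (1 - e) * P w) = ennreal e + ennreal ((1 - e) * P w)"
        using e P' by (intro ennreal_plus) auto
      then show "ennreal (tok_weight e P \<xi> w) * h (\<xi> w)
        = (if w = decoder P \<xi> then ennreal e * h (\<xi> w) else 0) + ennreal ((1 - e) * P w) * h (\<xi> w)"
        by (auto simp: tok_weight_def distrib_right)
    qed
    then show ?thesis by (simp add: sum.distrib)
  qed
  then have split: "(\<integral>\<^sup>+\<xi>. (\<Sum>w\<in>UNIV. ennreal (tok_weight e P \<xi> w) * h (\<xi> w)) \<partial>xi_law)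
      = ennreal e * (\<integral>\<^sup>+\<xi>. h (\<xi> (decoder P \<xi>)) \<partial>xi_law)
        + (\<Sum>w\<in>UNIV. ennreal ((1 - e) * P w) * (\<integral>\<^sup>+\<xi>. h (\<xi> w) \<partial>xi_law))"
    using dec_meas by (simp add: nn_integral_add nn_integral_sum nn_integral_cmult)
  have "(\<integral>\<^sup>+\<xi>. h (\<xi> (decoder P \<xi>)) \<partial>xi_law) = (\<integral>\<^sup>+y. h y \<partial>dens_law 1 P UNIV)"
    unfolding distr_xi_law_decoder[OF P, symmetric]
    by (subst nn_integral_distr) (use measurable_eval_decoder assms(4) in \<open>simp_all cong: measurable_cong_sets\<close>)
  also have "\<dots> = (\<integral>\<^sup>+y. ennreal (dens 1 P UNIV y) * h y \<partial>mu0)"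
    by (rule nn_integral_density[OF dens_meas h_meas])
  finally have dec: "(\<integral>\<^sup>+\<xi>. h (\<xi> (decoder P \<xi>)) \<partial>xi_law) = (\<integral>\<^sup>+y. ennreal (dens 1 P UNIV y) * h y \<partial>mu0)" .
  have comp: "(\<integral>\<^sup>+\<xi>. h (\<xi> w) \<partial>xi_law) = (\<integral>\<^sup>+y. h y \<partial>mu0)" for w
    unfolding distr_xi_law_component[of w, symmetric]
    by (subst nn_integral_distr) (use measurable_vec_component assms(4) in \<open>simp_all cong: measurable_cong_sets\<close>)
  have "(\<Sum>w\<in>UNIV. ennreal ((1 - e) * P w) * (\<integral>\<^sup>+y. h y \<partial>mu0)) = ennreal (1 - e) * (\<integral>\<^sup>+y. h y \<partial>mu0)"
    using e P' by (simp add: sum_distrib_right[symmetric] sum_ennreal sum_distrib_left[symmetric])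
  then have "(\<integral>\<^sup>+\<xi>. (\<Sum>w\<in>UNIV. ennreal (tok_weight e P \<xi> w) * h (\<xi> w)) \<partial>xi_law)
      = ennreal e * (\<integral>\<^sup>+y. ennreal (dens 1 P UNIV y) * h y \<partial>mu0) + ennreal (1 - e) * (\<integral>\<^sup>+y. h y \<partial>mu0)"
    by (simp only: split dec comp)
  also have "\<dots>
      = (\<integral>\<^sup>+y. ennreal e * (ennreal (dens 1 P UNIV y) * h y) + ennreal (1 - e) * h y \<partial>mu0)"
    by (simp add: nn_integral_add nn_integral_cmult)
  also have "\<dots> = (\<integral>\<^sup>+y. ennreal (dens e P UNIV y) * h y \<partial>mu0)"
  proof (intro nn_integral_cong)
    fix y
    have "dens e P UNIV y = e * dens 1 P UNIV y + (1 - e)" by (simp add: dens_def)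
    then have "ennreal (dens e P UNIV y) = ennreal e * ennreal (dens 1 P UNIV y) + ennreal (1 - e)"
      using e dens_nonneg[of 1 P UNIV y] by (simp add: ennreal_mult)
    then show "ennreal e * (ennreal (dens 1 P UNIV y) * h y) + ennreal (1 - e) * h y = ennreal (dens e P UNIV y) * h y"
      by (simp add: distrib_right mult.assoc)
  qed
  also have "\<dots> = (\<integral>\<^sup>+y. h y \<partial>dens_law e P UNIV)"
    by (rule nn_integral_density[OF dens_meas h_meas, symmetric])
  finally show ?thesis .
qed

section \<open>Extremality of \<open>P*\<close>\<close>

text \<open>The pair \<open>(a, c)\<close> majorises \<open>(x, y)\<close>: both points are convex
  combinations of \<open>a\<close> and \<open>c\<close>, with interchanged weights.\<close>

lemma convex_on_majorize2:
  fixes f :: "real \<Rightarrow> real"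
  assumes f: "convex_on S f" and S: "a \<in> S" "c \<in> S"
    and le: "c \<le> x" "x \<le> a" and eq: "x + y = a + c"
  shows "f x + f y \<le> f a + f c"
proof (cases "a = c")
  case True
  then show ?thesis using le eq by simp
next
  case False
  define t where "t = (x - c) / (a - c)"
  have t: "0 \<le> t" "t \<le> 1" "t * (a - c) = x - c"
    using le False by (auto simp: t_def)
  then have x: "x = (1 - t) * c + t * a" by (simp add: algebra_simps)
  have y: "y = (1 - t) * a + t * c" using eq by (simp add: x algebra_simps)
  have "f x \<le> (1 - t) * f c + t * f a"
    using convex_onD[OF f t(1,2) S(2,1)] by (simp add: x)
  moreover have "f y \<le> (1 - t) * f a + t * f c"
    using convex_onD[OF f t(1,2) S] by (simp add: y)
  ultimately show ?thesis by (simp add: algebra_simps)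
qed

text \<open>The right-hand side packs the mass into full entries \<open>a\<close> and a remainder; a further entry \<open>x\<close>
  either is absorbed by the remainder or completes one more full entry.\<close>
lemma sum_convex_le_packed:
  fixes f :: "real \<Rightarrow> real"
  assumes f: "convex_on {0..a} f" and f0: "f 0 = 0" and a: "0 < a"
    and I: "finite I" "\<And>i. i \<in> I \<Longrightarrow> 0 \<le> x i \<and> x i \<le> a"
  shows "(\<Sum>i\<in>I. f (x i)) \<le>
    of_int \<lfloor>sum x I / a\<rfloor> * f a + f (sum x I - a * of_int \<lfloor>sum x I / a\<rfloor>)"
  using I
proof (induction I)
  case empty
  then show ?case by (simp add: f0)
next
  case (insert i I)
  define m where "m = sum x I"
  define q where "q = \<lfloor>m / a\<rfloor>"
  define b where "b = m - a * of_int q"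
  have xi: "0 \<le> x i" "x i \<le> a" using insert.prems by auto
  have "of_int q \<le> m / a" "m / a < of_int q + 1" by (auto simp: q_def)
  then have b: "0 \<le> b" "b < a" using a by (auto simp: b_def field_simps)
  have IH: "(\<Sum>i\<in>I. f (x i)) \<le> of_int q * f a + f b"
    using insert by (simp add: m_def q_def b_def)
  have "of_int q * f a + f b + f (x i) \<le>
      of_int \<lfloor>(m + x i) / a\<rfloor> * f a + f (m + x i - a * of_int \<lfloor>(m + x i) / a\<rfloor>)"
  proof (cases "b + x i < a")
    case True
    have "(m + x i) / a = of_int q + (b + x i) / a" using a by (simp add: b_def field_simps)
    moreover have "0 \<le> (b + x i) / a" "(b + x i) / a < 1" using True b xi a by auto
    ultimately have fl: "\<lfloor>(m + x i) / a\<rfloor> = q" by linarith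
    have "f b + f (x i) \<le> f (b + x i) + f 0"
      using b xi True a by (intro convex_on_majorize2[OF f]) auto
    then show ?thesis unfolding fl by (simp add: f0 b_def algebra_simps)
  next
    case False
    have "(m + x i) / a = of_int q + (b + x i) / a" using a by (simp add: b_def field_simps)
    moreover have "1 \<le> (b + x i) / a" "(b + x i) / a < 2" using False b xi a by (auto simp: field_simps)
    ultimately have fl: "\<lfloor>(m + x i) / a\<rfloor> = q + 1" by linarith
    have "f b + f (x i) \<le> f a + f (b + x i - a)"
      using b xi False a by (intro convex_on_majorize2[OF f]) auto
    then show ?thesis unfolding fl by (simp add: b_def algebra_simps)
  qed
  with IH insert show ?case by (simp add: m_def add.commute)
qed

text \<open>This is the perspective \<open>x * exp (c / x)\<close> of the convex function
  \<open>exp\<close> at fixed \<open>c = ln r\<close>. At \<open>x = 0\<close> the value is 0, the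
  continuous extension, but the perspective argument breaks down there.\<close>

lemma convex_on_mult_powr_inverse:
  fixes r :: real
  assumes r: "0 < r" "r \<le> 1"
  shows "convex_on {0..a} (\<lambda>x. x * r powr (1 / x))"
proof (rule convex_onI)
  fix t x y :: real
  assume t: "0 < t" "t < 1" and xy: "x \<in> {0..a}" "y \<in> {0..a}"
  define z where "z = (1 - t) * x + t * y"
  have ln: "ln r \<le> 0" using r by (simp add: ln_le_zero_iff)
  \<comment> \<open>For an endpoint 0: shrinking the argument by a factor \<open>u\<close> shrinks
    the value at least by that factor.\<close>
  have scale: "u * y * r powr (1 / (u * y)) \<le> u * (y * r powr (1 / y))"
    if "0 < u" "u < 1" "0 \<le> y" for u y
  proof (cases "y = 0")
    case False
    have "1 / y \<le> 1 / (u * y)" using that False by (auto simp: field_simps)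
    then have "r powr (1 / (u * y)) \<le> r powr (1 / y)" using r by (intro powr_mono') auto
    then show ?thesis using that by (simp add: mult_left_mono)
  qed simp
  have "z * r powr (1 / z) \<le> (1 - t) * (x * r powr (1 / x)) + t * (y * r powr (1 / y))"
  proof (cases "x = 0 \<or> y = 0")
    case True
    then show ?thesis using scale[of t y] scale[of "1 - t" x] t xy by (auto simp: z_def)
  next
    case False
    then have pos: "0 < x" "0 < y" "0 < z" using xy t by (auto simp: z_def intro!: add_pos_pos)
    \<comment> \<open>The weight that makes \<open>1 / z\<close> a convex combination of
      \<open>1 / x\<close> and \<open>1 / y\<close>.\<close>
    define p where "p = t * y / z"
    have p: "0 \<le> p" "p \<le> 1" and p': "1 - p = (1 - t) * x / z"
      using pos t by (auto simp: p_def z_def field_simps)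
    have "ln r / z = (1 - p) * (ln r / x) + p * (ln r / y)"
    proof -
      have "(1 - p) * (ln r / x) = (1 - t) * ln r / z" "p * (ln r / y) = t * ln r / z"
        unfolding p' using pos by (simp_all add: p_def)
      then show ?thesis by (simp add: add_divide_distrib[symmetric] algebra_simps)
    qed
    then have "exp (ln r / z) \<le> (1 - p) * exp (ln r / x) + p * exp (ln r / y)"
      using convex_onD[OF exp_convex p, of "ln r / x" "ln r / y"] by simp
    then have "z * exp (ln r / z) \<le> z * ((1 - p) * exp (ln r / x) + p * exp (ln r / y))"
      using pos by simp
    also have "\<dots> = (1 - t) * (x * exp (ln r / x)) + t * (y * exp (ln r / y))"
    proof -
      have "z * (1 - p) = (1 - t) * x" "z * p = t * y" unfolding p' using pos by (simp_all add: p_def)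
      then show ?thesis by (simp only: distrib_left mult.assoc[symmetric])
    qed
    finally show ?thesis using r by (simp add: powr_def)
  qed
  then show "((1 - t) *\<^sub>R x + t *\<^sub>R y) * r powr (1 / ((1 - t) *\<^sub>R x + t *\<^sub>R y))
      \<le> (1 - t) * (x * r powr (1 / x)) + t * (y * r powr (1 / y))"
    by (simp add: z_def)
qed simp

lemma F1_eq_sum:
  assumes "finite I" "\<And>i. i \<in> I \<Longrightarrow> 0 \<le> P i" "0 < r" "r < 1"
  shows "F1 P I r = (\<Sum>i\<in>I. P i * r powr (1 / P i))"
proof -
  have "F1 P I r = (\<Sum>w\<in>{w\<in>I. 0 < P w}. P w * r powr (1 / P w))"
    using assms by (simp add: F1_def)
  also have "\<dots> = (\<Sum>i\<in>I. P i * r powr (1 / P i))"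
    using assms by (intro sum.mono_neutral_left) (auto simp: not_less intro: antisym)
  finally show ?thesis .
qed

locale watermark_params =
  fixes \<epsilon> \<Delta> :: real
  assumes eps: "0 < \<epsilon>" "\<epsilon> \<le> 1" and Delta: "0 < \<Delta>" "\<Delta> < 1"
begin

lemma of_nat_Pstar_len: "real (Pstar_len \<Delta>) = of_int \<lfloor>1 / (1 - \<Delta>)\<rfloor>"
  using Delta by (simp add: Pstar_len_def)

lemma Pstar_len_pos: "0 < Pstar_len \<Delta>"
proof -
  have "1 \<le> 1 / (1 - \<Delta>)" using Delta by simp
  then have "1 \<le> \<lfloor>1 / (1 - \<Delta>)\<rfloor>" by linarith
  then show ?thesis by (simp add: Pstar_len_def)
qed

lemma Pstar_bounds: "0 \<le> Pstar \<Delta> i \<and> Pstar \<Delta> i \<le> 1 - \<Delta>"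
proof -
  have "real (Pstar_len \<Delta>) \<le> 1 / (1 - \<Delta>)" "1 / (1 - \<Delta>) < real (Pstar_len \<Delta>) + 1"
    unfolding of_nat_Pstar_len by linarith+
  then have "(1 - \<Delta>) * real (Pstar_len \<Delta>) \<le> 1" "1 - (1 - \<Delta>) * real (Pstar_len \<Delta>) \<le> 1 - \<Delta>"
    using Delta by (simp_all add: field_simps)
  then show ?thesis using Delta by (simp add: Pstar_def)
qed

text \<open>Puts sums over \<open>Pstar\<close> into the floor form of the packing inequality at
  total mass 1; the identity function yields the normalisation.\<close>

lemma sum_Pstar_comp:
  assumes "f 0 = (0::real)"
  shows "(\<Sum>i\<le>Pstar_len \<Delta>. f (Pstar \<Delta> i))
    = of_int \<lfloor>1 / (1 - \<Delta>)\<rfloor> * f (1 - \<Delta>) + f (1 - (1 - \<Delta>) * of_int \<lfloor>1 / (1 - \<Delta>)\<rfloor>)"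
  by (simp add: Pstar_def of_nat_Pstar_len flip: lessThan_Suc_atMost)

lemma sum_Pstar: "sum (Pstar \<Delta>) {..Pstar_len \<Delta>} = 1"
  using sum_Pstar_comp[of "\<lambda>x. x"] by simp

text \<open>The packing inequality with cap \<open>1 - \<Delta>\<close>, total mass 1 and the convex
  function \<open>x * r powr (1 / x)\<close>, for each \<open>r\<close> separately. One vector is
  thus optimal for all \<open>r\<close> at once, and for vocabularies of any size.\<close>

lemma F1_le_F1_Pstar:
  fixes P :: "'w::finite \<Rightarrow> real"
  assumes P: "P \<in> P_Delta \<Delta>"
  shows "F1 P UNIV r \<le> F1 (Pstar \<Delta>) {..Pstar_len \<Delta>} r"
proof (cases "0 < r \<and> r < 1")
  case True
  let ?f = "\<lambda>x. x * r powr (1 / x)"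
  have P': "0 \<le> P w" "P w \<le> 1 - \<Delta>" "sum P UNIV = 1" for w
    using P by (auto simp: P_Delta_def prob_vec_def)
  have "F1 P UNIV r = (\<Sum>w\<in>UNIV. ?f (P w))"
    using True P' by (intro F1_eq_sum) auto
  also have "\<dots> \<le> of_int \<lfloor>sum P UNIV / (1 - \<Delta>)\<rfloor> * ?f (1 - \<Delta>)
      + ?f (sum P UNIV - (1 - \<Delta>) * of_int \<lfloor>sum P UNIV / (1 - \<Delta>)\<rfloor>)"
    using True P' Delta by (intro sum_convex_le_packed convex_on_mult_powr_inverse) auto
  also have "\<dots> = (\<Sum>i\<le>Pstar_len \<Delta>. ?f (Pstar \<Delta> i))"
    using sum_Pstar_comp[of ?f] P' by simp
  also have "\<dots> = F1 (Pstar \<Delta>) {..Pstar_len \<Delta>} r"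
    using True Pstar_bounds by (intro F1_eq_sum[symmetric]) auto
  finally show ?thesis .
qed (auto simp: F1_def)

lemma Fmix_le_Fmix_Pstar:
  fixes P :: "'w::finite \<Rightarrow> real"
  assumes "P \<in> P_Delta \<Delta>"
  shows "Fmix \<epsilon> P UNIV r \<le> Fmix \<epsilon> (Pstar \<Delta>) {..Pstar_len \<Delta>} r"
  using F1_le_F1_Pstar[OF assms, of r] eps by (simp add: Fmix_def mult_left_mono)

end

section \<open>The least favourable mixture\<close>

lemma integrable_mu0_iff:
  fixes f :: "real \<Rightarrow> real"
  assumes [measurable]: "f \<in> borel_measurable borel"
  shows "integrable mu0 f \<longleftrightarrow> set_integrable lborel {0..1} f"
proof -
  have "mu0 = density lborel (\<lambda>x. ennreal (indicator {0..1} x))"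
    unfolding mu0_eq_density by (intro arg_cong[where f="density lborel"] ext) (simp add: indicator_def)
  then have "integrable mu0 f \<longleftrightarrow> integrable (density lborel (\<lambda>x. ennreal (indicator {0..1} x))) f"
    by simp
  also have "\<dots> \<longleftrightarrow> set_integrable lborel {0..1} f"
    unfolding set_integrable_def by (intro integrable_density) auto
  finally show ?thesis .
qed

lemma integrable_mu0_powr:
  assumes "-1 < a"
  shows "integrable mu0 (\<lambda>r. r powr a)"
proof -
  have "(\<lambda>x. x powr a) absolutely_integrable_on {0..1}"
    using assms by (intro nonnegative_absolutely_integrable_1 integrable_on_powr_from_0) auto
  then show ?thesis
    by (simp add: integrable_mu0_iff set_integrable_def integrable_completion)
qed

context watermark_params
begin

definition pstar_dens :: "real \<Rightarrow> real" where
  "pstar_dens = dens \<epsilon> (Pstar \<Delta>) {..Pstar_len \<Delta>}"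

definition pstar_mix :: "real measure" where
  "pstar_mix = density mu0 (\<lambda>r. ennreal (pstar_dens r))"

lemma measurable_pstar_dens [measurable]: "pstar_dens \<in> borel_measurable borel"
  by (simp add: pstar_dens_def)

lemma pstar_mix_eq: "mix_measure \<epsilon> (Pstar \<Delta>) {..Pstar_len \<Delta>} = pstar_mix"
  unfolding pstar_mix_def pstar_dens_def
  using eps Delta Pstar_bounds sum_Pstar by (intro mix_measure_eq) auto

lemma prob_space_pstar_mix: "prob_space (pstar_mix)"
  unfolding pstar_mix_def pstar_dens_def
  using eps Delta Pstar_bounds sum_Pstar by (intro prob_space_density_dens) auto

lemma Pstar_exponent_nonneg: "0 < Pstar \<Delta> i \<Longrightarrow> 0 \<le> 1 / Pstar \<Delta> i - 1"
  using Pstar_bounds[of i] Delta by (simp add: field_simps)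

lemma pstar_dens_mono: "0 \<le> r \<Longrightarrow> r \<le> r' \<Longrightarrow> pstar_dens r \<le> pstar_dens r'"
  unfolding pstar_dens_def dens_def using eps Pstar_exponent_nonneg
  by (intro add_left_mono mult_left_mono sum_mono powr_mono2) auto

text \<open>Keeps the summand of entry 0, which equals \<open>1 - \<Delta>\<close>. A power is the
  right kind of bound: for \<open>\<epsilon> = 1\<close> the density vanishes at 0, all exponents
  being positive.\<close>

lemma pstar_dens_ge: "\<epsilon> * r powr (1 / (1 - \<Delta>) - 1) \<le> pstar_dens r"
proof -
  have P0: "Pstar \<Delta> 0 = 1 - \<Delta>" using Pstar_len_pos by (simp add: Pstar_def)
  have "r powr (1 / Pstar \<Delta> 0 - 1)
      \<le> (\<Sum>w\<in>{w\<in>{..Pstar_len \<Delta>}. 0 < Pstar \<Delta> w}. r powr (1 / Pstar \<Delta> w - 1))"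
    using Delta P0 by (intro member_le_sum) auto
  then have "\<epsilon> * r powr (1 / Pstar \<Delta> 0 - 1) \<le> \<epsilon> * \<dots>"
    using eps by (intro mult_left_mono) auto
  then show ?thesis using eps unfolding pstar_dens_def dens_def P0 by linarith
qed

lemma pstar_dens_pos: "0 < r \<Longrightarrow> 0 < pstar_dens r"
  using pstar_dens_ge[of r] eps by (auto intro: less_le_trans[rotated])

lemma ln_pstar_dens_mono:
  "0 < r \<Longrightarrow> r \<le> r' \<Longrightarrow> ln (pstar_dens r) \<le> ln (pstar_dens r')"
  using pstar_dens_mono[of r r'] pstar_dens_pos[of r] by simp

lemma isCont_ln_pstar_dens: "0 < r \<Longrightarrow> isCont (\<lambda>r. ln (pstar_dens r)) r"
  unfolding pstar_dens_def dens_def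
  using pstar_dens_pos[of r] by (intro continuous_intros) (auto simp: pstar_dens_def dens_def)

text \<open>The singularity at 0 is only logarithmic. The power -1/4 is chosen so that the square of
  the bound, of order \<open>r powr (-1/2)\<close>, is still integrable.\<close>

lemma ln_pstar_dens_abs_le:
  "\<exists>C\<ge>0. \<forall>r. 0 < r \<and> r < 1 \<longrightarrow> \<bar>ln (pstar_dens r)\<bar> \<le> C * r powr (-1/4)"
proof -
  define k where "k = 1 / (1 - \<Delta>) - 1"
  have k: "0 \<le> k" using Delta by (simp add: k_def)
  define A where "A = \<bar>ln \<epsilon>\<bar> + \<bar>ln (pstar_dens 1)\<bar>"
  have "\<bar>ln (pstar_dens r)\<bar> \<le> (A + 4 * k) * r powr (-1/4)" if r: "0 < r" "r < 1" for r
  proof -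
    have one: "1 \<le> r powr (-1/4)"
      using powr_mono'[of "-1/4" 0 r] r by simp
    \<comment> \<open>\<open>ln x \<le> x\<close> at \<open>x = r powr (-1/4)\<close>, whence the
      factor 4 below.\<close>
    have "ln (r powr (-1/4)) \<le> r powr (-1/4)"
      using ln_bound[of "r powr (-1/4)"] r by simp
    then have lnr: "- ln r \<le> 4 * r powr (-1/4)" using r by (simp add: ln_powr)
    have "ln (\<epsilon> * r powr k) \<le> ln (pstar_dens r)"
      using pstar_dens_ge[of r] r eps pstar_dens_pos[of r] by (simp add: k_def)
    then have "ln \<epsilon> + k * ln r \<le> ln (pstar_dens r)"
      using r eps by (simp add: ln_mult ln_powr)
    moreover have "k * (- ln r) \<le> k * (4 * r powr (-1/4))" using lnr k by (rule mult_left_mono)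
    moreover have "ln (pstar_dens r) \<le> ln (pstar_dens 1)"
      using r by (intro ln_pstar_dens_mono) auto
    ultimately have "\<bar>ln (pstar_dens r)\<bar> \<le> A * 1 + 4 * k * r powr (-1/4)"
    proof -
      have aux: "\<bar>x\<bar> \<le> \<bar>e\<bar> + \<bar>u\<bar> + z" if "e + l \<le> x" "- l \<le> z" "x \<le> u" "0 \<le> z" for x e u z l :: real
        using that by linarith
      assume "ln \<epsilon> + k * ln r \<le> ln (pstar_dens r)"
        "k * (- ln r) \<le> k * (4 * r powr (-1/4))"
        "ln (pstar_dens r) \<le> ln (pstar_dens 1)"
      then show ?thesis
        using aux[of "ln \<epsilon>" "k * ln r" "ln (pstar_dens r)" "4 * k * r powr (-1/4)"] k
        by (simp add: A_def mult.assoc mult.left_commute)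
    qed
    also have "\<dots> \<le> A * r powr (-1/4) + 4 * k * r powr (-1/4)"
      using one by (intro add_right_mono mult_left_mono) (auto simp: A_def)
    finally show ?thesis by (simp add: distrib_right)
  qed
  moreover have "0 \<le> A + 4 * k" using k by (simp add: A_def)
  ultimately show ?thesis by blast
qed

lemma integrable_ln_pstar_dens_sq: "integrable mu0 (\<lambda>r. (ln (pstar_dens r))\<^sup>2)"
proof -
  obtain C where C: "0 \<le> C" "\<And>r. 0 < r \<Longrightarrow> r < 1 \<Longrightarrow> \<bar>ln (pstar_dens r)\<bar> \<le> C * r powr (-1/4)"
    using ln_pstar_dens_abs_le by blast
  show ?thesis
  proof (rule Bochner_Integration.integrable_bound)
    show "integrable mu0 (\<lambda>r. C\<^sup>2 * r powr (-1/2))"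
      by (intro integrable_mult_right integrable_mu0_powr) simp
    show "AE r in mu0. norm ((ln (pstar_dens r))\<^sup>2) \<le> norm (C\<^sup>2 * r powr (-1/2))"
      using AE_mu0
    proof eventually_elim
      case (elim r)
      have "\<bar>ln (pstar_dens r)\<bar>\<^sup>2 \<le> (C * r powr (-1/4))\<^sup>2"
        using C(2)[of r] elim by (intro power_mono) auto
      also have "\<dots> = C\<^sup>2 * r powr (-1/2)"
        by (simp add: power_mult_distrib power2_eq_square powr_add[symmetric])
      finally show ?case by simp
    qed
  qed measurable
qed

lemma integrable_ln_pstar_dens: "integrable mu0 (\<lambda>r. ln (pstar_dens r))"
proof -
  show ?thesis by (rule mu0.square_integrable_imp_integrable[OF _ integrable_ln_pstar_dens_sq]) measurable
qed

text \<open>The divergence is computed through densities, so \<open>mu0\<close> enters as density 1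
  with respect to itself; the sign comes from \<open>ln (1 / pstar_dens r)\<close>.\<close>

lemma D_KL_eq: "D_KL mu0 (pstar_mix) = - (\<integral>r. ln (pstar_dens r) \<partial>mu0)"
proof -
  have nn: "AE r in mu0. 0 < pstar_dens r"
    using AE_mu0 by eventually_elim (simp add: pstar_dens_pos)
  have "KL_divergence (exp 1) (density mu0 (\<lambda>r. ennreal (pstar_dens r))) (density mu0 (\<lambda>r. ennreal 1))
      = (\<integral>r. 1 * log (exp 1) (1 / pstar_dens r) \<partial>mu0)"
    using nn by (intro mu0.KL_density_density) (auto elim!: eventually_mono)
  also have "\<dots> = (\<integral>r. - ln (pstar_dens r) \<partial>mu0)"
    using nn by (intro integral_cong_AE) (auto elim!: eventually_mono simp: log_def ln_div)
  finally show ?thesis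
    by (simp add: D_KL_def pstar_mix_def density_1)
qed

text \<open>Monotonicity squeezes the shifted function between \<open>ln (pstar_dens r)\<close> and
  its value at 2, since \<open>r + d < 2\<close>. The envelope does not depend on \<open>d\<close>,
  as dominated convergence requires.\<close>

lemma integrable_ln_pstar_dens_shift:
  assumes "0 \<le> d" "d \<le> 1"
  shows "integrable mu0 (\<lambda>r. ln (pstar_dens (r + d)))"
    and "AE r in mu0. norm (ln (pstar_dens (r + d)))
      \<le> \<bar>ln (pstar_dens r)\<bar> + \<bar>ln (pstar_dens 2)\<bar>"
proof -
  show ae: "AE r in mu0. norm (ln (pstar_dens (r + d)))
      \<le> \<bar>ln (pstar_dens r)\<bar> + \<bar>ln (pstar_dens 2)\<bar>"
    using AE_mu0
  proof eventually_elim
    case (elim r)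
    have "ln (pstar_dens r) \<le> ln (pstar_dens (r + d))"
      "ln (pstar_dens (r + d)) \<le> ln (pstar_dens 2)"
      using elim assms by (auto intro!: ln_pstar_dens_mono)
    then show ?case unfolding real_norm_def by linarith
  qed
  show "integrable mu0 (\<lambda>r. ln (pstar_dens (r + d)))"
  proof (rule Bochner_Integration.integrable_bound)
    show "integrable mu0 (\<lambda>r. \<bar>ln (pstar_dens r)\<bar> + \<bar>ln (pstar_dens 2)\<bar>)"
      by (intro Bochner_Integration.integrable_add integrable_abs integrable_ln_pstar_dens) simp
    show "AE r in mu0. norm (ln (pstar_dens (r + d)))
      \<le> norm (\<bar>ln (pstar_dens r)\<bar> + \<bar>ln (pstar_dens 2)\<bar>)"
      using ae by eventually_elim simp
  qed measurable
qed

text \<open>Dominated convergence along \<open>d = 1 / (k + 1)\<close>: the exponent lost by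
  shifting can be made arbitrarily small.\<close>

lemma integral_ln_pstar_dens_shift:
  assumes "c > 0"
  shows "\<exists>d>0. d \<le> 1 \<and> (\<integral>r. ln (pstar_dens (r + d)) \<partial>mu0) \<le> (\<integral>r. ln (pstar_dens r) \<partial>mu0) + c"
proof -
  have "(\<lambda>k. \<integral>r. ln (pstar_dens (r + inverse (real (Suc k)))) \<partial>mu0) \<longlonglongrightarrow> (\<integral>r. ln (pstar_dens r) \<partial>mu0)"
  proof (rule integral_dominated_convergence)
    show "integrable mu0 (\<lambda>r. \<bar>ln (pstar_dens r)\<bar> + \<bar>ln (pstar_dens 2)\<bar>)"
      by (intro Bochner_Integration.integrable_add integrable_abs integrable_ln_pstar_dens) simp
    show "AE r in mu0. norm (ln (pstar_dens (r + inverse (real (Suc k)))))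
      \<le> \<bar>ln (pstar_dens r)\<bar> + \<bar>ln (pstar_dens 2)\<bar>" for k
      by (rule integrable_ln_pstar_dens_shift(2)) (simp_all add: field_simps)
    show "AE r in mu0. (\<lambda>k. ln (pstar_dens (r + inverse (real (Suc k))))) \<longlonglongrightarrow> ln (pstar_dens r)"
      using AE_mu0
    proof eventually_elim
      case (elim r)
      have "(\<lambda>k. r + inverse (real (Suc k))) \<longlonglongrightarrow> r + 0"
        by (intro tendsto_add tendsto_const LIMSEQ_inverse_real_of_nat)
      then show ?case using isCont_tendsto_compose[OF isCont_ln_pstar_dens[of r]] elim by simp
    qed
  qed measurable
  then have "eventually (\<lambda>k. (\<integral>r. ln (pstar_dens (r + inverse (real (Suc k)))) \<partial>mu0)
      < (\<integral>r. ln (pstar_dens r) \<partial>mu0) + c) sequentially"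
    using assms by (intro order_tendstoD) auto
  then obtain k where "(\<integral>r. ln (pstar_dens (r + inverse (real (Suc k)))) \<partial>mu0)
      < (\<integral>r. ln (pstar_dens r) \<partial>mu0) + c"
    by (auto simp: eventually_sequentially)
  then show ?thesis
    by (intro exI[of _ "inverse (real (Suc k))"]) (auto simp: field_simps)
qed

end

section \<open>Sums over ordered p-values as Riemann sums\<close>

lemma sum_p_ord:
  assumes "n > 0"
  shows "(\<Sum>i<n. g (y i)) = (\<Sum>j<n. g (1 - p_ord n y (Suc j)) :: real)"
proof -
  define xs where "xs = sort (map (\<lambda>i. 1 - y i) [0..<n])"
  have len: "length xs = n" by (simp add: xs_def)
  have "(\<Sum>j<n. g (1 - p_ord n y (Suc j))) = (\<Sum>j<n. g (1 - xs ! j))"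
    by (intro sum.cong) (auto simp: p_ord_def xs_def)
  also have "\<dots> = sum_list (map (\<lambda>x. g (1 - x)) xs)"
    by (simp add: sum_list_sum_nth len atLeast0LessThan)
  also have "\<dots> = sum_mset (image_mset (\<lambda>x. g (1 - x)) (mset xs))"
    by (metis mset_map sum_mset_sum_list)
  also have "\<dots> = sum_mset (image_mset (\<lambda>x. g (1 - x)) (mset (map (\<lambda>i. 1 - y i) [0..<n])))"
    by (simp add: xs_def)
  also have "\<dots> = sum_list (map (\<lambda>x. g (1 - x)) (map (\<lambda>i. 1 - y i) [0..<n]))"
    by (metis mset_map sum_mset_sum_list)
  also have "\<dots> = (\<Sum>i<n. g (y i))"
    by (simp add: comp_def interv_sum_list_conv_sum_set_nat atLeast0LessThan)
  finally show ?thesis by simp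
qed

lemma measure_mu0_Ioc:
  assumes "0 \<le> a" "a \<le> b" "b \<le> 1"
  shows "measure mu0 {a<..b} = b - a"
proof -
  have "{a<..b} \<inter> {0..1} = {a<..b}" using assms by auto
  then show ?thesis using assms by (simp add: measure_def emeasure_mu0)
qed

text \<open>The p-value of rank \<open>j + 1\<close> is at least \<open>(j + 1) / n - d\<close>, so
  the matching observation is at most \<open>(n - (j + 1)) / n + d\<close>. For increasing
  \<open>g\<close> these values give a lower Riemann sum of \<open>g (r + d)\<close>. Positivity of
  \<open>d\<close> keeps the leftmost argument, \<open>d\<close> itself, in the range where
  \<open>g\<close> is monotone.\<close>

lemma sum_le_integral_shift:
  fixes g :: "real \<Rightarrow> real"
  assumes n: "n > 0" and d: "0 < d"
    and mono: "\<And>x y. 0 < x \<Longrightarrow> x \<le> y \<Longrightarrow> g x \<le> g y"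
    and int: "integrable mu0 (\<lambda>r. g (r + d))"
    and p: "\<And>t. t \<in> {1..n} \<Longrightarrow> p_ord n y t < 1 \<and> real t / real n - d \<le> p_ord n y t"
  shows "(\<Sum>i<n. g (y i)) \<le> real n * (\<integral>r. g (r + d) \<partial>mu0)"
proof -
  define A where "A i = {real i / real n<..(real i + 1) / real n}" for i
  have A[measurable]: "A i \<in> sets mu0" for i by (simp add: A_def)
  have mA: "measure mu0 (A i) = 1 / real n" if "i < n" for i
    unfolding A_def using n that by (subst measure_mu0_Ioc) (auto simp: field_simps)
  have int_ind: "integrable mu0 (\<lambda>r. g (real i / n + d) * indicator (A i) r)" for i
    by (intro integrable_mult_right integrable_real_indicator) (auto simp: A_def less_top[symmetric])
  have "(\<Sum>i<n. g (y i)) = (\<Sum>j<n. g (1 - p_ord n y (Suc j)))"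
    using n by (rule sum_p_ord)
  also have "\<dots> \<le> (\<Sum>j<n. g (real (n - Suc j) / real n + d))"
  proof (intro sum_mono mono)
    fix j assume j: "j \<in> {..<n}"
    show "0 < 1 - p_ord n y (Suc j)" using p[of "Suc j"] j by auto
    have "real (n - Suc j) / real n = 1 - real (Suc j) / real n"
      using j n by (simp add: of_nat_diff field_simps)
    then show "1 - p_ord n y (Suc j) \<le> real (n - Suc j) / real n + d"
      using p[of "Suc j"] j by auto
  qed
  also have "\<dots> = (\<Sum>i<n. g (real i / real n + d))"
    by (rule sum.nat_diff_reindex)
  also have "\<dots> = real n * (\<Sum>i<n. \<integral>r. g (real i / n + d) * indicator (A i) r \<partial>mu0)"
    using n by (simp add: mA sum_distrib_left)
  also have "(\<Sum>i<n. \<integral>r. g (real i / n + d) * indicator (A i) r \<partial>mu0)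
      = (\<integral>r. (\<Sum>i<n. g (real i / n + d) * indicator (A i) r) \<partial>mu0)"
    by (rule Bochner_Integration.integral_sum[symmetric]) (rule int_ind)
  also have "\<dots> \<le> (\<integral>r. g (r + d) \<partial>mu0)"
  proof (rule integral_mono_AE)
    show "integrable mu0 (\<lambda>r. \<Sum>i<n. g (real i / n + d) * indicator (A i) r)"
      by (intro Bochner_Integration.integrable_sum int_ind)
    show "AE r in mu0. (\<Sum>i<n. g (real i / n + d) * indicator (A i) r) \<le> g (r + d)"
      using AE_mu0
    proof eventually_elim
      case (elim r)
      \<comment> \<open>The cells are open on the left and closed on the right, hence the ceiling
        minus one.\<close>
      define k where "k = nat (\<lceil>real n * r\<rceil> - 1)"
      have "0 < real n * r" "real n * r \<le> real n" using elim n by auto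
      then have ceil: "1 \<le> \<lceil>real n * r\<rceil>" "\<lceil>real n * r\<rceil> \<le> int n" by linarith+
      then have k: "k < n" "real k < real n * r" "real n * r \<le> real k + 1"
        unfolding k_def by linarith+
      have "r \<in> A i \<longleftrightarrow> i = k" for i
      proof -
        have "r \<in> A i \<longleftrightarrow> real i < real n * r \<and> real n * r \<le> real i + 1"
          using n by (auto simp: A_def field_simps)
        also have "\<dots> \<longleftrightarrow> i = k" using k by auto
        finally show ?thesis .
      qed
      then have "(\<Sum>i<n. g (real i / n + d) * indicator (A i) r)
          = (\<Sum>i<n. if i = k then g (real k / n + d) else 0)"
        by (intro sum.cong) (auto simp: indicator_def)
      also have "\<dots> = g (real k / n + d)" using k by simp
      also have "\<dots> \<le> g (r + d)"
        using k n d by (intro mono) (auto simp: field_simps add_nonneg_pos)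
      finally show ?case .
    qed
  qed (rule int)
  finally show ?thesis using n by simp
qed

section \<open>The Tr-GoF statistic\<close>

text \<open>The affine parts of \<open>phi\<close> cancel. What remains, up to the factor
  \<open>s * (1 - s)\<close>, is one minus the Hellinger affinity of order \<open>s\<close> of the
  Bernoulli laws with parameters \<open>u\<close> and \<open>v\<close>.\<close>

lemma K_div_eq:
  assumes s: "0 < s" "s < 1" and uv: "0 < v" "v < u" "u < 1"
  shows "K_div s u v =
    (1 - u powr s * v powr (1 - s) - (1 - u) powr s * (1 - v) powr (1 - s)) / (s * (1 - s))"
proof -
  have "v * (u / v) powr s = u powr s * v powr (1 - s)"
    using uv by (simp add: powr_divide powr_diff)
  moreover have "(1 - v) * ((1 - u) / (1 - v)) powr s = (1 - u) powr s * (1 - v) powr (1 - s)"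
    using uv by (simp add: powr_divide powr_diff)
  moreover have "v * (1 - s + s * (u / v)) = v - s * v + s * u"
    "(1 - v) * (1 - s + s * ((1 - u) / (1 - v))) = (1 - v) - s * (1 - v) + s * (1 - u)"
  proof -
    have "a * (1 - s + s * x) = a - s * a + s * (a * x)" for a x :: real by (simp add: algebra_simps)
    from this[of v "u / v"] this[of "1 - v" "(1 - u) / (1 - v)"] uv
    show "v * (1 - s + s * (u / v)) = v - s * v + s * u"
      "(1 - v) * (1 - s + s * ((1 - u) / (1 - v))) = (1 - v) - s * (1 - v) + s * (1 - u)" by simp_all
  qed
  moreover have "K_div s u v =
      (v * (1 - s + s * (u / v)) - v * (u / v) powr s
      + ((1 - v) * (1 - s + s * ((1 - u) / (1 - v))) - (1 - v) * ((1 - u) / (1 - v)) powr s)) / (s * (1 - s))"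
    by (simp only: K_div_def phi_def times_divide_eq_right right_diff_distrib add_divide_distrib[symmetric])
  ultimately have "K_div s u v = (v - s * v + s * u - u powr s * v powr (1 - s)
      + ((1 - v) - s * (1 - v) + s * (1 - u) - (1 - u) powr s * (1 - v) powr (1 - s))) / (s * (1 - s))"
    by simp
  then show ?thesis by (simp add: algebra_simps)
qed

text \<open>Weighted AM-GM for \<open>sqrt (a * b)\<close> and \<open>b\<close> with weights
  \<open>2 * s\<close> and \<open>1 - 2 * s\<close>; having the geometric mean in place of
  \<open>a\<close> produces the quadratic gain.\<close>

lemma weighted_amgm_refined_aux:
  fixes a b s :: real
  assumes s: "0 < s" "s \<le> 1/2" and ab: "0 < a" "0 < b"
  shows "a powr s * b powr (1 - s) \<le> s * a + (1 - s) * b - s * (sqrt a - sqrt b)\<^sup>2"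
proof -
  have "(a powr (1/2) * b powr (1/2)) powr (2 * s) * b powr (1 - 2 * s)
      \<le> (2 * s) * (a powr (1/2) * b powr (1/2)) + (1 - 2 * s) * b"
    using s ab by (intro Youngs_inequality_0) auto
  moreover have "(a powr (1/2) * b powr (1/2)) powr (2 * s) * b powr (1 - 2 * s) = a powr s * b powr (1 - s)"
    using ab by (simp add: powr_mult powr_powr mult.assoc powr_add[symmetric])
  ultimately have "a powr s * b powr (1 - s) \<le> (2 * s) * (sqrt a * sqrt b) + (1 - 2 * s) * b"
    using ab by (simp add: powr_half_sqrt)
  also have "\<dots> = s * a + (1 - s) * b - s * (a + b - 2 * (sqrt a * sqrt b))"
    by (simp add: algebra_simps)
  also have "a + b - 2 * (sqrt a * sqrt b) = (sqrt a - sqrt b)\<^sup>2"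
    using ab by (simp add: power2_diff)
  finally show ?thesis .
qed

lemma weighted_amgm_refined:
  fixes a b s :: real
  assumes s: "0 < s" "s < 1" and ab: "0 < a" "0 < b"
  shows "a powr s * b powr (1 - s) \<le> s * a + (1 - s) * b - min s (1 - s) * (sqrt a - sqrt b)\<^sup>2"
proof (cases "s \<le> 1/2")
  case True
  then show ?thesis using weighted_amgm_refined_aux[OF s(1) True ab] by (simp add: min_def)
next
  case False
  then show ?thesis
    using weighted_amgm_refined_aux[of "1 - s" b a] s ab
    by (simp add: min_def power2_commute mult.commute)
qed

text \<open>A Pinsker-type bound with a constant independent of \<open>s\<close>: the gain in AM-GM
  carries \<open>min s (1 - s)\<close>, which dominates the normalisation
  \<open>s * (1 - s)\<close>, and the 4 bounds \<open>(sqrt u + sqrt v)\<^sup>2\<close>. It turns a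
  small statistic into closeness of p-values and ranks.\<close>

lemma K_div_ge:
  assumes s: "0 < s" "s < 1" and uv: "0 < v" "v < u" "u < 1"
  shows "(u - v)\<^sup>2 / 4 \<le> K_div s u v"
proof -
  let ?m = "min s (1 - s)"
  have "u powr s * v powr (1 - s) \<le> s * u + (1 - s) * v - ?m * (sqrt u - sqrt v)\<^sup>2"
    using s uv by (intro weighted_amgm_refined) auto
  moreover have "(1 - u) powr s * (1 - v) powr (1 - s) \<le> s * (1 - u) + (1 - s) * (1 - v)
      - ?m * (sqrt (1 - u) - sqrt (1 - v))\<^sup>2"
    using s uv by (intro weighted_amgm_refined) auto
  moreover have "0 \<le> ?m * (sqrt (1 - u) - sqrt (1 - v))\<^sup>2" using s by simp
  ultimately have 1: "?m * (sqrt u - sqrt v)\<^sup>2 \<le> 1 - u powr s * v powr (1 - s) - (1 - u) powr s * (1 - v) powr (1 - s)"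
    by (simp add: algebra_simps)
  have "u - v = (sqrt u - sqrt v) * (sqrt u + sqrt v)"
    using uv by (simp add: algebra_simps)
  then have "(u - v)\<^sup>2 = (sqrt u - sqrt v)\<^sup>2 * (sqrt u + sqrt v)\<^sup>2" by (simp add: power_mult_distrib)
  moreover have "(sqrt u + sqrt v)\<^sup>2 \<le> 2\<^sup>2"
  proof (rule power_mono)
    have "sqrt u \<le> 1" "sqrt v \<le> 1" using uv by auto
    then show "sqrt u + sqrt v \<le> 2" by linarith
  qed (use uv in auto)
  ultimately have 2: "(u - v)\<^sup>2 \<le> (sqrt u - sqrt v)\<^sup>2 * 4"
    by (simp add: mult_left_mono)
  have "s * (1 - s) \<le> ?m" using s by (auto simp: min_def intro: mult_left_le mult_left_le_one_le)
  then have "s * (1 - s) * (sqrt u - sqrt v)\<^sup>2 \<le> ?m * (sqrt u - sqrt v)\<^sup>2"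
    by (intro mult_right_mono) auto
  moreover have "s * (1 - s) * ((u - v)\<^sup>2 / 4) \<le> s * (1 - s) * (sqrt u - sqrt v)\<^sup>2"
    using 2 s by (intro mult_left_mono) auto
  ultimately have "s * (1 - s) * ((u - v)\<^sup>2 / 4) \<le> ?m * (sqrt u - sqrt v)\<^sup>2"
    by (rule order_trans[rotated])
  with 1 have "s * (1 - s) * ((u - v)\<^sup>2 / 4)
      \<le> 1 - u powr s * v powr (1 - s) - (1 - u) powr s * (1 - v) powr (1 - s)"
    by linarith
  then show ?thesis
    unfolding K_div_eq[OF assms] using s by (subst pos_le_divide_eq) (auto simp: mult.commute)
qed

text \<open>Replacing \<open>u\<close> by \<open>v\<close> in the first product and \<open>v\<close>
  by \<open>u\<close> in the second only lowers the affinity, which is therefore at least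
  \<open>v + (1 - u)\<close>.\<close>

lemma K_div_le:
  assumes s: "0 < s" "s < 1" and uv: "0 < v" "v < u" "u < 1"
  shows "K_div s u v \<le> (u - v) / (s * (1 - s))"
proof -
  have "v powr s * v powr (1 - s) \<le> u powr s * v powr (1 - s)"
    using s uv by (intro mult_right_mono powr_mono2) auto
  moreover have "(1 - u) powr s * (1 - u) powr (1 - s) \<le> (1 - u) powr s * (1 - v) powr (1 - s)"
    using s uv by (intro mult_left_mono powr_mono2) auto
  ultimately have "v \<le> u powr s * v powr (1 - s)" "1 - u \<le> (1 - u) powr s * (1 - v) powr (1 - s)"
    using uv by (simp_all add: powr_add[symmetric])
  then show ?thesis unfolding K_div_eq[OF assms] using s by (intro divide_right_mono) auto
qed

text \<open>The affinity increases in \<open>v\<close> up to \<open>u\<close>: its derivative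
  compares \<open>(u / x) powr s > 1\<close> with \<open>((1 - u) / (1 - x)) powr s < 1\<close>.
  Each level is thus attained at most once on \<open>(0, u)\<close>, which later excludes positive
  atoms.\<close>

lemma K_div_strict_antimono:
  assumes s: "0 < s" "s < 1" and v: "0 < v" "v < v'" "v' < u" "u < 1"
  shows "K_div s u v' < K_div s u v"
proof -
  let ?G = "\<lambda>v. u powr s * v powr (1 - s) + (1 - u) powr s * (1 - v) powr (1 - s)"
  have "?G v < ?G v'"
  proof (rule DERIV_pos_imp_increasing[OF v(2)])
    fix x assume x: "v \<le> x" "x \<le> v'"
    have "(?G has_real_derivative (u powr s * ((1 - s) * x powr (1 - s - 1))
        + (1 - u) powr s * ((1 - s) * (1 - x) powr (1 - s - 1) * (- 1)))) (at x)"
      using x v by (auto intro!: derivative_eq_intros)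
    moreover have "0 < u powr s * ((1 - s) * x powr (1 - s - 1))
        + (1 - u) powr s * ((1 - s) * (1 - x) powr (1 - s - 1) * (- 1))"
    proof -
      have "x powr s * x powr (- s) < u powr s * x powr (- s)"
        using x v s by (intro mult_strict_right_mono powr_less_mono2) auto
      moreover have "(1 - u) powr s * (1 - x) powr (- s) < (1 - x) powr s * (1 - x) powr (- s)"
        using x v s by (intro mult_strict_right_mono powr_less_mono2) auto
      ultimately have "(1 - u) powr s * (1 - x) powr (- s) < u powr s * x powr (- s)"
        using x v by (simp add: powr_add[symmetric])
      then have "(1 - s) * ((1 - u) powr s * (1 - x) powr (- s)) < (1 - s) * (u powr s * x powr (- s))"
        using s by simp
      then show ?thesis by (simp add: algebra_simps)
    qed
    ultimately show "\<exists>y. DERIV ?G x :> y \<and> 0 < y" by blast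
  qed
  then show ?thesis
    using K_div_eq[OF s, of v u] K_div_eq[OF s, of v' u] s v by (simp add: divide_strict_right_mono)
qed

lemma K_plus_le:
  assumes "0 < s" "s < 1" "u - v \<le> d" "0 \<le> d"
  shows "K_plus s u v \<le> d / (s * (1 - s))"
proof (cases "0 < v \<and> v < u \<and> u < 1")
  case True
  then have "K_div s u v \<le> (u - v) / (s * (1 - s))" using assms by (intro K_div_le) auto
  also have "\<dots> \<le> d / (s * (1 - s))" using assms by (intro divide_right_mono) auto
  finally show ?thesis using True by (simp add: K_plus_def)
qed (use assms in \<open>auto simp: K_plus_def\<close>)

section \<open>Order statistics as counts, and the Tr-GoF maximum\<close>

lemma nth_filter_downward:
  assumes "sorted xs" and Q: "\<And>x y. x \<le> y \<Longrightarrow> Q y \<Longrightarrow> Q x" and j: "j < length xs"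
  shows "Q (xs ! j) \<longleftrightarrow> j < length (filter Q xs)"
  using assms(1) j
proof (induction xs arbitrary: j)
  case (Cons x xs)
  show ?case
  proof (cases "Q x")
    case True
    show ?thesis
    proof (cases j)
      case (Suc k)
      then show ?thesis using Cons.IH[of k] Cons.prems True by simp
    qed (simp add: True)
  next
    case False
    have nQ: "\<not> Q z" if "z \<in> set (x # xs)" for z
    proof
      assume "Q z"
      moreover have "x \<le> z" using Cons.prems(1) that by (cases "z = x") simp_all
      ultimately show False using Q False by blast
    qed
    then have "filter Q (x # xs) = []" by (simp only: filter_empty_conv) blast
    moreover have "\<not> Q ((x # xs) ! j)" using Cons.prems(2) by (intro nQ nth_mem)
    ultimately show ?thesis by simp
  qed
qed simp

text \<open>Turns a statement about the \<open>t\<close>-th smallest p-value into a count, which is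
  a sum of indicators. \<open>Q\<close> is used both as \<open>\<le> x\<close> and as
  \<open>< x\<close>.\<close>

lemma p_ord_downward:
  assumes Q: "\<And>x y. x \<le> y \<Longrightarrow> Q y \<Longrightarrow> Q x" and t: "t \<in> {1..n}"
  shows "Q (p_ord n y t) \<longleftrightarrow> t \<le> card {i\<in>{..<n}. Q (1 - y i)}"
proof -
  let ?l = "map (\<lambda>i. 1 - y i) [0..<n]"
  have "Q (sort ?l ! (t - 1)) \<longleftrightarrow> t - 1 < length (filter Q (sort ?l))"
  proof (rule nth_filter_downward)
    show "t - 1 < length (sort ?l)" using t by auto
    show "Q x" if "x \<le> z" "Q z" for x z using that by (rule Q)
  qed simp
  also have "length (filter Q (sort ?l)) = length (filter Q ?l)"
    by (simp add: filter_sort)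
  also have "\<dots> = length (filter (\<lambda>i. Q (1 - y i)) [0..<n])"
    by (simp add: filter_map comp_def)
  also have "\<dots> = card (set (filter (\<lambda>i. Q (1 - y i)) [0..<n]))"
    by (rule distinct_card[symmetric]) simp
  also have "set (filter (\<lambda>i. Q (1 - y i)) [0..<n]) = {i\<in>{..<n}. Q (1 - y i)}" by auto
  finally show ?thesis using t by (auto simp: p_ord_def)
qed

lemma p_ord_in:
  assumes "t \<in> {1..n}"
  shows "\<exists>i<n. p_ord n y t = 1 - y i"
proof -
  have "p_ord n y t \<in> set (sort (map (\<lambda>i. 1 - y i) [0..<n]))"
    unfolding p_ord_def using assms by (auto simp del: set_sort intro!: nth_mem)
  then show ?thesis by auto
qed

lemma p_ord_mono:
  assumes "1 \<le> t" "t \<le> t'" "t' \<le> n"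
  shows "p_ord n y t \<le> p_ord n y t'"
  using assms unfolding p_ord_def by (auto intro!: sorted_nth_mono)

abbreviation GoF :: "real \<Rightarrow> statistic" where
  "GoF s \<equiv> TrGoF s (\<lambda>_. 0)"

definition GoF_set :: "real \<Rightarrow> nat \<Rightarrow> (nat \<Rightarrow> real) \<Rightarrow> real set" where
  "GoF_set s n y = {K_plus s (real t / real n) (p_ord n y t) | t. t \<in> {1..n} \<and> 0 \<le> p_ord n y (t + 1)}"

lemma TrGoF_eq: "GoF s n y = Max (GoF_set s n y)"
  by (simp add: TrGoF_def GoF_set_def)

lemma finite_GoF_set: "finite (GoF_set s n y)"
proof -
  have "GoF_set s n y \<subseteq> (\<lambda>t. K_plus s (real t / real n) (p_ord n y t)) ` {1..n}"
    by (auto simp: GoF_set_def)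
  then show ?thesis by (rule finite_subset) simp
qed

text \<open>The index \<open>t = n\<close> always qualifies, the p-value after the last being 1 by
  convention, and contributes 0 because \<open>u = 1\<close>. So the maximum runs over a nonempty
  set and is nonnegative.\<close>

lemma GoF_set_ne: "n > 0 \<Longrightarrow> 0 \<in> GoF_set s n y"
  unfolding GoF_set_def by (rule CollectI, rule exI[of _ n]) (auto simp: K_plus_def p_ord_def)

lemma TrGoF_le_iff:
  assumes "n > 0"
  shows "GoF s n y \<le> c \<longleftrightarrow>
    (\<forall>t\<in>{1..n}. 0 \<le> p_ord n y (t + 1) \<longrightarrow> K_plus s (real t / real n) (p_ord n y t) \<le> c)"
proof -
  have "Max (GoF_set s n y) \<le> c \<longleftrightarrow> (\<forall>x\<in>GoF_set s n y. x \<le> c)"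
    using GoF_set_ne[OF assms] by (intro Max_le_iff finite_GoF_set) auto
  then show ?thesis unfolding TrGoF_eq unfolding GoF_set_def by blast
qed

lemma TrGoF_le:
  assumes "n > 0" "0 < s" "s < 1" "0 \<le> d"
    and "\<And>t. t \<in> {1..n} \<Longrightarrow> real t / real n - p_ord n y t \<le> d"
  shows "GoF s n y \<le> d / (s * (1 - s))"
  unfolding TrGoF_le_iff[OF assms(1)] using assms by (auto intro: K_plus_le)

text \<open>A positive value cannot come from the default branch of \<open>K_plus\<close>; it is a
  genuine divergence at some rank and at the p-value of a single observation.\<close>

lemma TrGoF_pos_attained:
  assumes n: "n > 0" and pos: "GoF s n y = c" "0 < c"
  shows "\<exists>t\<in>{1..n}. \<exists>i<n. 0 < 1 - y i \<and> 1 - y i < real t / real n \<and> real t / real n < 1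
    \<and> K_div s (real t / real n) (1 - y i) = c"
proof -
  have "Max (GoF_set s n y) \<in> GoF_set s n y"
    using finite_GoF_set GoF_set_ne[OF n, of s y] by (intro Max_in) auto
  then obtain t where t: "t \<in> {1..n}" "K_plus s (real t / real n) (p_ord n y t) = c"
    using pos by (auto simp: GoF_set_def TrGoF_eq)
  obtain i where "i < n" "p_ord n y t = 1 - y i" using p_ord_in[OF t(1)] by blast
  then show ?thesis using t pos(2)
    by (intro bexI[OF _ t(1)] exI[of _ i]) (auto simp: K_plus_def split: if_splits)
qed

text \<open>No constraint is imposed on the largest p-value (there \<open>u = 1\<close>), whence the extra \<open>1/n\<close>.\<close>
lemma TrGoF_le_imp_p_ord_ge:
  assumes n: "n > 0" and s: "0 < s" "s < 1" and y: "\<And>i. i < n \<Longrightarrow> 0 < y i \<and> y i < 1"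
    and le: "GoF s n y \<le> d\<^sup>2 / 4" and d: "0 \<le> d" and t: "t \<in> {1..n}"
  shows "p_ord n y t < 1" and "t < n \<Longrightarrow> real t / real n - d \<le> p_ord n y t"
    and "real t / real n - (d + 1 / real n) \<le> p_ord n y t"
proof -
  have range: "0 < p_ord n y t \<and> p_ord n y t < 1" if t': "t \<in> {1..n}" for t
  proof -
    obtain i where "i < n" "p_ord n y t = 1 - y i" using p_ord_in[OF t'] by blast
    then show ?thesis using y[of i] by simp
  qed
  show "p_ord n y t < 1" using range[OF t] by simp
  have less: "real t / real n - d \<le> p_ord n y t" if t: "t \<in> {1..n}" "t < n" for t
  proof (rule ccontr)
    let ?u = "real t / real n" and ?v = "p_ord n y t"
    assume *: "\<not> ?thesis"
    then have uv: "0 < ?v" "?v < ?u" "?u < 1" proof -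
      have "?u < 1" using t by simp
      then show "0 < ?v" "?v < ?u" "?u < 1" using range[OF t(1)] d * by linarith+
    qed
    have "K_plus s ?u ?v \<le> d\<^sup>2 / 4"
    proof -
      have "t + 1 \<in> {1..n}" using t by simp
      then have "0 \<le> p_ord n y (t + 1)" using range by (simp add: less_imp_le)
      then show ?thesis using le t(1) unfolding TrGoF_le_iff[OF n] by blast
    qed
    then have "(?u - ?v)\<^sup>2 / 4 \<le> d\<^sup>2 / 4"
      using K_div_ge[OF s uv] uv by (simp add: K_plus_def)
    then have "(?u - ?v)\<^sup>2 \<le> d\<^sup>2" by simp
    then have "?u - ?v \<le> d" using d by (rule power2_le_imp_le)
    with * show False by simp
  qed
  show "t < n \<Longrightarrow> real t / real n - d \<le> p_ord n y t" using less[OF t] .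
  show "real t / real n - (d + 1 / real n) \<le> p_ord n y t"
  proof (cases "t < n")
    case True
    moreover have "0 \<le> 1 / real n" by simp
    ultimately show ?thesis using less[OF t] by linarith
  next
    case False
    then have tn: "t = n" using t by simp
    show ?thesis
    \<comment> \<open>Rank \<open>n\<close> inherits the bound of rank \<open>n - 1\<close> when
      there is one; for \<open>n = 1\<close> the bound to be shown is nonpositive.\<close>
    proof (cases "n = 1")
      case True
      then have "real t / real n = 1 / real n" using tn by simp
      then show ?thesis using range[OF t] d by linarith
    next
      case False
      then have "real (n - 1) / real n - d \<le> p_ord n y (n - 1)" using n by (intro less) auto
      also have "\<dots> \<le> p_ord n y n" using n False by (intro p_ord_mono) auto
      finally have "real (n - 1) / real n - d \<le> p_ord n y n" .
      moreover have "real (n - 1) / real n = real n / real n - 1 / real n"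
        using n by (simp add: of_nat_diff diff_divide_distrib)
      ultimately show ?thesis unfolding tn by linarith
    qed
  qed
qed

lemma measurable_p_ord:
  assumes t: "t \<in> {1..n + 1}"
  shows "(\<lambda>y. p_ord n y t) \<in> borel_measurable (obs_space n)"
proof (cases "t = n + 1")
  case True
  then show ?thesis by (simp add: p_ord_def)
next
  case False
  then have t': "t \<in> {1..n}" using t by auto
  show ?thesis
  proof (rule borel_measurableI_le)
    fix x
    have "(p_ord n y t \<le> x) \<longleftrightarrow> real t \<le> (\<Sum>i<n. indicator {u. 1 - u \<le> x} (y i))" for y
    proof -
      have "(\<Sum>i<n. indicator {u. 1 - u \<le> x} (y i)) = real (card {i\<in>{..<n}. 1 - y i \<le> x})"
        by (simp add: indicator_def sum.If_cases Int_def)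
      then show ?thesis using p_ord_downward[of "\<lambda>z. z \<le> x", OF _ t', of y] by simp
    qed
    then have "{y \<in> space (obs_space n). p_ord n y t \<le> x}
        = {y \<in> space (obs_space n). real t \<le> (\<Sum>i<n. indicator {u. 1 - u \<le> x} (y i))}" by simp
    also have "\<dots> \<in> sets (obs_space n)" by measurable
    finally show "{y \<in> space (obs_space n). p_ord n y t \<le> x} \<in> sets (obs_space n)" .
  qed
qed

lemma measurable_K_plus [measurable]: "K_plus s u \<in> borel_measurable borel"
  unfolding K_plus_def K_div_def phi_def by measurable

lemma measurable_statistic_TrGoF: "measurable_statistic (GoF s)"
  unfolding measurable_statistic_def
proof
  fix n
  show "GoF s n \<in> borel_measurable (obs_space n)"
  proof (cases "n = 0")
    case True
    \<comment> \<open>For \<open>n = 0\<close> the statistic is the unspecified constant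
      \<open>Max {}\<close>.\<close>
    then have "GoF s n = (\<lambda>_. Max {})" by (simp add: TrGoF_eq GoF_set_def fun_eq_iff)
    then show ?thesis by simp
  next
    case False
    show ?thesis
    proof (rule borel_measurableI_le)
      fix c
      have [measurable]: "Measurable.pred (obs_space n)
          (\<lambda>y. 0 \<le> p_ord n y (t + 1) \<longrightarrow> K_plus s (real t / real n) (p_ord n y t) \<le> c)" if "t \<in> {1..n}" for t
      proof -
        have [measurable]: "(\<lambda>y. p_ord n y t) \<in> borel_measurable (obs_space n)"
          "(\<lambda>y. p_ord n y (t + 1)) \<in> borel_measurable (obs_space n)"
          using that by (auto intro!: measurable_p_ord)
        show ?thesis by measurable
      qed
      have "{y \<in> space (obs_space n). GoF s n y \<le> c}
          = {y \<in> space (obs_space n). \<forall>t\<in>{1..n}. 0 \<le> p_ord n y (t + 1) \<longrightarrow> K_plus s (real t / real n) (p_ord n y t) \<le> c}"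
        using False by (simp add: TrGoF_le_iff)
      also have "\<dots> \<in> sets (obs_space n)" by measurable
      finally show "{y \<in> space (obs_space n). GoF s n y \<le> c} \<in> sets (obs_space n)" .
    qed
  qed
qed

section \<open>Behaviour under the null hypothesis\<close>

lemma H0_law_eq: "H0_law n = PiM {..<n} (\<lambda>_. mu0)"
  by (simp add: H0_law_def mu0_def)

lemma sets_H0_law [simp, measurable_cong]: "sets (H0_law n) = sets (obs_space n)"
  unfolding H0_law_eq by (intro sets_PiM_cong) auto

lemma space_H0_law: "space (H0_law n) = PiE {..<n} (\<lambda>_. UNIV)"
  by (simp add: H0_law_eq space_PiM)

lemma prob_space_H0_law: "prob_space (H0_law n)"
  unfolding H0_law_eq by (intro prob_space_PiM prob_space_mu0)

interpretation H: prob_space "H0_law n" for n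
  by (rule prob_space_H0_law)

lemma distr_H0_law_component:
  assumes "i < n"
  shows "distr (H0_law n) mu0 (\<lambda>y. y i) = mu0"
  unfolding H0_law_eq using assms by (intro distr_PiM_component prob_space_mu0) auto

lemma measurable_H0_component: "i < n \<Longrightarrow> (\<lambda>y. y i) \<in> measurable (H0_law n) mu0"
  unfolding H0_law_eq by (rule measurable_component_singleton) simp

lemma AE_H0_law: "AE y in H0_law n. \<forall>i\<in>{..<n}. 0 < y i \<and> y i < 1"
proof (rule AE_finite_allI)
  fix i assume "i \<in> {..<n}"
  then show "AE y in H0_law n. 0 < y i \<and> y i < 1"
    unfolding H0_law_eq using AE_mu0 by (intro AE_PiM_component prob_space_mu0) auto
qed simp

lemma
  assumes i: "i < n" and g: "integrable mu0 g"
  shows integrable_H0_component: "integrable (H0_law n) (\<lambda>y. g (y i) :: real)"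
    and integral_H0_component: "(\<integral>y. g (y i) \<partial>H0_law n) = (\<integral>r. g r \<partial>mu0)"
proof -
  have "integrable (distr (H0_law n) mu0 (\<lambda>y. y i)) g"
    using g by (simp add: distr_H0_law_component[OF i])
  then show "integrable (H0_law n) (\<lambda>y. g (y i))"
    by (rule integrable_distr[OF measurable_H0_component[OF i]])
  have "(\<integral>r. g r \<partial>distr (H0_law n) mu0 (\<lambda>y. y i)) = (\<integral>y. g (y i) \<partial>H0_law n)"
    using g by (intro integral_distr measurable_H0_component[OF i]) auto
  then show "(\<integral>y. g (y i) \<partial>H0_law n) = (\<integral>r. g r \<partial>mu0)"
    by (simp add: distr_H0_law_component[OF i])
qed

text \<open>Distinct coordinates are independent and \<open>h\<close> is centred, so only the
  diagonal of the expanded square survives.\<close>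

lemma H0_second_moment:
  fixes h :: "real \<Rightarrow> real"
  assumes h: "integrable mu0 h" "integrable mu0 (\<lambda>r. (h r)\<^sup>2)" and zero: "(\<integral>r. h r \<partial>mu0) = 0"
  shows "integrable (H0_law n) (\<lambda>y. (\<Sum>i<n. h (y i))\<^sup>2)"
    and "(\<integral>y. (\<Sum>i<n. h (y i))\<^sup>2 \<partial>H0_law n) = real n * (\<integral>r. (h r)\<^sup>2 \<partial>mu0)"
proof -
  interpret product_sigma_finite "\<lambda>_::nat. mu0" by unfold_locales
  have expand: "(\<Sum>i<n. h (y i))\<^sup>2 = (\<Sum>i<n. \<Sum>j<n. h (y i) * h (y j))" for y :: "nat \<Rightarrow> real"
    by (simp add: power2_eq_square sum_product)
  have cross: "integrable (H0_law n) (\<lambda>y. h (y i) * h (y j))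
      \<and> (\<integral>y. h (y i) * h (y j) \<partial>H0_law n) = (if i = j then \<integral>r. (h r)\<^sup>2 \<partial>mu0 else 0)"
    if ij: "i < n" "j < n" for i j
  proof (cases "i = j")
    case True
    then show ?thesis
      using integrable_H0_component[OF ij(1) h(2)] integral_H0_component[OF ij(1) h(2)]
      by (simp add: power2_eq_square)
  next
    case False
    \<comment> \<open>With 1 at all other coordinates, the cross term becomes a full product, to
      which the rule for integrals over product measures applies.\<close>
    define f where "f k = (if k = i \<or> k = j then h else (\<lambda>_. 1))" for k :: nat
    have f: "integrable mu0 (f k)" for k using h by (simp add: f_def)
    have prod: "(\<Prod>k<n. f k (y k)) = h (y i) * h (y j)" for y :: "nat \<Rightarrow> real"
    proof -
      have "(\<Prod>k<n. f k (y k)) = (\<Prod>k\<in>{i, j}. f k (y k))"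
        using ij by (intro prod.mono_neutral_right) (auto simp: f_def)
      then show ?thesis using False by (simp add: f_def)
    qed
    have "(\<Prod>k<n. \<integral>r. f k r \<partial>mu0) = 0"
      using ij zero by (intro prod_zero bexI[of _ i]) (auto simp: f_def)
    then show ?thesis
      using product_integrable_prod[of "{..<n}" f] product_integral_prod[of "{..<n}" f] f False
      by (simp add: prod H0_law_eq)
  qed
  show "integrable (H0_law n) (\<lambda>y. (\<Sum>i<n. h (y i))\<^sup>2)"
    unfolding expand using cross by (intro Bochner_Integration.integrable_sum) auto
  have "(\<integral>y. (\<Sum>i<n. \<Sum>j<n. h (y i) * h (y j)) \<partial>H0_law n)
      = (\<Sum>i<n. \<integral>y. (\<Sum>j<n. h (y i) * h (y j)) \<partial>H0_law n)"
    using cross by (intro Bochner_Integration.integral_sum Bochner_Integration.integrable_sum) auto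
  also have "\<dots> = (\<Sum>i<n. \<Sum>j<n. \<integral>y. h (y i) * h (y j) \<partial>H0_law n)"
    using cross by (intro sum.cong refl Bochner_Integration.integral_sum) auto
  also have "\<dots> = (\<Sum>i<n. \<Sum>j<n. if i = j then \<integral>r. (h r)\<^sup>2 \<partial>mu0 else 0)"
    using cross by (intro sum.cong refl) auto
  also have "\<dots> = real n * (\<integral>r. (h r)\<^sup>2 \<partial>mu0)" by simp
  finally show "(\<integral>y. (\<Sum>i<n. h (y i))\<^sup>2 \<partial>H0_law n) = real n * (\<integral>r. (h r)\<^sup>2 \<partial>mu0)"
    by (simp add: expand)
qed

text \<open>Chebyshev's inequality for the centred function, with bound
  \<open>V / (n * c\<^sup>2)\<close>.\<close>

lemma H0_weak_law:
  fixes g :: "real \<Rightarrow> real"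
  assumes g[measurable]: "g \<in> borel_measurable borel" and int: "integrable mu0 (\<lambda>r. (g r)\<^sup>2)" and c: "c > 0"
  shows "(\<lambda>n. \<P>(y in H0_law n. real n * c \<le> \<bar>(\<Sum>i<n. g (y i)) - real n * (\<integral>r. g r \<partial>mu0)\<bar>)) \<longlonglongrightarrow> 0"
proof -
  define \<mu> where "\<mu> = (\<integral>r. g r \<partial>mu0)"
  define h where "h r = g r - \<mu>" for r
  have g1: "integrable mu0 g" by (rule mu0.square_integrable_imp_integrable[OF _ int]) simp
  have h1: "integrable mu0 h" unfolding h_def using g1 by simp
  have h2: "integrable mu0 (\<lambda>r. (h r)\<^sup>2)"
    unfolding h_def power2_diff using g1 int by simp
  have h0: "(\<integral>r. h r \<partial>mu0) = 0"
    unfolding h_def using g1 mu0.prob_space by (simp add: \<mu>_def)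
  define V where "V = (\<integral>r. (h r)\<^sup>2 \<partial>mu0)"
  have V: "0 \<le> V" by (simp add: V_def)
  have "\<P>(y in H0_law n. real n * c \<le> \<bar>(\<Sum>i<n. g (y i)) - real n * \<mu>\<bar>) \<le> V / c\<^sup>2 * inverse (real n)" if n: "n > 0" for n
  proof -
    have eq: "(\<Sum>i<n. g (y i)) - real n * \<mu> = (\<Sum>i<n. h (y i))" for y :: "nat \<Rightarrow> real"
      by (simp add: h_def sum_subtractf)
    have hm: "h \<in> borel_measurable mu0" using h1 by (rule borel_measurable_integrable)
    have meas: "(\<lambda>y. \<Sum>i<n. h (y i)) \<in> borel_measurable (H0_law n)"
    proof (rule borel_measurable_sum)
      fix i assume "i \<in> {..<n}"
      then show "(\<lambda>y. h (y i)) \<in> borel_measurable (H0_law n)"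
        by (intro measurable_compose[OF measurable_H0_component hm]) simp
    qed
    have "\<P>(y in H0_law n. real n * c \<le> \<bar>\<Sum>i<n. h (y i)\<bar>)
        \<le> (\<integral>y. (\<Sum>i<n. h (y i))\<^sup>2 \<partial>H0_law n) / (real n * c)\<^sup>2"
      using n c H0_second_moment(1)[OF h1 h2 h0] meas by (intro H.second_moment_method) auto
    also have "\<dots> = V / c\<^sup>2 * inverse (real n)"
    proof -
      have "(real n * c)\<^sup>2 = real n * (real n * c\<^sup>2)" by (simp add: power2_eq_square)
      then have "real n * V / (real n * c)\<^sup>2 = V / (real n * c\<^sup>2)" using n by simp
      also have "\<dots> = V / c\<^sup>2 * inverse (real n)" by (simp add: divide_inverse mult_ac)
      finally show ?thesis
        by (simp only: H0_second_moment(2)[OF h1 h2 h0, of n] V_def)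
    qed
    finally show ?thesis by (simp add: eq)
  qed
  then have "eventually (\<lambda>n. norm (\<P>(y in H0_law n. real n * c \<le> \<bar>(\<Sum>i<n. g (y i)) - real n * \<mu>\<bar>)) \<le> V / c\<^sup>2 * inverse (real n)) sequentially"
    by (intro eventually_sequentiallyI[of 1]) simp
  moreover have "(\<lambda>n. V / c\<^sup>2 * inverse (real n)) \<longlonglongrightarrow> 0"
    using tendsto_mult[OF tendsto_const lim_inverse_n, of "V / c\<^sup>2"] by (simp only: mult_zero_right)
  ultimately show ?thesis unfolding \<mu>_def by (rule Lim_null_comparison)
qed

lemma measure_mu0_ge:
  assumes "0 \<le> x" "x \<le> 1"
  shows "measure mu0 {u. 1 - u \<le> x} = x"
proof -
  have "{u. 1 - u \<le> x} \<inter> {0..1} = {1-x..1}" using assms by auto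
  then have "emeasure mu0 {u. 1 - u \<le> x} = ennreal x"
    using assms by (subst emeasure_mu0) auto
  then show ?thesis using assms by (simp add: measure_def)
qed

lemma measurable_TrGoF [measurable]:
  "GoF s n \<in> borel_measurable (obs_space n)"
  using measurable_statistic_TrGoF by (simp add: measurable_statistic_def)

text \<open>A one-sided Glivenko-Cantelli argument: the weak law controls the counts on the grid
  \<open>j / m\<close>, and monotonicity of counts covers the points in between. Hence
  \<open>t / n\<close> exceeds the \<open>t\<close>-th p-value by at most \<open>d\<close>, and the
  linear upper bound on \<open>K_plus\<close> applies.\<close>

lemma TrGoF_tendsto_0_in_prob:
  assumes s: "0 < s" "s < 1" and \<eta>: "0 < \<eta>"
  shows "(\<lambda>n. \<P>(y in H0_law n. \<eta> \<le> GoF s n y)) \<longlonglongrightarrow> 0"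
proof -
  \<comment> \<open>Half of what would give the bound \<open>\<eta>\<close>, so that the final
    inequality is strict.\<close>
  define d where "d = \<eta> * (s * (1 - s)) / 2"
  have d: "0 < d" using s \<eta> by (simp add: d_def)
  have d\<eta>: "d / (s * (1 - s)) < \<eta>" using s \<eta> by (simp add: d_def)
  obtain k where k: "inverse (real (Suc k)) < d / 2" using reals_Archimedean[of "d / 2"] d by auto
  define m where "m = Suc k"
  have m: "m > 0" "1 / real m < d / 2" using k unfolding m_def inverse_eq_divide by simp_all
  define x where "x j = real j / real m" for j :: nat
  define g :: "nat \<Rightarrow> real \<Rightarrow> real" where "g j = indicator {u. 1 - u \<le> x j}" for j
  define B where "B n j = {y\<in>space (H0_law n).
    real n * (d / 2) \<le> \<bar>(\<Sum>i<n. g j (y i)) - real n * (\<integral>r. g j r \<partial>mu0)\<bar>}" for n j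
  have gm[measurable]: "g j \<in> borel_measurable borel" for j unfolding g_def by measurable
  have gsq: "(\<lambda>r. (g j r)\<^sup>2) = g j" for j by (auto simp: g_def indicator_def)
  have gi: "integrable mu0 (g j)" for j
    unfolding g_def by (intro integrable_real_indicator) (auto simp: less_top[symmetric])
  have lim: "(\<lambda>n. measure (H0_law n) (B n j)) \<longlonglongrightarrow> 0" for j
    unfolding B_def using d gi by (intro H0_weak_law gm) (simp_all add: gsq)
  have "(\<lambda>n. \<Sum>j\<in>{1..m}. measure (H0_law n) (B n j)) \<longlonglongrightarrow> (\<Sum>j\<in>{1..m}. 0)"
    by (intro tendsto_sum lim)
  then have lim': "(\<lambda>n. \<Sum>j\<in>{1..m}. measure (H0_law n) (B n j)) \<longlonglongrightarrow> 0" by simp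
  have gint: "(\<integral>r. g j r \<partial>mu0) = x j" if "j \<in> {1..m}" for j
    using that m unfolding g_def by (simp add: measure_mu0_ge x_def)
  have "\<P>(y in H0_law n. \<eta> \<le> GoF s n y)
      \<le> (\<Sum>j\<in>{1..m}. measure (H0_law n) (B n j))" if n: "n > 0" for n
  proof -
    have B: "B n j \<in> sets (H0_law n)" for j
      unfolding B_def by measurable
    have "\<P>(y in H0_law n. \<eta> \<le> GoF s n y) \<le> measure (H0_law n) (\<Union>j\<in>{1..m}. B n j)"
    proof (rule H.finite_measure_mono_AE)
      show "AE y in H0_law n. y \<in> {y\<in>space (H0_law n). \<eta> \<le> GoF s n y} \<longrightarrow> y \<in> (\<Union>j\<in>{1..m}. B n j)"
        using AE_H0_law AE_space
      proof eventually_elim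
        case (elim y)
        have "GoF s n y \<le> d / (s * (1 - s))" if nB: "\<And>j. j \<in> {1..m} \<Longrightarrow> y \<notin> B n j"
        proof (rule TrGoF_le[OF n s])
          fix t assume t: "t \<in> {1..n}"
          define p where "p = p_ord n y t"
          obtain i where "i < n" "p = 1 - y i" using p_ord_in[OF t] by (auto simp: p_def)
          then have p: "0 < p" "p < 1" using elim by auto
          \<comment> \<open>The next grid point at or above \<open>p\<close>. It overshoots by at
            most \<open>1 / m < d / 2\<close>; the deviation of the count accounts for the other
            \<open>d / 2\<close>.\<close>
          define j where "j = nat \<lceil>real m * p\<rceil>"
          have "0 < real m * p" "real m * p < real m" using p m by auto
          then have c: "1 \<le> \<lceil>real m * p\<rceil>" "\<lceil>real m * p\<rceil> \<le> int m" by linarith+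
          then have "real j = of_int \<lceil>real m * p\<rceil>" unfolding j_def by simp
          then have j: "real m * p \<le> real j" "real j \<le> real m * p + 1" by linarith+
          have j1: "j \<in> {1..m}" unfolding atLeastAtMost_iff j_def using c by linarith
          have xj: "p \<le> x j" "x j \<le> p + 1 / real m"
            using j m by (auto simp: x_def field_simps)
          have "p_ord n y t \<le> x j \<longleftrightarrow> t \<le> card {i\<in>{..<n}. 1 - y i \<le> x j}"
            by (rule p_ord_downward[of "\<lambda>z. z \<le> x j", OF _ t]) simp
          then have "real t \<le> real (card {i\<in>{..<n}. 1 - y i \<le> x j})" using xj by (simp add: p_def)
          also have "\<dots> = (\<Sum>i<n. g j (y i))"
            by (simp add: g_def indicator_def sum.If_cases Int_def)
          also have "\<dots> < real n * x j + real n * (d / 2)"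
          proof -
            have "\<not> real n * (d / 2) \<le> \<bar>(\<Sum>i<n. g j (y i)) - real n * x j\<bar>"
              using nB[OF j1] elim(2) unfolding B_def gint[OF j1] by blast
            then show ?thesis by linarith
          qed
          also have "\<dots> \<le> real n * (p + d)"
            unfolding distrib_left[symmetric] using xj m by (intro mult_left_mono) linarith+
          finally have "real t / real n < p + d" using n by (simp add: field_simps)
          then show "real t / real n - p_ord n y t \<le> d" by (simp add: p_def)
        qed (use d in simp)
        then show ?case using d\<eta> elim by force
      qed
      show "(\<Union>j\<in>{1..m}. B n j) \<in> sets (H0_law n)" using B by auto
    qed
    also have "\<dots> \<le> (\<Sum>j\<in>{1..m}. measure (H0_law n) (B n j))"
      using B by (intro H.finite_measure_subadditive_finite) auto
    finally show ?thesis .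
  qed
  then have "eventually (\<lambda>n. norm (\<P>(y in H0_law n. \<eta> \<le> GoF s n y))
      \<le> (\<Sum>j\<in>{1..m}. measure (H0_law n) (B n j))) sequentially"
    by (intro eventually_sequentiallyI[of 1]) simp
  then show ?thesis using lim' by (rule Lim_null_comparison)
qed

text \<open>With a critical value above \<open>\<eta>\<close> the rejection probability would be at
  most that of \<open>\<eta> \<le> GoF s n y\<close>, which eventually drops below
  \<open>\<alpha>\<close>.\<close>

lemma critical_value_TrGoF_small:
  assumes s: "0 < s" "s < 1" and \<eta>: "0 < \<eta>" and \<alpha>: "0 < \<alpha>"
    and crit: "critical_values \<alpha> (GoF s) \<gamma>"
  shows "eventually (\<lambda>n. \<gamma> n \<le> \<eta>) sequentially"
proof -
  have "eventually (\<lambda>n. \<P>(y in H0_law n. \<eta> \<le> GoF s n y) < \<alpha>) sequentially"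
    using TrGoF_tendsto_0_in_prob[OF s \<eta>] \<alpha> by (rule order_tendstoD)
  with crit[unfolded critical_values_def] show ?thesis
  proof eventually_elim
    case (elim n)
    show ?case
    proof (rule ccontr)
      assume "\<not> \<gamma> n \<le> \<eta>"
      then have "\<P>(y in H0_law n. \<gamma> n \<le> GoF s n y)
          \<le> \<P>(y in H0_law n. \<eta> \<le> GoF s n y)"
      proof (intro H.finite_measure_mono)
        show "{y\<in>space (H0_law n). \<eta> \<le> GoF s n y} \<in> sets (H0_law n)" by measurable
      qed auto
      with elim show False by simp
    qed
  qed
qed

section \<open>Existence of critical values\<close>

text \<open>Rotation of the circle of length 1 with fundamental domain (0, 1]: the point 1 is not
  wrapped to 0.\<close>

definition rot :: "real \<Rightarrow> real \<Rightarrow> real" where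
  "rot c x = (if x + c \<le> 1 then x + c else x + c - 1)"

lemma measurable_rot [measurable]: "rot c \<in> borel_measurable borel"
  unfolding rot_def by measurable

lemma emeasure_mu0':
  assumes [measurable]: "A \<in> sets borel"
  shows "emeasure mu0 A = emeasure lborel (A \<inter> {0<..1})"
proof -
  have "AE x in lborel. x \<noteq> (0::real)" by (rule AE_lborel_singleton)
  then have "emeasure lborel (A \<inter> {0..1}) = emeasure lborel (A \<inter> {0<..1})"
    by (intro emeasure_eq_AE) (auto elim!: eventually_mono)
  then show ?thesis by (simp add: emeasure_mu0)
qed

lemma emeasure_lborel_shift:
  fixes A :: "real set"
  assumes "A \<in> sets borel"
  shows "emeasure lborel ((+) c -` A) = emeasure lborel A"
proof -
  have "emeasure (distr lborel borel ((+) c)) A = emeasure lborel ((+) c -` A \<inter> space lborel)"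
    using assms by (intro emeasure_distr) auto
  then show ?thesis by (simp add: lborel_distr_plus)
qed

text \<open>A rotation is a translation on each of two pieces, whose images \<open>(c, 1]\<close>
  and \<open>(0, c]\<close> tile the circle.\<close>

lemma distr_mu0_rot:
  assumes c: "0 \<le> c" "c \<le> 1"
  shows "distr mu0 mu0 (rot c) = mu0"
proof (rule measure_eqI)
  fix A assume "A \<in> sets (distr mu0 mu0 (rot c))"
  then have A[measurable]: "A \<in> sets borel" by simp
  let ?A1 = "A \<inter> {c<..1}" and ?A2 = "A \<inter> {0<..c}"
  have sh: "(+) d -` B \<in> sets borel" if "B \<in> sets borel" for d :: real and B
    using measurable_sets[of "(+) d" borel borel B] that by simp
  have "emeasure (distr mu0 mu0 (rot c)) A = emeasure mu0 (rot c -` A)"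
    by (subst emeasure_distr) auto
  also have "\<dots> = emeasure lborel (rot c -` A \<inter> {0<..1})"
    using measurable_sets[of "rot c" borel borel A] by (intro emeasure_mu0') simp
  also have "rot c -` A \<inter> {0<..1} = ((+) c -` ?A1) \<union> ((+) (c - 1) -` ?A2)"
    using c by (auto simp: rot_def add.commute split: if_splits) (simp_all add: algebra_simps)
  also have "emeasure lborel \<dots> = emeasure lborel ((+) c -` ?A1) + emeasure lborel ((+) (c - 1) -` ?A2)"
    by (rule plus_emeasure[symmetric]) (auto intro!: sh)
  also have "\<dots> = emeasure lborel ?A1 + emeasure lborel ?A2"
  proof -
    have "?A1 \<in> sets borel" "?A2 \<in> sets borel" by auto
    then show ?thesis by (simp only: emeasure_lborel_shift)
  qed
  also have "\<dots> = emeasure lborel (?A1 \<union> ?A2)"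
    by (rule plus_emeasure) auto
  also have "?A1 \<union> ?A2 = A \<inter> {0<..1}" using c by auto
  also have "emeasure lborel \<dots> = emeasure mu0 A" by (rule emeasure_mu0'[symmetric]) simp
  finally show "emeasure (distr mu0 mu0 (rot c)) A = emeasure mu0 A" .
qed simp

lemma distr_H0_rot:
  assumes c: "0 \<le> c" "c \<le> 1"
  shows "distr (H0_law n) (H0_law n) (compose {..<n} (rot c)) = H0_law n"
proof -
  have "distr (PiM {..<n} (\<lambda>_. mu0)) (PiM {..<n} (\<lambda>_. mu0)) (compose {..<n} (rot c))
      = PiM {..<n} (\<lambda>_. distr mu0 mu0 (rot c))"
    by (rule distr_PiM_finite_prob_space') (auto intro: prob_space_mu0)
  then show ?thesis by (simp add: H0_law_eq distr_mu0_rot[OF c])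
qed

text \<open>Equivalently, the \<open>j\<close>-th smallest p-value is at least \<open>j / n\<close>
  for every \<open>j < n\<close>. Counts are used because they can be followed through a rotation,
  which changes the order of the points.\<close>

definition below_line :: "nat \<Rightarrow> (nat \<Rightarrow> real) set" where
  "below_line n = {y. \<forall>j\<in>{1..<n}. card {k\<in>{..<n}. 1 - y k < real j / real n} < j}"

lemma below_line_iff:
  "y \<in> below_line n \<longleftrightarrow> (\<forall>j\<in>{1..<n}. (\<Sum>k<n. indicator {u. 1 - u < real j / real n} (y k)) < real j)"
proof -
  have "(\<Sum>k<n. indicator {u. 1 - u < real j / real n} (y k)) = real (card {k\<in>{..<n}. 1 - y k < real j / real n})" for j
    by (simp add: indicator_def sum.If_cases Int_def)
  then show ?thesis by (simp add: below_line_def)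
qed

lemma sets_below_line: "below_line n \<inter> space (H0_law n) \<in> sets (H0_law n)"
proof -
  have "{y \<in> space (H0_law n). \<forall>j\<in>{1..<n}. (\<Sum>k<n. indicator {u. 1 - u < real j / real n} (y k)) < real j}
      \<in> sets (H0_law n)" by measurable
  also have "{y \<in> space (H0_law n). \<forall>j\<in>{1..<n}. (\<Sum>k<n. indicator {u. 1 - u < real j / real n} (y k)) < real j}
      = below_line n \<inter> space (H0_law n)" by (auto simp: below_line_iff)
  finally show ?thesis .
qed

text \<open>An arc of length \<open>(b - a)/n\<close> would carry fewer than \<open>b - a\<close> points and its complement
  fewer than \<open>n - (b - a)\<close>.\<close>
lemma below_line_rot_disjoint:
  assumes y: "\<And>k. k < n \<Longrightarrow> 0 < y k \<and> y k < 1" and ab: "a < b" "b < n"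
    and a: "(\<lambda>k. rot (real a / real n) (y k)) \<in> below_line n"
    and b: "(\<lambda>k. rot (real b / real n) (y k)) \<in> below_line n"
  shows False
proof -
  let ?A = "{k\<in>{..<n}. 1 - rot (real a / real n) (y k) < real (b - a) / real n}"
  let ?B = "{k\<in>{..<n}. 1 - rot (real b / real n) (y k) < real (n - (b - a)) / real n}"
  have "card ?A < b - a"
    by (rule bspec[OF a[unfolded below_line_def mem_Collect_eq]]) (use ab in auto)
  moreover have "card ?B < n - (b - a)"
    by (rule bspec[OF b[unfolded below_line_def mem_Collect_eq]]) (use ab in auto)
  moreover have "{..<n} \<subseteq> ?A \<union> ?B"
  proof
    fix k assume k: "k \<in> {..<n}"
    define u v where "u = real a / real n" and "v = real b / real n"
    have uv: "0 \<le> u" "u < v" "v < 1" using ab by (auto simp: u_def v_def divide_strict_right_mono)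
    have 1: "real (b - a) / real n = v - u" "real (n - (b - a)) / real n = 1 - (v - u)"
      using ab by (auto simp: u_def v_def of_nat_diff diff_divide_distrib add_divide_distrib)
    show "k \<in> ?A \<union> ?B"
      using k y[of k] uv unfolding 1 u_def[symmetric] v_def[symmetric] by (auto simp: rot_def)
  qed
  then have "card {..<n} \<le> card (?A \<union> ?B)" by (intro card_mono) auto
  ultimately show False using card_Un_le[of ?A ?B] ab unfolding card_lessThan by linarith
qed

text \<open>A form of the cycle lemma: rotations by the \<open>n\<close> multiples of
  \<open>1 / n\<close> preserve the null law, and almost every configuration is below the line after
  at most one of them.\<close>

lemma measure_below_line_le:
  assumes n: "n > 0"
  shows "measure (H0_law n) (below_line n \<inter> space (H0_law n)) \<le> 1 / real n"
proof -
  define G where "G = {y\<in>space (H0_law n). \<forall>i\<in>{..<n}. 0 < y i \<and> y i < 1}"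
  have G: "G \<in> sets (H0_law n)" unfolding G_def by measurable
  \<comment> \<open>Intersecting with the almost sure event \<open>G\<close> gives the strict
    coordinate bounds on which disjointness relies.\<close>
  define E where "E i = compose {..<n} (rot (real i / real n)) -` (below_line n \<inter> space (H0_law n))
    \<inter> space (H0_law n) \<inter> G" for i
  have comp: "compose {..<n} (rot c) \<in> measurable (H0_law n) (H0_law n)" for c
    unfolding H0_law_eq compose_def by (intro measurable_restrict) measurable
  have Es: "E i \<in> sets (H0_law n)" for i
    unfolding E_def using measurable_sets[OF comp sets_below_line] G by auto
  have mE: "measure (H0_law n) (E i) = measure (H0_law n) (below_line n \<inter> space (H0_law n))" if "i < n" for i
  proof -
    have "measure (H0_law n) (E i) = measure (H0_law n) (compose {..<n} (rot (real i / real n)) -` (below_line n \<inter> space (H0_law n))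
        \<inter> space (H0_law n))"
    proof (rule H.finite_measure_eq_AE)
      show "AE y in H0_law n. (y \<in> E i) = (y \<in> compose {..<n} (rot (real i / real n)) -` (below_line n \<inter> space (H0_law n))
        \<inter> space (H0_law n))"
        using AE_H0_law by eventually_elim (auto simp: E_def G_def)
    qed (use Es measurable_sets[OF comp sets_below_line] in auto)
    also have "\<dots> = measure (distr (H0_law n) (H0_law n) (compose {..<n} (rot (real i / real n)))) (below_line n \<inter> space (H0_law n))"
      by (rule measure_distr[symmetric, OF comp sets_below_line])
    also have "\<dots> = measure (H0_law n) (below_line n \<inter> space (H0_law n))"
      using that by (subst distr_H0_rot) auto
    finally show ?thesis .
  qed
  have mem: "(\<lambda>k. rot (real i / real n) (y k)) \<in> below_line n" if "y \<in> E i" for y i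
  proof -
    have "compose {..<n} (rot (real i / real n)) y \<in> below_line n" using that by (simp add: E_def)
    then show ?thesis by (simp add: below_line_def compose_def cong: conj_cong)
  qed
  have disj: "disjoint_family_on E {..<n}"
  proof -
    have "E i \<inter> E j = {}" if "i < j" "j < n" for i j
    proof (rule ccontr)
      assume "E i \<inter> E j \<noteq> {}"
      then obtain y where y: "y \<in> E i" "y \<in> E j" by auto
      have "0 < y k \<and> y k < 1" if "k < n" for k using y(1) that by (auto simp: E_def G_def)
      from below_line_rot_disjoint[OF this \<open>i < j\<close> \<open>j < n\<close> mem[OF y(1)] mem[OF y(2)]]
      show False .
    qed
    then show ?thesis unfolding disjoint_family_on_def
      by (metis Int_commute lessThan_iff linorder_neqE_nat)
  qed
  have "real n * measure (H0_law n) (below_line n \<inter> space (H0_law n)) = (\<Sum>i<n. measure (H0_law n) (E i))"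
    by (simp add: mE)
  also have "\<dots> = measure (H0_law n) (\<Union>i<n. E i)"
    using Es disj by (intro H.finite_measure_finite_Union[symmetric]) auto
  also have "\<dots> \<le> 1" by (rule H.prob_le_1)
  finally show ?thesis using n by (simp add: field_simps)
qed

section \<open>Atoms of the null distribution and the choice of critical values\<close>

lemma TrGoF_eq_0_imp_below_line:
  assumes n: "n > 0" and s: "0 < s" "s < 1" and y: "\<And>i. i < n \<Longrightarrow> 0 < y i \<and> y i < 1"
    and zero: "GoF s n y \<le> 0"
  shows "y \<in> below_line n"
  unfolding below_line_def
proof (intro CollectI ballI)
  fix j assume j: "j \<in> {1..<n}"
  let ?c = "card {k\<in>{..<n}. 1 - y k < real j / real n}"
  \<comment> \<open>The case \<open>d = 0\<close> of the bound on ordered p-values, which has no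
    \<open>1 / n\<close> term below rank \<open>n\<close>.\<close>
  have ge: "real t / real n \<le> p_ord n y t" if "t \<in> {1..n}" "t < n" for t
    using TrGoF_le_imp_p_ord_ge(2)[OF n s y, where d = 0 and t = t] zero that by simp
  have iff: "p_ord n y t < real j / real n \<longleftrightarrow> t \<le> ?c" if "t \<in> {1..n}" for t
    by (rule p_ord_downward[of "\<lambda>z. z < real j / real n", OF _ that]) simp
  show "?c < j"
  proof (rule ccontr)
    assume "\<not> ?c < j"
    then have "p_ord n y j < real j / real n" using iff[of j] j by auto
    moreover have "real j / real n \<le> p_ord n y j" using ge[of j] j by auto
    ultimately show False by simp
  qed
qed

text \<open>By strict monotonicity of \<open>K_div\<close> in its second argument, a value
  \<open>c > 0\<close> forces some observation to equal one of finitely many prescribed numbers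
  \<open>1 - v t\<close>.\<close>

lemma measure_TrGoF_eq_0:
  assumes n: "n > 0" and s: "0 < s" "s < 1" and c: "0 < c"
  shows "\<P>(y in H0_law n. GoF s n y = c) = 0"
proof -
  \<comment> \<open>If \<open>c\<close> is not attained at rank \<open>t\<close>, the chosen number
    is arbitrary; this is harmless as every single point is null.\<close>
  define v where "v t = (SOME v. 0 < v \<and> v < real t / real n \<and> K_div s (real t / real n) v = c)" for t :: nat
  define Z where "Z t i = {y\<in>space (H0_law n). y i = 1 - v t}" for t i
  have Z0: "Z t i \<in> null_sets (H0_law n)" if i: "i < n" for t i
  proof -
    have eq: "Z t i = (\<lambda>y. y i) -` {1 - v t} \<inter> space (H0_law n)" by (auto simp: Z_def)
    have s1: "{1 - v t} \<in> sets mu0" by simp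
    have "emeasure (H0_law n) (Z t i) = emeasure (distr (H0_law n) mu0 (\<lambda>y. y i)) {1 - v t}"
      unfolding eq by (rule emeasure_distr[symmetric, OF measurable_H0_component[OF i] s1])
    also have "\<dots> = 0" by (simp add: distr_H0_law_component[OF i] emeasure_mu0_singleton)
    finally show ?thesis
      using measurable_sets[OF measurable_H0_component[OF i] s1] by (auto simp: eq null_sets_def)
  qed
  have N: "(\<Union>t\<in>{1..n}. \<Union>i\<in>{..<n}. Z t i) \<in> null_sets (H0_law n)"
    using Z0 by (intro null_sets_UN' countable_finite) auto
  have "{y\<in>space (H0_law n). GoF s n y = c} \<subseteq> (\<Union>t\<in>{1..n}. \<Union>i\<in>{..<n}. Z t i)"
  proof
    fix y assume y: "y \<in> {y\<in>space (H0_law n). GoF s n y = c}"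
    then obtain t i where t: "t \<in> {1..n}" "i < n" "0 < 1 - y i" "1 - y i < real t / real n"
      "real t / real n < 1" "K_div s (real t / real n) (1 - y i) = c"
      using TrGoF_pos_attained[OF n _ c] by blast
    have "0 < v t \<and> v t < real t / real n \<and> K_div s (real t / real n) (v t) = c"
      unfolding v_def by (rule someI[of _ "1 - y i"]) (use t in simp)
    then have "v t = 1 - y i"
      using K_div_strict_antimono[OF s, of "v t" "1 - y i" "real t / real n"]
        K_div_strict_antimono[OF s, of "1 - y i" "v t" "real t / real n"] t
      by (cases "v t" "1 - y i" rule: linorder_cases) auto
    then have "y \<in> Z t i" using y by (simp add: Z_def)
    then show "y \<in> (\<Union>t\<in>{1..n}. \<Union>i\<in>{..<n}. Z t i)" using t by blast
  qed
  then have "{y\<in>space (H0_law n). GoF s n y = c} \<in> null_sets (H0_law n)"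
    using N by (rule null_sets_subset[OF _ _ , rotated -1]) measurable
  then show ?thesis by (rule measure_eq_0_null_sets)
qed

text \<open>The cdf of the statistic is continuous at positive points, so the intermediate value
  theorem applies once its value at 0, at most \<open>1 / n\<close>, is below
  \<open>1 - \<alpha>\<close>. That holds for all large \<open>n\<close>, as
  \<open>critical_values\<close> demands.\<close>

lemma critical_values_TrGoF_exist:
  assumes s: "0 < s" "s < 1" and \<alpha>: "0 < \<alpha>" "\<alpha> < 1"
  shows "\<exists>\<gamma>. critical_values \<alpha> (GoF s) \<gamma>"
proof -
  have "eventually (\<lambda>n. 1 / real n < 1 - \<alpha>) sequentially"
    using \<alpha> by (intro order_tendstoD(2)[OF lim_1_over_n]) simp
  then have "eventually (\<lambda>n. \<exists>c. \<P>(y in H0_law n. c \<le> GoF s n y) = \<alpha>) sequentially"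
    using eventually_gt_at_top[of 0]
  proof eventually_elim
    case (elim n)
    let ?S = "GoF s n"
    let ?N = "distr (H0_law n) borel ?S"
    have Sm: "?S \<in> borel_measurable (H0_law n)" by measurable
    interpret N: prob_space ?N by (rule H.prob_space_distr[OF Sm])
    interpret N: real_distribution ?N by unfold_locales auto
    have mN: "measure ?N A = \<P>(y in H0_law n. ?S y \<in> A)" if "A \<in> sets borel" for A
      using measure_distr[OF Sm that] by (simp add: vimage_def Int_def conj_commute)
    have cont: "isCont (cdf ?N) c" if "0 < c" for c
      unfolding N.isCont_cdf using mN[of "{c}"] measure_TrGoF_eq_0[OF elim(2) s that] by simp
    have "cdf ?N 0 \<le> measure (H0_law n) (below_line n \<inter> space (H0_law n))"
      unfolding cdf_def mN[OF borel_closed[OF closed_atMost]]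
    proof (rule H.finite_measure_mono_AE[OF _ sets_below_line])
      show "AE y in H0_law n. y \<in> {y \<in> space (H0_law n). ?S y \<in> {..0}} \<longrightarrow> y \<in> below_line n \<inter> space (H0_law n)"
        using AE_H0_law
      proof eventually_elim
        case (elim y)
        then show ?case using TrGoF_eq_0_imp_below_line[OF \<open>0 < n\<close> s, of y] by auto
      qed
    qed
    also have "\<dots> \<le> 1 / real n" by (rule measure_below_line_le[OF elim(2)])
    finally have "cdf ?N 0 < 1 - \<alpha>" using elim(1) by simp
    \<comment> \<open>Right continuity moves the left end of the interval away from 0, where the cdf
      may jump.\<close>
    moreover have "(cdf ?N \<longlongrightarrow> cdf ?N 0) (at_right 0)"
      using N.cdf_is_right_cont[of 0] by (simp add: continuous_within)
    ultimately have "eventually (\<lambda>c. cdf ?N c < 1 - \<alpha>) (at_right 0)"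
      by (intro order_tendstoD(2))
    then obtain b where b: "0 < b" "\<And>c. 0 < c \<Longrightarrow> c < b \<Longrightarrow> cdf ?N c < 1 - \<alpha>"
      unfolding eventually_at_right_field by blast
    define a where "a = b / 2"
    have a: "0 < a" "cdf ?N a < 1 - \<alpha>" using b by (auto simp: a_def)
    have "eventually (\<lambda>c. 1 - \<alpha> < cdf ?N c) at_top"
      using N.cdf_lim_at_top_prob \<alpha> by (intro order_tendstoD(1)) auto
    then have "eventually (\<lambda>c. 1 - \<alpha> < cdf ?N c \<and> a \<le> c) at_top"
      using eventually_ge_at_top[of a] by (rule eventually_conj)
    then obtain B where B: "1 - \<alpha> < cdf ?N B" "a \<le> B"
      using eventually_happens'[OF trivial_limit_at_top_linorder] by blast
    have "\<exists>c. a \<le> c \<and> c \<le> B \<and> cdf ?N c = 1 - \<alpha>"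
      using a B cont by (intro IVT) auto
    then obtain c where c: "0 < c" "cdf ?N c = 1 - \<alpha>" using a by (meson less_le_trans)
    \<comment> \<open>Without an atom at \<open>c\<close>, the event \<open>> c\<close> of
      probability \<open>\<alpha>\<close> may be replaced by \<open>\<ge> c\<close>.\<close>
    have "measure ?N {c} = 0" using cont[OF c(1)] N.isCont_cdf by simp
    have "{..c} \<union> {c<..} = UNIV" by auto
    then have "1 = measure ?N ({..c} \<union> {c<..})" using N.prob_space by simp
    also have "\<dots> = measure ?N {..c} + measure ?N {c<..}"
      by (rule N.finite_measure_Union) auto
    finally have "measure ?N {c<..} = \<alpha>" using c(2) by (simp add: cdf_def)
    moreover have "measure ?N ({c} \<union> {c<..}) = measure ?N {c} + measure ?N {c<..}"
      by (rule N.finite_measure_Union) auto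
    moreover have "{c} \<union> {c<..} = {c..}" by auto
    ultimately have "measure ?N {c..} = \<alpha>" using \<open>measure ?N {c} = 0\<close> by simp
    then show ?case using mN[of "{c..}"] by auto
  qed
  then have "critical_values \<alpha> (GoF s)
      (\<lambda>n. SOME c. \<P>(y in H0_law n. c \<le> GoF s n y) = \<alpha>)"
    unfolding critical_values_def by eventually_elim (rule someI_ex)
  then show ?thesis by blast
qed

section \<open>The supermartingale bound\<close>

text \<open>A down-closed set of reals is empty, everything, or a closed or open ray. Closed rays
  are the hypothesis on the cdfs, open ones follow by left limits.\<close>

lemma emeasure_down_closed_le:
  assumes N: "real_distribution N1" "real_distribution N2"
    and le: "\<And>x. cdf N1 x \<le> cdf N2 x"
    and down: "\<And>x y. x \<le> y \<Longrightarrow> y \<in> A \<Longrightarrow> x \<in> A"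
  shows "emeasure N1 A \<le> emeasure N2 A"
proof -
  interpret N1: real_distribution N1 by (rule N(1))
  interpret N2: real_distribution N2 by (rule N(2))
  consider "A = {}" | "A = UNIV" | c where "A = {..c}" | c where "A = {..<c}"
  proof (cases "A = {}")
    case False
    show thesis
    proof (cases "bdd_above A")
      case bdd: True
      have low: "x \<in> A" if "x < Sup A" for x
        using less_cSupD[OF False that] down[of x] by (auto intro: less_imp_le)
      have up: "x \<le> Sup A" if "x \<in> A" for x using cSup_upper[OF that bdd] .
      show thesis
      proof (cases "Sup A \<in> A")
        case True
        then have "A = {..Sup A}" using up down by auto
        then show thesis by (rule that)
      next
        case False
        then have "A = {..<Sup A}" using up low by (auto simp: less_le)
        then show thesis by (rule that)
      qed
    next
      case unb: False
      have "x \<in> A" for x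
      proof -
        obtain y where "y \<in> A" "\<not> y \<le> x" using unb by (auto simp: bdd_above_def)
        then show ?thesis using down[of x y] by simp
      qed
      then show thesis using that by blast
    qed
  qed (use that in blast)
  then show ?thesis
  proof cases
    case 2
    then show ?thesis using N1.emeasure_space_1 N2.emeasure_space_1 by simp
  next
    case (3 c)
    then show ?thesis using le[of c] by (simp add: cdf_def N1.emeasure_eq_measure N2.emeasure_eq_measure)
  next
    case (4 c)
    have "measure N1 {..<c} \<le> measure N2 {..<c}"
      by (rule tendsto_le[OF trivial_limit_at_left_real N2.cdf_at_left N1.cdf_at_left]) (simp add: le)
    then show ?thesis using 4 by (simp add: N1.emeasure_eq_measure N2.emeasure_eq_measure)
  qed simp
qed

text \<open>The layer-cake identity for a single value, with infinity included because the
  integrands ahead can be infinite.\<close>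

lemma ennreal_eq_nn_integral_less:
  "(\<integral>\<^sup>+x. indicator {x. 0 \<le> x \<and> ennreal x < a} x \<partial>lborel) = a"
proof (cases a)
  case (real r)
  then have "{x. 0 \<le> x \<and> ennreal x < a} = {0..<r}" by (auto simp: ennreal_less_iff)
  then show ?thesis using real by simp
next
  case top
  then have eq: "{x. 0 \<le> x \<and> ennreal x < a} = {0..}" by auto
  have "of_nat n \<le> emeasure lborel {0::real..}" for n
  proof -
    have "of_nat n = emeasure lborel {0..<real n}" by (simp add: ennreal_of_nat_eq_real_of_nat)
    also have "\<dots> \<le> emeasure lborel {0::real..}" by (intro emeasure_mono) auto
    finally show ?thesis .
  qed
  then have "(SUP n. of_nat n :: ennreal) \<le> emeasure lborel {0::real..}" by (intro SUP_least)
  then have "emeasure lborel {0::real..} = \<top>" by (simp add: ennreal_SUP_of_nat_eq_top top_unique)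
  then show ?thesis using top eq by simp
qed

text \<open>Layer cake: the strict superlevel sets of a decreasing function are down-closed, so the
  two integrals compare level by level.\<close>

lemma nn_integral_antimono_le:
  assumes N: "real_distribution N1" "real_distribution N2"
    and le: "\<And>x. cdf N1 x \<le> cdf N2 x"
    and h[measurable]: "h \<in> borel_measurable borel" and anti: "\<And>x y. x \<le> y \<Longrightarrow> h y \<le> h x"
  shows "(\<integral>\<^sup>+r. h r \<partial>N1) \<le> (\<integral>\<^sup>+r. h r \<partial>N2 :: ennreal)"
proof -
  let ?L = "\<lambda>r. {x. 0 \<le> x \<and> ennreal x < h r}"
  have layer: "(\<integral>\<^sup>+r. h r \<partial>N) = (\<integral>\<^sup>+x. indicator {0..} x * emeasure N {r. ennreal x < h r} \<partial>lborel)"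
    if "real_distribution N" for N
  proof -
    interpret N: real_distribution N by (rule that)
    interpret pair_sigma_finite N lborel by unfold_locales
    have "(\<integral>\<^sup>+r. h r \<partial>N) = (\<integral>\<^sup>+r. (\<integral>\<^sup>+x. indicator (?L r) x \<partial>lborel) \<partial>N)"
      by (simp add: ennreal_eq_nn_integral_less)
    also have "\<dots> = (\<integral>\<^sup>+x. (\<integral>\<^sup>+r. indicator (?L r) x \<partial>N) \<partial>lborel)"
    proof (rule Fubini'[symmetric])
      have "(\<lambda>(r, x). indicator {z. 0 \<le> snd z \<and> ennreal (snd z) < h (fst z)} (r, x) :: ennreal) \<in> borel_measurable (N \<Otimes>\<^sub>M lborel)"
        by measurable
      then show "(\<lambda>(r, x). indicator (?L r) x :: ennreal) \<in> borel_measurable (N \<Otimes>\<^sub>M lborel)"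
        by (simp add: indicator_def split_beta)
    qed
    also have "\<dots> = (\<integral>\<^sup>+x. indicator {0..} x * emeasure N {r. ennreal x < h r} \<partial>lborel)"
    proof (rule nn_integral_cong)
      fix x :: real
      have m: "{r. ennreal x < h r} \<in> sets N" by measurable
      have "(\<integral>\<^sup>+r. indicator (?L r) x \<partial>N) = (\<integral>\<^sup>+r. indicator {0..} x * indicator {r. ennreal x < h r} r \<partial>N)"
        by (intro nn_integral_cong) (auto simp: indicator_def)
      also have "\<dots> = indicator {0..} x * emeasure N {r. ennreal x < h r}"
        using m by (subst nn_integral_cmult) auto
      finally show "(\<integral>\<^sup>+r. indicator (?L r) x \<partial>N) = indicator {0..} x * emeasure N {r. ennreal x < h r}" .
    qed
    finally show ?thesis .
  qed
  have "emeasure N1 {r. ennreal x < h r} \<le> emeasure N2 {r. ennreal x < h r}" for x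
    by (rule emeasure_down_closed_le[OF N le]) (use anti less_le_trans in blast)
  then show ?thesis
    unfolding layer[OF N(1)] layer[OF N(2)] by (intro nn_integral_mono mult_left_mono) auto
qed

context watermark_params
begin

text \<open>The value infinity at and below 0 makes the function antitone on the whole line, as the
  dominance lemma requires; the laws concerned do not charge that set.\<close>

definition inv_dens :: "real \<Rightarrow> ennreal" where
  "inv_dens r = (if r \<le> 0 then \<top> else ennreal (1 / pstar_dens r))"

lemma measurable_inv_dens [measurable]: "inv_dens \<in> borel_measurable borel"
  unfolding inv_dens_def by measurable

lemma inv_dens_antimono: "x \<le> y \<Longrightarrow> inv_dens y \<le> inv_dens x"
  using pstar_dens_mono[of x y] pstar_dens_pos[of x]
  by (auto simp: inv_dens_def intro!: ennreal_leI divide_left_mono)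

lemma nn_integral_inv_dens_pstar_mix: "(\<integral>\<^sup>+r. inv_dens r \<partial>pstar_mix) = 1"
proof -
  have "(\<integral>\<^sup>+r. inv_dens r \<partial>pstar_mix) = (\<integral>\<^sup>+r. ennreal (pstar_dens r) * inv_dens r \<partial>mu0)"
    unfolding pstar_mix_def by (rule nn_integral_density) measurable
  also have "\<dots> = (\<integral>\<^sup>+r. 1 \<partial>mu0)"
  proof (rule nn_integral_cong_AE, use AE_mu0 in eventually_elim)
    case (elim r)
    then show ?case using pstar_dens_pos[of r]
      by (simp add: inv_dens_def ennreal_mult[symmetric] del: ennreal_mult)
  qed
  finally show ?thesis using mu0.emeasure_space_1 by simp
qed

text \<open>The bound holds for each admissible \<open>P\<close> separately, so it survives any
  dependence of \<open>P\<close> on the past.\<close>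

lemma one_step_bound:
  fixes P :: "'w::finite \<Rightarrow> real"
  assumes P: "P \<in> P_Delta \<Delta>"
  shows "(\<integral>\<^sup>+\<xi>. (\<Sum>w\<in>UNIV. ennreal (tok_weight \<epsilon> P \<xi> w) * inv_dens (\<xi> w)) \<partial>xi_law) \<le> 1"
proof -
  have pv: "prob_vec P" using P by (simp add: P_Delta_def)
  then have P': "\<And>w. 0 \<le> P w" "sum P UNIV = 1" by (auto simp: prob_vec_def)
  have e: "0 \<le> \<epsilon>" using eps by simp
  let ?N1 = "dens_law \<epsilon> P UNIV" and ?N2 = "pstar_mix"
  have "(\<integral>\<^sup>+\<xi>. (\<Sum>w\<in>UNIV. ennreal (tok_weight \<epsilon> P \<xi> w) * inv_dens (\<xi> w)) \<partial>xi_law)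
      = (\<integral>\<^sup>+r. inv_dens r \<partial>?N1)"
    by (rule nn_integral_xi_law_tok_weight[OF pv e eps(2)]) simp
  also have "\<dots> \<le> (\<integral>\<^sup>+r. inv_dens r \<partial>?N2)"
  proof (rule nn_integral_antimono_le)
    show "real_distribution ?N1"
      using P' eps by (intro real_distribution_density_dens) auto
    show "real_distribution ?N2"
      unfolding pstar_mix_def pstar_dens_def
      using eps Delta Pstar_bounds sum_Pstar by (intro real_distribution_density_dens) auto
    show "cdf ?N1 x \<le> cdf ?N2 x" for x
    proof -
      have "cdf ?N1 = Fmix \<epsilon> P UNIV" using P' eps by (intro cdf_density_dens) auto
      moreover have "cdf ?N2 = Fmix \<epsilon> (Pstar \<Delta>) {..Pstar_len \<Delta>}"
        unfolding pstar_mix_def pstar_dens_def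
        using eps Delta Pstar_bounds sum_Pstar by (intro cdf_density_dens) auto
      ultimately show ?thesis using Fmix_le_Fmix_Pstar[OF P] by simp
    qed
  qed (auto intro: inv_dens_antimono)
  finally show ?thesis by (simp add: nn_integral_inv_dens_pstar_mix)
qed

end

section \<open>Trajectories and the conditional structure of the model\<close>

lemma measurable_step_NTP: "fst \<in> step_space \<rightarrow>\<^sub>M vec_space"
  unfolding step_space_def by measurable

lemma measurable_step_Xi: "(\<lambda>x. fst (snd x)) \<in> step_space \<rightarrow>\<^sub>M vec_space"
  unfolding step_space_def by measurable

lemma measurable_step_Tok: "(\<lambda>x. snd (snd x)) \<in> step_space \<rightarrow>\<^sub>M count_space UNIV"
  unfolding step_space_def by measurable

lemma measurable_step_Y: "(\<lambda>x. fst (snd x) (snd (snd x))) \<in> borel_measurable step_space"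
proof -
  have "(\<lambda>x. (\<lambda>w x. fst (snd x) w) (snd (snd x)) x) \<in> borel_measurable step_space"
    by (rule measurable_compose_countable[OF measurable_vec_apply[OF measurable_step_Xi] measurable_step_Tok])
  then show ?thesis by simp
qed

lemma measurable_traj_component: "k \<in> I \<Longrightarrow> (\<lambda>u. u k) \<in> PiM I (\<lambda>_. step_space) \<rightarrow>\<^sub>M step_space"
  by (rule measurable_component_singleton)

lemma measurable_NTP: "k \<in> I \<Longrightarrow> NTP k \<in> PiM I (\<lambda>_. step_space) \<rightarrow>\<^sub>M vec_space"
  unfolding NTP_def by (rule measurable_compose[OF measurable_traj_component measurable_step_NTP])

lemma measurable_Xi: "k \<in> I \<Longrightarrow> Xi k \<in> PiM I (\<lambda>_. step_space) \<rightarrow>\<^sub>M vec_space"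
  unfolding Xi_def by (rule measurable_compose[OF measurable_traj_component measurable_step_Xi])

lemma measurable_Tok: "k \<in> I \<Longrightarrow> Tok k \<in> PiM I (\<lambda>_. step_space) \<rightarrow>\<^sub>M count_space UNIV"
  unfolding Tok_def by (rule measurable_compose[OF measurable_traj_component measurable_step_Tok])

lemma measurable_Yv: "k \<in> I \<Longrightarrow> Yv k \<in> borel_measurable (PiM I (\<lambda>_. step_space))"
  unfolding Yv_def Xi_def Tok_def
  by (rule measurable_compose[OF measurable_traj_component measurable_step_Y])

abbreviation Ys :: "nat \<Rightarrow> 'w traj \<Rightarrow> nat \<Rightarrow> real" where
  "Ys n u \<equiv> restrict (\<lambda>k. Yv k u) {..<n}"

abbreviation past_space :: "nat \<Rightarrow> 'w::finite traj measure" where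
  "past_space k \<equiv> PiM {..<k} (\<lambda>_. step_space)"

lemma measurable_restrict_traj:
  "(\<lambda>u. restrict u {..<k}) \<in> PiM UNIV (\<lambda>_. step_space) \<rightarrow>\<^sub>M past_space k"
  by (rule measurable_restrict_subset) simp

locale watermark_model = watermark_params +
  fixes M :: "'w::finite traj measure"
  assumes gw: "gw_model \<epsilon> \<Delta> M"
begin

lemma gw_prob_space: "prob_space M"
  using gw by (simp add: gw_model_def)

lemma gw_sets: "sets M = sets (PiM UNIV (\<lambda>_. step_space))"
  using gw by (simp add: gw_model_def traj_space_def)

lemma gw_space: "space M = space traj_space"
  using sets_eq_imp_space_eq[OF gw_sets] by (simp add: traj_space_def)

lemma gw_measurable: "measurable M N = measurable (PiM UNIV (\<lambda>_. step_space)) N"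
  by (rule measurable_cong_sets[OF gw_sets refl])

lemma
  shows Xi: "Xi k \<in> M \<rightarrow>\<^sub>M vec_space" and NTP: "NTP k \<in> M \<rightarrow>\<^sub>M vec_space"
    and Tok: "Tok k \<in> M \<rightarrow>\<^sub>M count_space UNIV"
  unfolding gw_measurable by (rule measurable_Xi measurable_NTP measurable_Tok, simp)+

lemma gw_AE_prob_vec: "AE u in M. NTP k u \<in> P_Delta \<Delta>"
  using gw by (simp add: gw_model_def)

lemma gw_distr_Xi: "distr M vec_space (Xi k) = xi_law"
  using gw by (simp add: gw_model_def xi_law_def mu0_def)

lemma gw_hist_measurable:
  "(\<lambda>u. (restrict u {..<k}, NTP k u)) \<in> M \<rightarrow>\<^sub>M past_space k \<Otimes>\<^sub>M vec_space"
  unfolding gw_measurable by (intro measurable_Pair measurable_restrict_traj measurable_NTP) simp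

lemma gw_histXi_measurable:
  "(\<lambda>u. (restrict u {..<k}, NTP k u, Xi k u)) \<in> M \<rightarrow>\<^sub>M past_space k \<Otimes>\<^sub>M vec_space \<Otimes>\<^sub>M vec_space"
  unfolding gw_measurable by (intro measurable_Pair measurable_restrict_traj measurable_NTP measurable_Xi) simp_all

text \<open>Clause (a) is a product formula for events. As rectangles generate, the past with its
  current next-token vector and the fresh \<open>\<xi>\<close> have a product law, which makes
  Fubini available.\<close>

lemma gw_joint:
  "distr M ((past_space k \<Otimes>\<^sub>M vec_space) \<Otimes>\<^sub>M vec_space)
      (\<lambda>u. ((restrict u {..<k}, NTP k u), Xi k u))
    = distr M (past_space k \<Otimes>\<^sub>M vec_space) (\<lambda>u. (restrict u {..<k}, NTP k u)) \<Otimes>\<^sub>M xi_law"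
proof (rule pair_measure_eqI[symmetric])
  interpret M: prob_space M by (rule gw_prob_space)
  let ?T = "past_space k \<Otimes>\<^sub>M vec_space" and ?\<psi> = "\<lambda>u. (restrict u {..<k}, NTP k u)"
  let ?D = "distr M ?T ?\<psi>"
  interpret D: prob_space ?D by (rule M.prob_space_distr[OF gw_hist_measurable])
  show "sigma_finite_measure ?D" "sigma_finite_measure (xi_law :: ('w \<Rightarrow> real) measure)" by unfold_locales
  show "sets (?D \<Otimes>\<^sub>M xi_law) = sets (distr M (?T \<Otimes>\<^sub>M vec_space) (\<lambda>u. (?\<psi> u, Xi k u)))"
    by (simp cong: sets_pair_measure_cong)
  fix A B assume A: "A \<in> sets ?D" and B: "B \<in> sets (xi_law :: ('w \<Rightarrow> real) measure)"
  then have AB: "A \<in> sets ?T" "B \<in> sets vec_space" by simp_all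
  let ?A = "?\<psi> -` A \<inter> space M" and ?B = "Xi k -` B \<inter> space M"
  have "emeasure ?D A = emeasure M ?A"
    by (rule emeasure_distr[OF gw_hist_measurable AB(1)])
  moreover have "emeasure xi_law B = emeasure M ?B"
    unfolding gw_distr_Xi[of k, symmetric] by (rule emeasure_distr[OF Xi AB(2)])
  moreover have "measure M (?A \<inter> ?B) = measure M ?A * measure M ?B"
  proof -
    have "?A \<in> sets (Hist k)"
      unfolding Hist_def gw_space using AB(1) by (rule in_vimage_algebra)
    then show ?thesis using gw AB(2) by (simp add: gw_model_def)
  qed
  moreover have "emeasure (distr M (?T \<Otimes>\<^sub>M vec_space) (\<lambda>u. (?\<psi> u, Xi k u))) (A \<times> B) = emeasure M (?A \<inter> ?B)"
  proof -
    have "emeasure (distr M (?T \<Otimes>\<^sub>M vec_space) (\<lambda>u. (?\<psi> u, Xi k u))) (A \<times> B)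
        = emeasure M ((\<lambda>u. (?\<psi> u, Xi k u)) -` (A \<times> B) \<inter> space M)"
      using AB by (intro emeasure_distr measurable_Pair gw_hist_measurable Xi) auto
    also have "(\<lambda>u. (?\<psi> u, Xi k u)) -` (A \<times> B) \<inter> space M = ?A \<inter> ?B" by auto
    finally show ?thesis .
  qed
  ultimately show "emeasure ?D A * emeasure xi_law B
      = emeasure (distr M (?T \<Otimes>\<^sub>M vec_space) (\<lambda>u. (?\<psi> u, Xi k u))) (A \<times> B)"
    by (simp add: M.emeasure_eq_measure ennreal_mult)
qed

text \<open>Clause (b) says that the measures with densities the token indicator and the token
  weight have the same image under the history map. Integrating \<open>F\<close> against this image
  gives the claim without conditional expectations.\<close>

lemma gw_token_weight:
  fixes F :: "'w traj \<times> ('w \<Rightarrow> real) \<times> ('w \<Rightarrow> real) \<Rightarrow> ennreal"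
  assumes F: "F \<in> borel_measurable (past_space k \<Otimes>\<^sub>M vec_space \<Otimes>\<^sub>M vec_space)"
  shows "(\<integral>\<^sup>+u. indicator {u. Tok k u = w} u * F (restrict u {..<k}, NTP k u, Xi k u) \<partial>M)
    = (\<integral>\<^sup>+u. ennreal (tok_weight \<epsilon> (NTP k u) (Xi k u) w) * F (restrict u {..<k}, NTP k u, Xi k u) \<partial>M)"
proof -
  interpret M: prob_space M by (rule gw_prob_space)
  let ?T = "past_space k \<Otimes>\<^sub>M vec_space \<Otimes>\<^sub>M vec_space"
  let ?\<phi> = "\<lambda>u. (restrict u {..<k}, NTP k u, Xi k u)"
  let ?W = "\<lambda>u. tok_weight \<epsilon> (NTP k u) (Xi k u) w"
  let ?I = "indicator {u. Tok k u = w} :: _ \<Rightarrow> ennreal"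
  have W: "?W \<in> borel_measurable M" by (rule measurable_tok_weight[OF NTP Xi])
  have TokS: "{u\<in>space M. Tok k u = w} \<in> sets M"
    using measurable_sets[OF Tok, of "{w}"] by (simp add: vimage_def Int_def conj_commute)
  have I: "?I \<in> borel_measurable M"
    using TokS by (simp add: borel_measurable_indicator_iff Int_def conj_commute)
  have EW: "(\<lambda>u. ennreal (?W u)) \<in> borel_measurable M" using W by simp
  have bound: "AE u in M. 0 \<le> ?W u \<and> ?W u \<le> 1"
    using gw_AE_prob_vec[of k]
  proof eventually_elim
    case (elim u)
    then show ?case using eps by (simp add: P_Delta_def tok_weight_nonneg tok_weight_le_1)
  qed
  have "distr (density M ?I) ?T ?\<phi> = distr (density M (\<lambda>u. ennreal (?W u))) ?T ?\<phi>"
  proof (rule measure_eqI)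
    fix C assume "C \<in> sets (distr (density M ?I) ?T ?\<phi>)"
    then have C: "C \<in> sets ?T" by simp
    let ?C = "?\<phi> -` C \<inter> space M"
    have C': "?C \<in> sets M" using gw_histXi_measurable C by (rule measurable_sets)
    have "?C \<in> sets (HistXi k)"
      unfolding HistXi_def gw_space using C by (rule in_vimage_algebra)
    then have eq: "measure M (?C \<inter> {u\<in>space M. Tok k u = w}) = (\<integral>u\<in>?C. ?W u \<partial>M)"
      using gw unfolding gw_model_def tok_weight_def by blast
    have "emeasure (distr (density M ?I) ?T ?\<phi>) C = emeasure (density M ?I) ?C"
      using C gw_histXi_measurable[of k] by (subst emeasure_distr) (simp_all cong: measurable_cong_sets)
    also have "\<dots> = (\<integral>\<^sup>+u. ?I u * indicator ?C u \<partial>M)"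
      using C' I by (rule emeasure_density[rotated])
    also have "\<dots> = (\<integral>\<^sup>+u. indicator (?C \<inter> {u\<in>space M. Tok k u = w}) u \<partial>M)"
      by (intro nn_integral_cong) (auto simp: indicator_def)
    also have "\<dots> = ennreal (measure M (?C \<inter> {u\<in>space M. Tok k u = w}))"
      using C' TokS by (simp add: M.emeasure_eq_measure)
    also have "\<dots> = (\<integral>\<^sup>+u. ennreal (?W u) * indicator ?C u \<partial>M)"
      by (simp only: eq M.nn_integral_unit_weight(1)[OF C' W bound])
    also have "\<dots> = emeasure (density M (\<lambda>u. ennreal (?W u))) ?C"
      using C' EW by (rule emeasure_density[symmetric, rotated])
    also have "\<dots> = emeasure (distr (density M (\<lambda>u. ennreal (?W u))) ?T ?\<phi>) C"
      using C gw_histXi_measurable[of k] by (subst emeasure_distr) (simp_all cong: measurable_cong_sets)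
    finally show "emeasure (distr (density M ?I) ?T ?\<phi>) C
        = emeasure (distr (density M (\<lambda>u. ennreal (?W u))) ?T ?\<phi>) C" .
  qed simp
  then have "(\<integral>\<^sup>+z. F z \<partial>distr (density M ?I) ?T ?\<phi>) = (\<integral>\<^sup>+z. F z \<partial>distr (density M (\<lambda>u. ennreal (?W u))) ?T ?\<phi>)"
    by simp
  moreover have "(\<integral>\<^sup>+z. F z \<partial>distr (density M g) ?T ?\<phi>) = (\<integral>\<^sup>+u. g u * F (?\<phi> u) \<partial>M)"
    if g: "g \<in> borel_measurable M" for g
  proof -
    have "(\<integral>\<^sup>+z. F z \<partial>distr (density M g) ?T ?\<phi>) = (\<integral>\<^sup>+u. F (?\<phi> u) \<partial>density M g)"
      using gw_histXi_measurable[of k] F by (intro nn_integral_distr) (simp_all cong: measurable_cong_sets)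
    also have "\<dots> = (\<integral>\<^sup>+u. g u * F (?\<phi> u) \<partial>M)"
      by (rule nn_integral_density[OF g measurable_compose[OF gw_histXi_measurable F]])
    finally show ?thesis .
  qed
  ultimately show ?thesis using I EW by simp
qed

text \<open>Induction peeling off the last factor: split over the token, replace its indicator by
  its weight, and integrate out the fresh \<open>\<xi>\<close> with the past held fixed, where the
  one-step bound applies.\<close>

lemma gw_prod_inv_dens_le_1: "(\<integral>\<^sup>+u. (\<Prod>k<n. inv_dens (Yv k u)) \<partial>M) \<le> 1"
proof (induction n)
  case 0
  interpret M: prob_space M by (rule gw_prob_space)
  show ?case using M.emeasure_space_1 by simp
next
  case (Suc n)
  interpret M: prob_space M by (rule gw_prob_space)
  let ?h = "inv_dens"
  let ?H = "past_space n :: 'w traj measure"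
  let ?V = "vec_space :: ('w \<Rightarrow> real) measure"
  let ?T = "?H \<Otimes>\<^sub>M ?V"
  let ?W = "tok_weight \<epsilon> :: ('w \<Rightarrow> real) \<Rightarrow> ('w \<Rightarrow> real) \<Rightarrow> 'w \<Rightarrow> real"
  define Z where "Z \<eta> = (\<Prod>k<n. ?h (Yv k \<eta>))" for \<eta> :: "'w traj"
  have Z: "Z \<in> borel_measurable ?H"
    unfolding Z_def by (intro borel_measurable_prod_ennreal measurable_compose[OF measurable_Yv measurable_inv_dens])
  \<comment> \<open>The earlier factors depend on the past alone, so they can be pulled out of the
    inner integral.\<close>
  have Z_restrict: "Z (restrict u {..<n}) = Z u" for u
    unfolding Z_def by (intro prod.cong) (auto simp: Yv_def Xi_def Tok_def)
  have ZM: "(\<lambda>u. Z (restrict u {..<n})) \<in> borel_measurable M"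
    unfolding gw_measurable by (rule measurable_compose[OF measurable_restrict_traj Z])
  have hX: "(\<lambda>u. ?h (Xi n u w)) \<in> borel_measurable M" for w
    by (rule measurable_compose[OF measurable_vec_apply[OF Xi] measurable_inv_dens])
  have IM: "indicator {u. Tok n u = w} \<in> borel_measurable M" for w
    using measurable_sets[OF Tok, of "{w}"]
    by (simp add: borel_measurable_indicator_iff vimage_def Int_def conj_commute)
  have WM: "(\<lambda>u. ennreal (?W (NTP n u) (Xi n u) w)) \<in> borel_measurable M" for w
    using measurable_tok_weight[OF NTP Xi] by simp
  let ?D = "distr M ?T (\<lambda>u. (restrict u {..<n}, NTP n u))"
  let ?G = "\<lambda>z. Z (fst (fst z)) * (\<Sum>w\<in>UNIV. ennreal (?W (snd (fst z)) (snd z) w) * ?h (snd z w))"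
  have W': "(\<lambda>z. ennreal (?W (snd (fst z)) (snd z) w)) \<in> borel_measurable (?T \<Otimes>\<^sub>M ?V)" for w
    by (rule measurable_compose[OF measurable_tok_weight measurable_ennreal])
      (intro measurable_compose[OF measurable_fst measurable_snd] measurable_snd)+
  have G: "?G \<in> borel_measurable (?T \<Otimes>\<^sub>M ?V)"
    by (intro borel_measurable_times_ennreal borel_measurable_sum measurable_compose[OF _ Z]
      measurable_compose[OF measurable_vec_apply measurable_inv_dens] W'
      measurable_compose[OF measurable_fst measurable_fst] measurable_snd)
  have "(\<integral>\<^sup>+u. (\<Prod>k<Suc n. ?h (Yv k u)) \<partial>M)
      = (\<integral>\<^sup>+u. (\<Sum>w\<in>UNIV. indicator {u. Tok n u = w} u * (Z (restrict u {..<n}) * ?h (Xi n u w))) \<partial>M)"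
  proof (intro nn_integral_cong)
    fix u
    have "(\<Sum>w\<in>UNIV. indicator {u. Tok n u = w} u * (Z (restrict u {..<n}) * ?h (Xi n u w)))
        = (\<Sum>w\<in>UNIV. if w = Tok n u then Z u * ?h (Xi n u w) else 0)"
      by (intro sum.cong) (auto simp: Z_restrict)
    also have "\<dots> = Z u * ?h (Yv n u)" by (simp add: Yv_def)
    finally show "(\<Prod>k<Suc n. ?h (Yv k u))
        = (\<Sum>w\<in>UNIV. indicator {u. Tok n u = w} u * (Z (restrict u {..<n}) * ?h (Xi n u w)))"
      by (simp add: Z_def)
  qed
  also have "\<dots> = (\<Sum>w\<in>UNIV. \<integral>\<^sup>+u. indicator {u. Tok n u = w} u * (Z (restrict u {..<n}) * ?h (Xi n u w)) \<partial>M)"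
    by (intro nn_integral_sum borel_measurable_times_ennreal IM ZM hX)
  also have "\<dots> = (\<Sum>w\<in>UNIV. \<integral>\<^sup>+u. ennreal (?W (NTP n u) (Xi n u) w) * (Z (restrict u {..<n}) * ?h (Xi n u w)) \<partial>M)"
  proof (intro sum.cong refl)
    fix w
    have "(\<lambda>z. Z (fst z) * ?h (snd (snd z) w)) \<in> borel_measurable (?H \<Otimes>\<^sub>M ?V \<Otimes>\<^sub>M ?V)"
      by (intro borel_measurable_times_ennreal measurable_compose[OF _ Z]
        measurable_compose[OF measurable_vec_apply measurable_inv_dens] measurable_fst
        measurable_compose[OF measurable_snd measurable_snd])
    from gw_token_weight[OF this, of w]
    show "(\<integral>\<^sup>+u. indicator {u. Tok n u = w} u * (Z (restrict u {..<n}) * ?h (Xi n u w)) \<partial>M)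
      = (\<integral>\<^sup>+u. ennreal (?W (NTP n u) (Xi n u) w) * (Z (restrict u {..<n}) * ?h (Xi n u w)) \<partial>M)"
      by simp
  qed
  also have "\<dots> = (\<integral>\<^sup>+u. (\<Sum>w\<in>UNIV. ennreal (?W (NTP n u) (Xi n u) w) * (Z (restrict u {..<n}) * ?h (Xi n u w))) \<partial>M)"
    by (intro nn_integral_sum[symmetric] borel_measurable_times_ennreal WM ZM hX)
  also have "\<dots> = (\<integral>\<^sup>+u. ?G ((restrict u {..<n}, NTP n u), Xi n u) \<partial>M)"
    by (simp add: sum_distrib_left mult.left_commute)
  also have "\<dots> = (\<integral>\<^sup>+z. ?G z \<partial>distr M (?T \<Otimes>\<^sub>M ?V) (\<lambda>u. ((restrict u {..<n}, NTP n u), Xi n u)))"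
    by (rule nn_integral_distr[symmetric, OF measurable_Pair[OF gw_hist_measurable Xi]])
      (simp only: measurable_distr_eq1 G)
  also have "\<dots> = (\<integral>\<^sup>+z. ?G z \<partial>(?D \<Otimes>\<^sub>M xi_law))"
    by (simp only: gw_joint)
  also have "\<dots> \<le> (\<integral>\<^sup>+u. Z (restrict u {..<n}) \<partial>M)"
  proof -
    have "sets (?D \<Otimes>\<^sub>M xi_law) = sets (?T \<Otimes>\<^sub>M ?V)" by (intro sets_pair_measure_cong) simp_all
    then have G': "?G \<in> borel_measurable (?D \<Otimes>\<^sub>M xi_law)" using G by (simp cong: measurable_cong_sets)
    have G'': "(\<lambda>x. \<integral>\<^sup>+\<xi>. ?G (x, \<xi>) \<partial>xi_law) \<in> borel_measurable ?T"
    proof -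
      have "sets (?T \<Otimes>\<^sub>M xi_law) = sets (?T \<Otimes>\<^sub>M ?V)" by (intro sets_pair_measure_cong) simp_all
      then have "?G \<in> borel_measurable (?T \<Otimes>\<^sub>M xi_law)" using G by (simp cong: measurable_cong_sets)
      then show ?thesis by (rule Q.borel_measurable_nn_integral_fst)
    qed
    have "(\<integral>\<^sup>+z. ?G z \<partial>(?D \<Otimes>\<^sub>M xi_law)) = (\<integral>\<^sup>+x. (\<integral>\<^sup>+\<xi>. ?G (x, \<xi>) \<partial>xi_law) \<partial>?D)"
      by (rule Q.nn_integral_fst[OF G', symmetric])
    also have "\<dots> = (\<integral>\<^sup>+u. (\<integral>\<^sup>+\<xi>. ?G ((restrict u {..<n}, NTP n u), \<xi>) \<partial>xi_law) \<partial>M)"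
      by (rule nn_integral_distr[OF gw_hist_measurable]) (use G'' in simp)
    also have "\<dots> \<le> (\<integral>\<^sup>+u. Z (restrict u {..<n}) \<partial>M)"
    proof (rule nn_integral_mono_AE, use gw_AE_prob_vec[of n] in eventually_elim)
      case (elim u)
      have "(\<lambda>\<xi>. \<Sum>w\<in>UNIV. ennreal (?W (NTP n u) \<xi> w) * ?h (\<xi> w)) \<in> borel_measurable vec_space"
        by (intro borel_measurable_sum borel_measurable_times_ennreal
          measurable_compose[OF measurable_vec_component measurable_inv_dens]
          measurable_compose[OF measurable_tok_weight measurable_ennreal] measurable_const measurable_ident_sets[OF refl]) simp
      then have "(\<integral>\<^sup>+\<xi>. ?G ((restrict u {..<n}, NTP n u), \<xi>) \<partial>xi_law)
          = Z (restrict u {..<n}) * (\<integral>\<^sup>+\<xi>. (\<Sum>w\<in>UNIV. ennreal (?W (NTP n u) \<xi> w) * ?h (\<xi> w)) \<partial>xi_law)"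
        by (simp add: nn_integral_cmult cong: measurable_cong_sets)
      also have "\<dots> \<le> Z (restrict u {..<n}) * 1"
        by (intro mult_left_mono one_step_bound[OF elim]) simp
      finally show ?case by simp
    qed
    finally show ?thesis .
  qed
  also have "\<dots> \<le> 1" using Suc.IH by (simp add: Z_restrict) (simp add: Z_def)
  finally show ?case .
qed

text \<open>Almost surely all coordinates of \<open>\<xi>\<close> lie in (0, 1), hence so does the
  selected one, however the token depends on \<open>\<xi>\<close>.\<close>

lemma gw_AE_Y: "AE u in M. \<forall>k. 0 < Yv k u \<and> Yv k u < 1"
proof (subst AE_all_countable, intro allI)
  fix k
  have "AE \<xi> in distr M vec_space (Xi k). \<forall>w\<in>UNIV. 0 < \<xi> w \<and> \<xi> w < 1"
    unfolding gw_distr_Xi by (rule AE_xi_law)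
  from AE_distrD[OF Xi this] show "AE u in M. 0 < Yv k u \<and> Yv k u < 1"
    by eventually_elim (simp add: Yv_def)
qed

lemma gw_measurable_Y:
  "Ys n \<in> M \<rightarrow>\<^sub>M obs_space n"
  unfolding gw_measurable by (intro measurable_restrict measurable_Yv) simp

lemma gw_measurable_event:
  assumes S: "measurable_statistic S"
  shows "{u\<in>space M. S n (Ys n u) \<le> c} \<in> sets M"
proof -
  have "S n \<in> borel_measurable (obs_space n)" using S by (simp add: measurable_statistic_def)
  from measurable_compose[OF gw_measurable_Y this]
  have "(\<lambda>u. S n (Ys n u)) \<in> borel_measurable M" .
  then show ?thesis by measurable
qed

end

section \<open>The i.i.d. model\<close>

text \<open>\<open>Pstar\<close> is carried over along an enumeration of the vocabulary, which is
  where the size of the vocabulary enters. Surplus tokens get probability 0 and drop out of sums of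
  \<open>g\<close> with \<open>g 0 = 0\<close>.\<close>

lemma (in watermark_params) ex_Pstar_vec:
  assumes card: "Pstar_len \<Delta> + 1 \<le> CARD('w::finite)"
  shows "\<exists>P :: 'w \<Rightarrow> real. P \<in> P_Delta \<Delta> \<and> dens \<epsilon> P UNIV = pstar_dens"
proof -
  obtain h where h: "bij_betw h (UNIV :: 'w set) {0..<CARD('w)}"
    using ex_bij_betw_finite_nat[of "UNIV :: 'w set"] by auto
  define P where "P w = Pstar \<Delta> (h w)" for w
  have sub: "{..Pstar_len \<Delta>} \<subseteq> {0..<CARD('w)}" using card by auto
  have reindex: "(\<Sum>w\<in>UNIV. g (P w)) = (\<Sum>i\<le>Pstar_len \<Delta>. g (Pstar \<Delta> i))" if "g 0 = 0" for g :: "real \<Rightarrow> real"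
  proof -
    have "(\<Sum>w\<in>UNIV. g (P w)) = (\<Sum>i\<in>{0..<CARD('w)}. g (Pstar \<Delta> i))"
      unfolding P_def using h by (rule sum.reindex_bij_betw)
    also have "\<dots> = (\<Sum>i\<le>Pstar_len \<Delta>. g (Pstar \<Delta> i))"
      using sub that by (intro sum.mono_neutral_right) (auto simp: Pstar_def)
    finally show ?thesis .
  qed
  have "P \<in> P_Delta \<Delta>"
    using Pstar_bounds reindex[of "\<lambda>x. x"] sum_Pstar
    by (simp add: P_Delta_def prob_vec_def P_def)
  moreover have "dens \<epsilon> P UNIV = pstar_dens"
  proof
    fix r :: real
    let ?g = "\<lambda>p. if 0 < p then r powr (1 / p - 1) else 0"
    have "(\<Sum>w\<in>{w\<in>UNIV. 0 < P w}. r powr (1 / P w - 1)) = (\<Sum>w\<in>UNIV. ?g (P w))"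
      by (rule sum.inter_filter) simp
    also have "\<dots> = (\<Sum>i\<le>Pstar_len \<Delta>. ?g (Pstar \<Delta> i))" by (rule reindex) simp
    also have "\<dots> = (\<Sum>i\<in>{i\<in>{..Pstar_len \<Delta>}. 0 < Pstar \<Delta> i}. r powr (1 / Pstar \<Delta> i - 1))"
      by (rule sum.inter_filter[symmetric]) simp
    finally show "dens \<epsilon> P UNIV r = pstar_dens r" by (simp add: dens_def pstar_dens_def)
  qed
  ultimately show ?thesis by blast
qed

text \<open>One step with constant next-token vector: given \<open>\<xi>\<close>, the token has
  density \<open>tok_weight\<close> with respect to counting measure. This builds clause (b) into
  the construction.\<close>

definition step_law :: "real \<Rightarrow> ('w::finite \<Rightarrow> real) \<Rightarrow> 'w step measure" where
  "step_law e P = distr (density (xi_law \<Otimes>\<^sub>M count_space UNIV) (\<lambda>z. ennreal (tok_weight e P (fst z) (snd z))))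
     step_space (\<lambda>z. (P, fst z, snd z))"

definition iid_law :: "real \<Rightarrow> ('w::finite \<Rightarrow> real) \<Rightarrow> 'w traj measure" where
  "iid_law e P = PiM UNIV (\<lambda>_. step_law e P)"

lemma sets_step_law [simp]: "sets (step_law e P) = sets step_space"
  by (simp add: step_law_def)

lemma sets_PiM_step_law: "sets (PiM I (\<lambda>_. step_law e P)) = sets (PiM I (\<lambda>_. step_space))"
  by (intro sets_PiM_cong) simp_all

context
  fixes e :: real and P :: "'w::finite \<Rightarrow> real"
  assumes eps: "0 < e" "e \<le> 1" and P: "prob_vec P"
begin

abbreviation "past_law k \<equiv> PiM {..<k::nat} (\<lambda>_. step_law e P)"

lemma tok_weight_pair_measurable:
  "(\<lambda>z. ennreal (tok_weight e P (fst z) (snd z))) \<in> borel_measurable (xi_law \<Otimes>\<^sub>M count_space UNIV)"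
proof -
  have f: "fst \<in> xi_law \<Otimes>\<^sub>M count_space (UNIV :: 'w set) \<rightarrow>\<^sub>M vec_space"
    using measurable_fst[of xi_law "count_space (UNIV :: 'w set)"]
    by (simp add: measurable_cong_sets[OF refl sets_xi_law])
  have "(\<lambda>z. (\<lambda>w z. tok_weight e P (fst z) w) (snd z) z) \<in> borel_measurable (xi_law \<Otimes>\<^sub>M count_space (UNIV :: 'w set))"
    by (rule measurable_compose_countable[OF measurable_tok_weight[OF measurable_const f] measurable_snd]) simp
  then show ?thesis by simp
qed

lemma step_pair_measurable:
  "(\<lambda>z. (P, fst z, snd z)) \<in> xi_law \<Otimes>\<^sub>M count_space UNIV \<rightarrow>\<^sub>M step_space"
proof -
  have f: "fst \<in> xi_law \<Otimes>\<^sub>M count_space (UNIV :: 'w set) \<rightarrow>\<^sub>M vec_space"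
    using measurable_fst[of xi_law "count_space (UNIV :: 'w set)"]
    by (simp add: measurable_cong_sets[OF refl sets_xi_law])
  show ?thesis unfolding step_space_def
    by (intro measurable_Pair measurable_const f measurable_snd) simp
qed

lemma nn_integral_step_law:
  assumes F: "F \<in> borel_measurable step_space"
  shows "(\<integral>\<^sup>+x. F x \<partial>step_law e P)
    = (\<integral>\<^sup>+\<xi>. (\<Sum>w\<in>UNIV. ennreal (tok_weight e P \<xi> w) * F (P, \<xi>, w)) \<partial>xi_law)"
proof -
  interpret C: sigma_finite_measure "count_space (UNIV :: 'w set)"
    by (rule sigma_finite_measure_count_space_finite) simp
  have F': "(\<lambda>z. F (P, fst z, snd z)) \<in> borel_measurable (xi_law \<Otimes>\<^sub>M count_space UNIV)"
    by (rule measurable_compose[OF step_pair_measurable F])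
  have "(\<integral>\<^sup>+x. F x \<partial>step_law e P) = (\<integral>\<^sup>+z. F (P, fst z, snd z)
      \<partial>density (xi_law \<Otimes>\<^sub>M count_space UNIV) (\<lambda>z. ennreal (tok_weight e P (fst z) (snd z))))"
    unfolding step_law_def using step_pair_measurable F
    by (intro nn_integral_distr) (simp_all cong: measurable_cong_sets)
  also have "\<dots> = (\<integral>\<^sup>+z. ennreal (tok_weight e P (fst z) (snd z)) * F (P, fst z, snd z) \<partial>(xi_law \<Otimes>\<^sub>M count_space UNIV))"
    by (rule nn_integral_density[OF tok_weight_pair_measurable F'])
  also have "\<dots> = (\<integral>\<^sup>+\<xi>. (\<integral>\<^sup>+w. ennreal (tok_weight e P \<xi> w) * F (P, \<xi>, w) \<partial>count_space UNIV) \<partial>xi_law)"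
    using C.nn_integral_fst[OF borel_measurable_times_ennreal[OF tok_weight_pair_measurable F']] by simp
  finally show ?thesis by (simp add: nn_integral_count_space_finite)
qed

lemma sum_tok_weight_ennreal: "(\<Sum>w\<in>UNIV. ennreal (tok_weight e P \<xi> w)) = 1"
  using sum_tok_weight[OF P, of e \<xi>] tok_weight_nonneg[OF P, of e \<xi>] eps by (simp add: sum_ennreal)

lemma nn_integral_step_law_Xi:
  assumes F: "F \<in> borel_measurable (vec_space \<Otimes>\<^sub>M vec_space)"
  shows "(\<integral>\<^sup>+x. F (fst x, fst (snd x)) \<partial>step_law e P) = (\<integral>\<^sup>+\<xi>. F (P, \<xi>) \<partial>xi_law)"
proof -
  have "(\<lambda>x. F (fst x, fst (snd x))) \<in> borel_measurable step_space"
    by (rule measurable_compose[OF measurable_Pair[OF measurable_step_NTP measurable_step_Xi] F])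
  from nn_integral_step_law[OF this] show ?thesis
    by (simp add: sum_distrib_right[symmetric] sum_tok_weight_ennreal)
qed

lemma prob_space_step_law: "prob_space (step_law e P)"
proof (rule prob_spaceI)
  have "emeasure (step_law e P) (space (step_law e P)) = (\<integral>\<^sup>+x. 1 \<partial>step_law e P)" by simp
  also have "\<dots> = (\<integral>\<^sup>+\<xi>. 1 \<partial>(xi_law :: ('w \<Rightarrow> real) measure))"
    by (rule nn_integral_step_law_Xi[of "\<lambda>_. 1"]) simp
  also have "\<dots> = 1" by simp
  finally show "emeasure (step_law e P) (space (step_law e P)) = 1" .
qed

lemma prob_space_iid_law: "prob_space (iid_law e P)"
  unfolding iid_law_def by (intro prob_space_PiM prob_space_step_law)

lemma sets_iid_law: "sets (iid_law e P) = sets (PiM UNIV (\<lambda>_. step_space))"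
  unfolding iid_law_def by (rule sets_PiM_step_law)

lemma measurable_iid_law: "measurable (iid_law e P) N = measurable (PiM UNIV (\<lambda>_. step_space)) N"
  by (rule measurable_cong_sets[OF sets_iid_law refl])

lemma space_iid_law: "space (iid_law e P) = space traj_space"
  using sets_eq_imp_space_eq[OF sets_iid_law] by (simp add: traj_space_def)

lemma distr_iid_law_restrict:
  "distr (iid_law e P) (PiM {..<n} (\<lambda>_. step_law e P)) (\<lambda>u. restrict u {..<n}) = PiM {..<n} (\<lambda>_. step_law e P)"
proof -
  have "distr (PiM UNIV (\<lambda>_. step_law e P)) (PiM {..<n} (\<lambda>_. step_law e P)) (\<lambda>u. \<lambda>i\<in>{..<n}. u (id i))
      = PiM {..<n} (\<lambda>_. step_law e P)"
    by (rule distr_PiM_reindex) (simp_all add: prob_space_step_law)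
  then show ?thesis by (simp add: iid_law_def restrict_def)
qed

text \<open>A function of the coordinates up to \<open>k\<close> is integrated over a finite
  product, where coordinate \<open>k\<close> splits off by Fubini. Clauses (a) and (b) of the model
  are verified through this formula.\<close>

lemma nn_integral_iid_law_split:
  assumes F: "F \<in> borel_measurable (past_space k \<Otimes>\<^sub>M step_space)"
  shows "(\<integral>\<^sup>+u. F (restrict u {..<k}, u k) \<partial>iid_law e P)
    = (\<integral>\<^sup>+\<eta>. (\<integral>\<^sup>+\<xi>. (\<Sum>w\<in>UNIV. ennreal (tok_weight e P \<xi> w) * F (\<eta>, (P, \<xi>, w))) \<partial>xi_law) \<partial>past_law k)"
proof -
  let ?s = "\<lambda>_ :: nat. step_law e P" and ?G = "\<lambda>u. F (restrict u {..<k}, u k)"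
  interpret S: prob_space "step_law e P" by (rule prob_space_step_law)
  interpret product_sigma_finite ?s by unfold_locales
  have ins: "insert k {..<k} = {..<Suc k}" by auto
  have "(\<lambda>u. (restrict u {..<k}, u k)) \<in> PiM {..<Suc k} (\<lambda>_. step_space) \<rightarrow>\<^sub>M past_space k \<Otimes>\<^sub>M step_space"
    by (intro measurable_Pair measurable_restrict_subset measurable_component_singleton) auto
  then have G': "?G \<in> borel_measurable (PiM {..<Suc k} (\<lambda>_. step_space))"
    by (rule measurable_compose[OF _ F])
  have G: "?G \<in> borel_measurable (PiM {..<Suc k} ?s)"
    unfolding measurable_cong_sets[OF sets_PiM_step_law refl] by (rule G')
  have res: "(\<lambda>u. restrict u {..<Suc k}) \<in> iid_law e P \<rightarrow>\<^sub>M PiM {..<Suc k} ?s"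
    unfolding iid_law_def by (rule measurable_restrict_subset) simp
  have "(\<integral>\<^sup>+u. ?G u \<partial>iid_law e P) = (\<integral>\<^sup>+u. ?G (restrict u {..<Suc k}) \<partial>iid_law e P)"
  proof -
    have "{..<Suc k} \<inter> {..<k} = {..<k}" by auto
    then show ?thesis by (simp only: restrict_restrict) simp
  qed
  also have "\<dots> = (\<integral>\<^sup>+u. ?G u \<partial>PiM {..<Suc k} ?s)"
    by (rule nn_integral_distr[OF res, of ?G, unfolded distr_iid_law_restrict, OF G, symmetric])
  also have "\<dots> = (\<integral>\<^sup>+\<eta>. (\<integral>\<^sup>+x. ?G (\<eta>(k := x)) \<partial>step_law e P) \<partial>PiM {..<k} ?s)"
    using G unfolding ins[symmetric] by (rule product_nn_integral_insert[rotated 2]) simp_all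
  also have "\<dots> = (\<integral>\<^sup>+\<eta>. (\<integral>\<^sup>+\<xi>. (\<Sum>w\<in>UNIV. ennreal (tok_weight e P \<xi> w) * F (\<eta>, (P, \<xi>, w))) \<partial>xi_law) \<partial>PiM {..<k} ?s)"
  proof (rule nn_integral_cong)
    fix \<eta> assume \<eta>: "\<eta> \<in> space (PiM {..<k} ?s)"
    then have "restrict (\<eta>(k := x)) {..<k} = \<eta>" for x
      by (auto simp: space_PiM PiE_def extensional_def fun_eq_iff)
    moreover have "(\<lambda>x. F (\<eta>, x)) \<in> borel_measurable step_space"
      using \<eta> unfolding sets_eq_imp_space_eq[OF sets_PiM_step_law] by (rule measurable_compose[OF measurable_Pair1' F])
    ultimately show "(\<integral>\<^sup>+x. ?G (\<eta>(k := x)) \<partial>step_law e P)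
        = (\<integral>\<^sup>+\<xi>. (\<Sum>w\<in>UNIV. ennreal (tok_weight e P \<xi> w) * F (\<eta>, (P, \<xi>, w))) \<partial>xi_law)"
      using nn_integral_step_law[of "\<lambda>x. F (\<eta>, x)"] by simp
  qed
  finally show ?thesis .
qed

text \<open>The token weights sum to 1, so the token disappears from an integrand that ignores
  it.\<close>

lemma nn_integral_iid_law_hist:
  assumes F: "F \<in> borel_measurable (past_space k \<Otimes>\<^sub>M vec_space \<Otimes>\<^sub>M vec_space)"
  shows "(\<integral>\<^sup>+u. F (restrict u {..<k}, NTP k u, Xi k u) \<partial>iid_law e P)
    = (\<integral>\<^sup>+\<eta>. (\<integral>\<^sup>+\<xi>. F (\<eta>, P, \<xi>) \<partial>xi_law) \<partial>past_law k)"
proof -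
  have "(\<lambda>z. F (fst z, fst (snd z), fst (snd (snd z)))) \<in> borel_measurable (past_space k \<Otimes>\<^sub>M step_space)"
    by (rule measurable_compose[OF _ F])
      (intro measurable_Pair measurable_fst measurable_compose[OF measurable_snd measurable_step_NTP]
        measurable_compose[OF measurable_snd measurable_step_Xi])
  from nn_integral_iid_law_split[OF this] show ?thesis
    by (simp add: NTP_def Xi_def sum_distrib_right[symmetric] sum_tok_weight_ennreal)
qed

lemma sets_vec_singleton: "{P} \<in> sets vec_space"
proof -
  have "{P} = (\<Inter>w. (\<lambda>f. f w) -` {P w} \<inter> space vec_space)" by auto
  also have "\<dots> \<in> sets vec_space"
    by (intro sets.finite_INT measurable_sets[OF measurable_vec_component]) auto
  finally show ?thesis .
qed

lemma AE_iid_law_NTP: "AE u in iid_law e P. NTP k u = P"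
proof -
  have "{x \<in> space step_space. fst x = P} = fst -` {P} \<inter> space step_space" by auto
  then have "{x \<in> space step_space. fst x = P} \<in> sets step_space"
    using measurable_sets[OF measurable_step_NTP sets_vec_singleton] by simp
  then have "AE x in step_law e P. fst x = P"
    unfolding step_law_def using step_pair_measurable
    by (subst AE_distr_iff) (simp_all cong: measurable_cong_sets)
  then show ?thesis
    unfolding iid_law_def NTP_def by (intro AE_PiM_component prob_space_step_law) auto
qed

lemma iid_law_sets_image:
  assumes f: "f \<in> iid_law e P \<rightarrow>\<^sub>M T" and A: "A \<in> sets (vimage_algebra (space traj_space) f T)"
  shows "\<exists>C\<in>sets T. A = f -` C \<inter> space (iid_law e P)"
proof -
  have "f \<in> space traj_space \<rightarrow> space T"
    using measurable_space[OF f] by (simp add: space_iid_law)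
  then show ?thesis using A by (auto simp: sets_vimage_algebra2 space_iid_law)
qed

lemma emeasure_vimage_eq_nn_integral:
  assumes f: "f \<in> N \<rightarrow>\<^sub>M T" and C: "C \<in> sets T"
  shows "emeasure N (f -` C \<inter> space N) = (\<integral>\<^sup>+u. indicator C (f u) \<partial>N)"
proof -
  have "emeasure N (f -` C \<inter> space N) = (\<integral>\<^sup>+u. indicator (f -` C \<inter> space N) u \<partial>N)"
    using measurable_sets[OF f C] by simp
  also have "\<dots> = (\<integral>\<^sup>+u. indicator C (f u) \<partial>N)"
    by (intro nn_integral_cong) (simp add: indicator_def)
  finally show ?thesis .
qed

text \<open>Events in the clauses are preimages under the history maps, so their probabilities are
  iterated integrals over the past and \<open>\<xi>\<close>. Independence is factorisation of such
  an integral; for the token clause both sides become the same one.\<close>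

lemma gw_model_iid_law:
  assumes PD: "P \<in> P_Delta \<Delta>"
  shows "gw_model e \<Delta> (iid_law e P)"
proof -
  let ?M = "iid_law e P" and ?V = "vec_space :: ('w \<Rightarrow> real) measure"
  interpret M: prob_space ?M by (rule prob_space_iid_law)
  let ?S = "\<lambda>k. past_space k :: 'w traj measure"
  have Xi: "Xi k \<in> ?M \<rightarrow>\<^sub>M ?V" and NTP: "NTP k \<in> ?M \<rightarrow>\<^sub>M ?V" and Tok: "Tok k \<in> ?M \<rightarrow>\<^sub>M count_space UNIV" for k
    unfolding measurable_iid_law by (rule measurable_Xi measurable_NTP measurable_Tok, simp)+
  have res: "(\<lambda>u. restrict u {..<k}) \<in> ?M \<rightarrow>\<^sub>M ?S k" for k
    unfolding measurable_iid_law by (rule measurable_restrict_traj)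
  have snd': "(\<lambda>z. snd (snd z)) \<in> ?S k \<Otimes>\<^sub>M ?V \<Otimes>\<^sub>M ?V \<rightarrow>\<^sub>M ?V" for k
    by (rule measurable_compose[OF measurable_snd measurable_snd])
  have hist: "(\<lambda>z. (fst z, fst (snd z))) \<in> ?S k \<Otimes>\<^sub>M ?V \<Otimes>\<^sub>M ?V \<rightarrow>\<^sub>M ?S k \<Otimes>\<^sub>M ?V" for k
    by (intro measurable_Pair measurable_fst measurable_compose[OF measurable_snd measurable_fst])
  have XiB: "emeasure ?M (Xi k -` B \<inter> space ?M) = emeasure xi_law B" if B: "B \<in> sets ?V" for k B
  proof -
    interpret H: prob_space "past_law k" by (intro prob_space_PiM prob_space_step_law)
    have "emeasure ?M (Xi k -` B \<inter> space ?M) = (\<integral>\<^sup>+u. indicator B (Xi k u) \<partial>?M)"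
      by (rule emeasure_vimage_eq_nn_integral[OF Xi B])
    also have "\<dots> = (\<integral>\<^sup>+u. (\<lambda>z. indicator B (snd (snd z))) (restrict u {..<k}, NTP k u, Xi k u) \<partial>?M)" by simp
    also have "\<dots> = (\<integral>\<^sup>+\<eta>. (\<integral>\<^sup>+\<xi>. (\<lambda>z. indicator B (snd (snd z))) (\<eta>, P, \<xi>) \<partial>xi_law) \<partial>past_law k)"
      by (rule nn_integral_iid_law_hist[OF measurable_compose[OF snd' borel_measurable_indicator[OF B]]])
    also have "\<dots> = emeasure xi_law B" using B by (simp add: H.emeasure_space_1)
    finally show ?thesis .
  qed
  have c1: "distr ?M vec_space (Xi k) = PiM UNIV (\<lambda>_. uniform_measure lborel {0..1})" for k
  proof -
    have "distr ?M vec_space (Xi k) = xi_law"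
      using XiB Xi by (intro measure_eqI) (simp_all add: emeasure_distr)
    then show ?thesis by (simp add: xi_law_def mu0_def)
  qed
  have c2: "measure ?M (A \<inter> (Xi k -` B \<inter> space ?M)) = measure ?M A * measure ?M (Xi k -` B \<inter> space ?M)"
    if A: "A \<in> sets (Hist k)" and B: "B \<in> sets ?V" for k A B
  proof -
    let ?f = "\<lambda>u. (restrict u {..<k}, NTP k u)"
    have f: "?f \<in> ?M \<rightarrow>\<^sub>M ?S k \<Otimes>\<^sub>M ?V" by (intro measurable_Pair res NTP)
    obtain C where C: "C \<in> sets (?S k \<Otimes>\<^sub>M ?V)" "A = ?f -` C \<inter> space ?M"
      using iid_law_sets_image[OF f] A by (auto simp: Hist_def)
    let ?I = "\<integral>\<^sup>+\<eta>. indicator C (\<eta>, P) \<partial>past_law k"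
    have IC: "(\<lambda>z. indicator C (fst z, fst (snd z)) :: ennreal) \<in> borel_measurable (?S k \<Otimes>\<^sub>M ?V \<Otimes>\<^sub>M ?V)"
      by (rule measurable_compose[OF hist borel_measurable_indicator[OF C(1)]])
    have IB: "(\<lambda>z. indicator B (snd (snd z)) :: ennreal) \<in> borel_measurable (?S k \<Otimes>\<^sub>M ?V \<Otimes>\<^sub>M ?V)"
      by (rule measurable_compose[OF snd' borel_measurable_indicator[OF B]])
    have "emeasure ?M A = (\<integral>\<^sup>+u. indicator C (?f u) \<partial>?M)"
      unfolding C(2) by (rule emeasure_vimage_eq_nn_integral[OF f C(1)])
    also have "\<dots> = (\<integral>\<^sup>+u. (\<lambda>z. indicator C (fst z, fst (snd z))) (restrict u {..<k}, NTP k u, Xi k u) \<partial>?M)" by simp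
    also have "\<dots> = ?I"
      unfolding nn_integral_iid_law_hist[OF IC] by simp
    finally have eA: "emeasure ?M A = ?I" .
    have "emeasure ?M (A \<inter> (Xi k -` B \<inter> space ?M)) = (\<integral>\<^sup>+u. indicator (A \<inter> (Xi k -` B \<inter> space ?M)) u \<partial>?M)"
      using measurable_sets[OF f C(1)] measurable_sets[OF Xi B] by (simp add: C(2))
    also have "\<dots> = (\<integral>\<^sup>+u. (\<lambda>z. indicator C (fst z, fst (snd z)) * indicator B (snd (snd z))) (restrict u {..<k}, NTP k u, Xi k u) \<partial>?M)"
      by (intro nn_integral_cong) (simp add: C(2) indicator_def)
    also have "\<dots> = (\<integral>\<^sup>+\<eta>. (\<integral>\<^sup>+\<xi>. indicator C (\<eta>, P) * indicator B \<xi> \<partial>xi_law) \<partial>past_law k)"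
      unfolding nn_integral_iid_law_hist[OF borel_measurable_times_ennreal[OF IC IB]] by simp
    also have "\<dots> = (\<integral>\<^sup>+\<eta>. indicator C (\<eta>, P) * emeasure xi_law B \<partial>past_law k)"
      using B by (simp add: nn_integral_cmult cong: measurable_cong_sets)
    also have "\<dots> = ?I * emeasure xi_law B"
    proof (rule nn_integral_multc)
      have "(\<lambda>\<eta>. indicator C (\<eta>, P) :: ennreal) \<in> borel_measurable (?S k)"
        by (rule measurable_compose[OF measurable_Pair2' borel_measurable_indicator[OF C(1)]]) simp
      then show "(\<lambda>\<eta>. indicator C (\<eta>, P) :: ennreal) \<in> borel_measurable (past_law k)"
        by (simp add: measurable_cong_sets[OF sets_PiM_step_law refl])
    qed
    finally have "emeasure ?M (A \<inter> (Xi k -` B \<inter> space ?M)) = emeasure ?M A * emeasure ?M (Xi k -` B \<inter> space ?M)"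
      by (simp only: eA XiB[OF B])
    then show ?thesis by (simp add: M.emeasure_eq_measure ennreal_mult[symmetric])
  qed
  have c3: "measure ?M (A \<inter> {u\<in>space ?M. Tok k u = w}) =
      (\<integral>u\<in>A. (e * (if decoder (NTP k u) (Xi k u) = w then 1 else 0) + (1 - e) * NTP k u w) \<partial>?M)"
    if A: "A \<in> sets (HistXi k)" for k A w
  proof -
    let ?f = "\<lambda>u. (restrict u {..<k}, NTP k u, Xi k u)"
    let ?W = "\<lambda>u. tok_weight e (NTP k u) (Xi k u) w"
    have f: "?f \<in> ?M \<rightarrow>\<^sub>M ?S k \<Otimes>\<^sub>M ?V \<Otimes>\<^sub>M ?V" by (intro measurable_Pair res NTP Xi)
    obtain C where C: "C \<in> sets (?S k \<Otimes>\<^sub>M ?V \<Otimes>\<^sub>M ?V)" "A = ?f -` C \<inter> space ?M"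
      using iid_law_sets_image[OF f] A by (auto simp: HistXi_def)
    have A': "A \<in> sets ?M" unfolding C(2) by (rule measurable_sets[OF f C(1)])
    have W: "?W \<in> borel_measurable ?M" by (rule measurable_tok_weight[OF NTP Xi])
    have TokS: "{u\<in>space ?M. Tok k u = w} \<in> sets ?M"
      using measurable_sets[OF Tok, of "{w}" k] by (simp add: vimage_def Int_def conj_commute)
    have bound: "AE u in ?M. 0 \<le> ?W u \<and> ?W u \<le> 1"
      using AE_iid_law_NTP[of k]
    proof eventually_elim
      case (elim u)
      show ?case using P eps elim by (simp add: tok_weight_nonneg tok_weight_le_1)
    qed
    let ?R = "\<integral>\<^sup>+\<eta>. (\<integral>\<^sup>+\<xi>. ennreal (tok_weight e P \<xi> w) * indicator C (\<eta>, P, \<xi>) \<partial>xi_law) \<partial>past_law k"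
    have g: "(\<lambda>z. (fst z, fst (snd z), fst (snd (snd z)))) \<in> ?S k \<Otimes>\<^sub>M step_space \<rightarrow>\<^sub>M ?S k \<Otimes>\<^sub>M ?V \<Otimes>\<^sub>M ?V"
      by (intro measurable_Pair measurable_fst measurable_compose[OF measurable_snd measurable_step_NTP]
        measurable_compose[OF measurable_snd measurable_step_Xi])
    have G: "(\<lambda>z. indicator {w} (snd (snd (snd z))) * indicator C (fst z, fst (snd z), fst (snd (snd z))) :: ennreal)
        \<in> borel_measurable (?S k \<Otimes>\<^sub>M step_space)"
      by (intro borel_measurable_times_ennreal measurable_compose[OF g borel_measurable_indicator[OF C(1)]]
        measurable_compose[OF measurable_compose[OF measurable_snd measurable_step_Tok]]) simp
    have "emeasure ?M (A \<inter> {u\<in>space ?M. Tok k u = w})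
        = (\<integral>\<^sup>+u. indicator (A \<inter> {u\<in>space ?M. Tok k u = w}) u \<partial>?M)"
      using A' TokS by simp
    also have "\<dots> = (\<integral>\<^sup>+u. (\<lambda>z. indicator {w} (snd (snd (snd z))) * indicator C (fst z, fst (snd z), fst (snd (snd z)))) (restrict u {..<k}, u k) \<partial>?M)"
      by (intro nn_integral_cong) (auto simp: C(2) indicator_def NTP_def Xi_def Tok_def)
    also have "\<dots> = ?R"
      unfolding nn_integral_iid_law_split[OF G]
    proof (intro nn_integral_cong)
      fix \<eta> :: "'w traj" and \<xi> :: "'w \<Rightarrow> real"
      have "(\<Sum>v\<in>UNIV. ennreal (tok_weight e P \<xi> v) * (indicator {w} v * indicator C (\<eta>, P, \<xi>)))
          = (\<Sum>v\<in>UNIV. if v = w then ennreal (tok_weight e P \<xi> v) * indicator C (\<eta>, P, \<xi>) else 0)"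
        by (intro sum.cong) auto
      then show "(\<Sum>v\<in>UNIV. ennreal (tok_weight e P \<xi> v) * (indicator {w} (snd (snd (snd (\<eta>, P, \<xi>, v))))
          * indicator C (fst (\<eta>, P, \<xi>, v), fst (snd (\<eta>, P, \<xi>, v)), fst (snd (snd (\<eta>, P, \<xi>, v))))))
          = ennreal (tok_weight e P \<xi> w) * indicator C (\<eta>, P, \<xi>)"
        by simp
    qed
    finally have L: "emeasure ?M (A \<inter> {u\<in>space ?M. Tok k u = w}) = ?R" .
    have wm: "(\<lambda>z. ennreal (tok_weight e (fst (snd z)) (snd (snd z)) w)) \<in> borel_measurable (?S k \<Otimes>\<^sub>M ?V \<Otimes>\<^sub>M ?V)"
      by (rule measurable_compose[OF measurable_tok_weight[OF measurable_compose[OF measurable_snd measurable_fst] snd'] measurable_ennreal])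
    have "(\<integral>\<^sup>+u. ennreal (?W u) * indicator A u \<partial>?M)
        = (\<integral>\<^sup>+u. (\<lambda>z. ennreal (tok_weight e (fst (snd z)) (snd (snd z)) w) * indicator C z) (?f u) \<partial>?M)"
      by (intro nn_integral_cong) (simp add: C(2) indicator_def)
    also have "\<dots> = ?R"
      unfolding nn_integral_iid_law_hist[OF borel_measurable_times_ennreal[OF wm borel_measurable_indicator[OF C(1)]]]
      by simp
    finally have "ennreal (measure ?M (A \<inter> {u\<in>space ?M. Tok k u = w})) = ennreal (\<integral>u\<in>A. ?W u \<partial>?M)"
      using L unfolding M.emeasure_eq_measure M.nn_integral_unit_weight(1)[OF A' W bound] by (simp only:)
    then show ?thesis
      using M.nn_integral_unit_weight(2)[OF A' W bound] by (simp add: tok_weight_def)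
  qed
  have c0: "AE u in ?M. NTP k u \<in> P_Delta \<Delta>" for k
    using AE_iid_law_NTP[of k] by eventually_elim (simp add: PD)
  show ?thesis
    unfolding gw_model_def
    using M.prob_space_axioms sets_iid_law c0 c1 c2 c3 by (simp add: traj_space_def)
qed

lemma distr_step_law_Y:
  "distr (step_law e P) borel (\<lambda>x. fst (snd x) (snd (snd x))) = dens_law e P UNIV"
proof (rule measure_eqI)
  fix B assume "B \<in> sets (distr (step_law e P) borel (\<lambda>x. fst (snd x) (snd (snd x))))"
  then have B: "B \<in> sets borel" by simp
  have Y: "(\<lambda>x. fst (snd x) (snd (snd x))) \<in> step_law e P \<rightarrow>\<^sub>M borel"
    using measurable_step_Y by (simp cong: measurable_cong_sets)
  have "emeasure (distr (step_law e P) borel (\<lambda>x. fst (snd x) (snd (snd x)))) B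
      = (\<integral>\<^sup>+x. indicator B (fst (snd x) (snd (snd x))) \<partial>step_law e P)"
    using emeasure_vimage_eq_nn_integral[OF Y B] by (simp add: emeasure_distr[OF Y B])
  also have "\<dots> = (\<integral>\<^sup>+\<xi>. (\<Sum>w\<in>UNIV. ennreal (tok_weight e P \<xi> w) * indicator B (\<xi> w)) \<partial>xi_law)"
    using nn_integral_step_law[OF measurable_compose[OF measurable_step_Y borel_measurable_indicator[OF B]]] by simp
  also have "\<dots> = (\<integral>\<^sup>+y. indicator B y \<partial>dens_law e P UNIV)"
    using eps B by (intro nn_integral_xi_law_tok_weight[OF P]) auto
  also have "\<dots> = emeasure (dens_law e P UNIV) B"
    using B by simp
  finally show "emeasure (distr (step_law e P) borel (\<lambda>x. fst (snd x) (snd (snd x)))) B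
      = emeasure (dens_law e P UNIV) B" .
qed simp

text \<open>Each observation is the same function of its own step, so the product structure passes
  from steps to observations.\<close>

lemma distr_iid_law_Y:
  "distr (iid_law e P) (obs_space n) (Ys n)
    = PiM {..<n} (\<lambda>_. dens_law e P UNIV)"
proof -
  let ?Y = "\<lambda>x :: 'w step. fst (snd x) (snd (snd x))"
  let ?N = "dens_law e P UNIV"
  let ?H = "PiM {..<n} (\<lambda>_. step_law e P)"
  have Y: "?Y \<in> step_law e P \<rightarrow>\<^sub>M borel"
    using measurable_step_Y by (simp cong: measurable_cong_sets)
  interpret S: prob_space "step_law e P" by (rule prob_space_step_law)
  have P': "0 \<le> P v" "sum P UNIV = 1" for v using P by (auto simp: prob_vec_def)
  have N: "prob_space ?N" by (rule prob_space_density_dens) (use P' eps in auto)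
  have YN: "?Y \<in> step_law e P \<rightarrow>\<^sub>M ?N" using Y by (simp cong: measurable_cong_sets)
  have sets: "sets (PiM {..<n} (\<lambda>_. ?N)) = sets (obs_space n)" by (intro sets_PiM_cong) auto
  have comp: "compose {..<n} ?Y \<in> ?H \<rightarrow>\<^sub>M PiM {..<n} (\<lambda>_. ?N)"
    unfolding compose_def
    by (intro measurable_restrict measurable_compose[OF _ YN]) (rule measurable_component_singleton)
  have res: "(\<lambda>u. restrict u {..<n}) \<in> iid_law e P \<rightarrow>\<^sub>M ?H"
    unfolding iid_law_def by (rule measurable_restrict_subset) simp
  have "distr (iid_law e P) (obs_space n) (Ys n)
      = distr (iid_law e P) (PiM {..<n} (\<lambda>_. ?N)) (compose {..<n} ?Y \<circ> (\<lambda>u. restrict u {..<n}))"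
    by (rule distr_cong) (auto simp: sets compose_def Yv_def Xi_def Tok_def fun_eq_iff)
  also have "\<dots> = distr ?H (PiM {..<n} (\<lambda>_. ?N)) (compose {..<n} ?Y)"
    unfolding distr_distr[OF comp res, symmetric] distr_iid_law_restrict ..
  also have "\<dots> = PiM {..<n} (\<lambda>_. distr (step_law e P) ?N ?Y)"
    by (rule distr_PiM_finite_prob_space') (simp_all only: N S.prob_space_axioms YN finite_lessThan)
  also have "distr (step_law e P) ?N ?Y = distr (step_law e P) borel ?Y"
    by (rule distr_cong) auto
  finally show ?thesis by (simp only: distr_step_law_Y)
qed

end

text \<open>Both sides agree on boxes, where the integral factorises. This makes the likelihood
  ratio of the i.i.d. alternative against the null explicit.\<close>

lemma PiM_density_mu0:
  fixes f :: "real \<Rightarrow> ennreal"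
  assumes f[measurable]: "f \<in> borel_measurable borel" and prob: "prob_space (density mu0 f)"
  shows "PiM {..<n} (\<lambda>_. density mu0 f) = density (H0_law n) (\<lambda>y. \<Prod>k<n. f (y k))"
proof (rule sym)
  interpret m: product_sigma_finite "\<lambda>_::nat. mu0" by unfold_locales
  interpret D: prob_space "density mu0 f" by (rule prob)
  interpret d: product_sigma_finite "\<lambda>_::nat. density mu0 f" by unfold_locales
  have fm: "(\<lambda>y. \<Prod>k<n. f (y k)) \<in> borel_measurable (H0_law n)"
    by (intro borel_measurable_prod_ennreal measurable_compose[OF measurable_H0_component]) auto
  show "density (H0_law n) (\<lambda>y. \<Prod>k<n. f (y k)) = PiM {..<n} (\<lambda>_. density mu0 f)"
  proof (rule d.PiM_eqI)
    show "sets (density (H0_law n) (\<lambda>y. \<Prod>k<n. f (y k))) = sets (PiM {..<n} (\<lambda>_. density mu0 f))"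
      by (simp, intro sets_PiM_cong) auto
    fix A :: "nat \<Rightarrow> real set" assume A: "\<And>i. i \<in> {..<n} \<Longrightarrow> A i \<in> sets (density mu0 f)"
    then have A': "A i \<in> sets borel" if "i < n" for i using that by simp
    have PiE: "PiE {..<n} A \<in> sets (H0_law n)"
      unfolding H0_law_eq using A' by (intro sets_PiM_I_finite) auto
    have "emeasure (density (H0_law n) (\<lambda>y. \<Prod>k<n. f (y k))) (PiE {..<n} A)
        = (\<integral>\<^sup>+y. (\<Prod>k<n. f (y k)) * indicator (PiE {..<n} A) y \<partial>H0_law n)"
      by (rule emeasure_density[OF fm PiE])
    also have "\<dots> = (\<integral>\<^sup>+y. (\<Prod>k<n. f (y k) * indicator (A k) (y k)) \<partial>PiM {..<n} (\<lambda>_. mu0))"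
      unfolding H0_law_eq
    proof (rule nn_integral_cong)
      fix y assume y: "y \<in> space (PiM {..<n} (\<lambda>_. mu0))"
      have "indicator (PiE {..<n} A) y = (\<Prod>k<n. indicator (A k) (y k) :: ennreal)"
      proof (cases "\<forall>k<n. y k \<in> A k")
        case True
        then have "y \<in> PiE {..<n} A" using y by (auto simp: space_PiM PiE_iff)
        moreover have "(\<Prod>k<n. indicator (A k) (y k) :: ennreal) = 1"
          using True by (intro prod.neutral) auto
        ultimately show ?thesis by simp
      next
        case False
        then obtain k where k: "k < n" "y k \<notin> A k" by auto
        then have "(\<Prod>k<n. indicator (A k) (y k) :: ennreal) = 0"
          by (intro prod_zero bexI[of _ k]) auto
        moreover have "y \<notin> PiE {..<n} A" using k by (auto simp: PiE_iff)
        ultimately show ?thesis by simp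
      qed
      then show "(\<Prod>k<n. f (y k)) * indicator (PiE {..<n} A) y = (\<Prod>k<n. f (y k) * indicator (A k) (y k))"
        by (simp add: prod.distrib)
    qed
    also have "\<dots> = (\<Prod>k<n. \<integral>\<^sup>+r. f r * indicator (A k) r \<partial>mu0)"
      using A' by (intro m.product_nn_integral_prod) auto
    also have "\<dots> = (\<Prod>k<n. emeasure (density mu0 f) (A k))"
      using A' by (intro prod.cong refl emeasure_density[symmetric]) auto
    finally show "emeasure (density (H0_law n) (\<lambda>y. \<Prod>k<n. f (y k))) (PiE {..<n} A)
        = (\<Prod>i\<in>{..<n}. emeasure (density mu0 f) (A i))" .
  qed simp
qed

section \<open>Error exponents\<close>

context watermark_params
begin

abbreviation "mean_log \<equiv> \<integral>r. ln (pstar_dens r) \<partial>mu0"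

text \<open>A common bound passes to the supremum once some model exists, the real supremum of the
  empty set being unspecified; the vocabulary is large enough for the i.i.d. law built from
  \<open>Pstar\<close>.\<close>

lemma sup_type2_upper:
  assumes "\<And>M :: 'w::finite traj measure. gw_model \<epsilon> \<Delta> M \<Longrightarrow>
      measure M {u\<in>space M. S n (Ys n u) \<le> \<gamma> n} \<le> c"
    and card: "Pstar_len \<Delta> + 1 \<le> CARD('w)"
  shows "sup_type2 TYPE('w) \<epsilon> \<Delta> S \<gamma> n \<le> c"
proof -
  obtain P :: "'w \<Rightarrow> real" where "P \<in> P_Delta \<Delta>" using ex_Pstar_vec[OF card] by blast
  then have "gw_model \<epsilon> \<Delta> (iid_law \<epsilon> P)"
    using eps by (intro gw_model_iid_law) (auto simp: P_Delta_def)
  then show ?thesis unfolding sup_type2_def using assms(1) by (intro cSUP_least) auto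
qed

lemma sup_type2_lower:
  fixes M :: "'w::finite traj measure"
  assumes "gw_model \<epsilon> \<Delta> M"
  shows "measure M {u\<in>space M. S n (Ys n u) \<le> \<gamma> n} \<le> sup_type2 TYPE('w) \<epsilon> \<Delta> S \<gamma> n"
  unfolding sup_type2_def
proof (rule cSUP_upper)
  show "bdd_above ((\<lambda>M. measure M {u \<in> space M. S n (Ys n u) \<le> \<gamma> n})
      ` {M :: 'w traj measure. gw_model \<epsilon> \<Delta> M})"
    by (rule bdd_aboveI[of _ 1]) (auto simp: gw_model_def intro: prob_space.prob_le_1)
qed (use assms in simp)

context
  fixes s \<alpha> :: real
  assumes s: "0 < s" "s < 1" and alpha: "0 < \<alpha>" "\<alpha> < 1"
begin

text \<open>Change of measure: off the exceptional set \<open>B n\<close> the likelihood ratio is at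
  least \<open>exp (n * (mean_log - c))\<close>, and acceptance without \<open>B n\<close> keeps
  null probability at least \<open>(1 - \<alpha>) - (1 - \<alpha>) / 2\<close>.\<close>

lemma type2_lower_bound:
  assumes S: "measurable_statistic S" and crit: "critical_values \<alpha> S \<gamma>"
    and card: "Pstar_len \<Delta> + 1 \<le> CARD('w::finite)" and c: "0 < c"
  shows "eventually (\<lambda>n. exp (real n * (mean_log - c)) * ((1 - \<alpha>) / 2)
    \<le> sup_type2 TYPE('w) \<epsilon> \<Delta> S \<gamma> n) sequentially"
proof -
  let ?g = "\<lambda>r. ln (pstar_dens r)"
  define \<mu> where "\<mu> = (\<integral>r. ?g r \<partial>mu0)"
  define B where "B n = {y\<in>space (H0_law n). real n * c \<le> \<bar>(\<Sum>i<n. ?g (y i)) - real n * \<mu>\<bar>}" for n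
  have "(\<lambda>n. measure (H0_law n) (B n)) \<longlonglongrightarrow> 0"
    unfolding B_def \<mu>_def by (rule H0_weak_law[OF _ integrable_ln_pstar_dens_sq c]) measurable
  then have "eventually (\<lambda>n. measure (H0_law n) (B n) < (1 - \<alpha>) / 2) sequentially"
    using alpha by (intro order_tendstoD(2)) auto
  with crit[unfolded critical_values_def] show ?thesis unfolding \<mu>_def[symmetric]
  proof eventually_elim
    case (elim n)
    obtain P :: "'w \<Rightarrow> real" where P: "P \<in> P_Delta \<Delta>" "dens \<epsilon> P UNIV = pstar_dens"
      using ex_Pstar_vec[OF card] by blast
    have pv: "prob_vec P" using P by (simp add: P_Delta_def)
    let ?M = "iid_law \<epsilon> P"
    have gw: "gw_model \<epsilon> \<Delta> ?M" by (rule gw_model_iid_law[OF eps pv P(1)])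
    interpret M: watermark_model \<epsilon> \<Delta> ?M by unfold_locales (rule gw)
    interpret M: prob_space ?M by (rule M.gw_prob_space)
    have Sm[measurable]: "S n \<in> borel_measurable (obs_space n)"
      using S by (simp add: measurable_statistic_def)
    define A where "A = {y\<in>space (H0_law n). S n y \<le> \<gamma> n}"
    define L where "L = {y\<in>space (H0_law n). \<gamma> n \<le> S n y}"
    have A[measurable]: "A \<in> sets (H0_law n)" unfolding A_def by measurable
    have L: "L \<in> sets (H0_law n)" unfolding L_def by measurable
    have B: "B n \<in> sets (H0_law n)" unfolding B_def by measurable
    define E where "E = A - B n"
    have E: "E \<in> sets (H0_law n)" unfolding E_def using A B by auto
    \<comment> \<open>Acceptance and rejection overlap where \<open>S n y = \<gamma> n\<close>; they
      cover the space, and subadditivity is enough.\<close>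
    have "space (H0_law n) = E \<union> (L \<union> B n)"
      by (auto simp: E_def A_def L_def B_def)
    then have "1 = measure (H0_law n) (E \<union> (L \<union> B n))" using H.prob_space[of n] by simp
    also have "\<dots> \<le> measure (H0_law n) E + (measure (H0_law n) L + measure (H0_law n) (B n))"
      using E L B by (intro order_trans[OF measure_Un_le] add_left_mono measure_Un_le) auto
    finally have mE: "(1 - \<alpha>) / 2 \<le> measure (H0_law n) E"
      using elim by (simp add: L_def)
    have law: "distr ?M (obs_space n) (Ys n)
        = density (H0_law n) (\<lambda>y. \<Prod>k<n. ennreal (pstar_dens (y k)))"
    proof -
      have "PiM {..<n} (\<lambda>_. density mu0 (\<lambda>r. ennreal (pstar_dens r)))
          = density (H0_law n) (\<lambda>y. \<Prod>k<n. ennreal (pstar_dens (y k)))"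
        by (rule PiM_density_mu0) (use prob_space_pstar_mix in \<open>auto simp: pstar_mix_def\<close>)
      then show ?thesis unfolding distr_iid_law_Y[OF eps pv] P(2) .
    qed
    have A': "A \<in> sets (obs_space n)" using A by simp
    have dm: "(\<lambda>y. \<Prod>k<n. ennreal (pstar_dens (y k))) \<in> borel_measurable (H0_law n)"
      by measurable
    have "ennreal (exp (real n * (\<mu> - c)) * ((1 - \<alpha>) / 2)) \<le> ennreal (exp (real n * (\<mu> - c)) * measure (H0_law n) E)"
      using mE by (intro ennreal_leI mult_left_mono) auto
    also have "\<dots> = (\<integral>\<^sup>+y. ennreal (exp (real n * (\<mu> - c))) * indicator E y \<partial>H0_law n)"
      using E by (simp add: nn_integral_cmult_indicator H.emeasure_eq_measure ennreal_mult)
    also have "\<dots> \<le> (\<integral>\<^sup>+y. (\<Prod>k<n. ennreal (pstar_dens (y k))) * indicator A y \<partial>H0_law n)"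
    proof (rule nn_integral_mono_AE, use AE_H0_law AE_space in eventually_elim)
      case (elim y)
      show ?case
      proof (cases "y \<in> E")
        case True
        then have y: "y \<in> A" "y \<notin> B n" by (auto simp: E_def)
        have pos: "0 < pstar_dens (y k)" if "k < n" for k
          using elim that by (intro pstar_dens_pos) auto
        have "\<not> real n * c \<le> \<bar>(\<Sum>i<n. ?g (y i)) - real n * \<mu>\<bar>"
          using y(2) elim unfolding B_def by blast
        then have "real n * (\<mu> - c) \<le> (\<Sum>i<n. ?g (y i))"
          unfolding right_diff_distrib by linarith
        then have "exp (real n * (\<mu> - c)) \<le> exp (\<Sum>i<n. ?g (y i))" by simp
        also have "\<dots> = (\<Prod>i<n. pstar_dens (y i))"
          using pos by (simp add: exp_sum)
        finally have "ennreal (exp (real n * (\<mu> - c))) \<le> ennreal (\<Prod>i<n. pstar_dens (y i))"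
          by (rule ennreal_leI)
        also have "\<dots> = (\<Prod>k<n. ennreal (pstar_dens (y k)))"
          using pos by (intro prod_ennreal[symmetric]) (auto intro: less_imp_le)
        finally show ?thesis using True y by simp
      qed simp
    qed
    also have "\<dots> = emeasure (density (H0_law n) (\<lambda>y. \<Prod>k<n. ennreal (pstar_dens (y k)))) A"
      by (rule emeasure_density[symmetric, OF dm A])
    also have "\<dots> = emeasure ?M (Ys n -` A \<inter> space ?M)"
      unfolding law[symmetric] by (rule emeasure_distr[OF M.gw_measurable_Y A'])
    also have "Ys n -` A \<inter> space ?M
        = {u\<in>space ?M. S n (Ys n u) \<le> \<gamma> n}"
      by (auto simp: A_def space_H0_law)
    finally have "exp (real n * (\<mu> - c)) * ((1 - \<alpha>) / 2)
        \<le> measure ?M {u\<in>space ?M. S n (Ys n u) \<le> \<gamma> n}"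
      by (simp add: M.emeasure_eq_measure)
    also have "\<dots> \<le> sup_type2 TYPE('w) \<epsilon> \<Delta> S \<gamma> n" by (rule sup_type2_lower[OF gw])
    finally show ?case .
  qed
qed

text \<open>The tolerance \<open>d\<close> is split: one half is what a statistic of size
  \<open>(d / 2)\<^sup>2 / 4\<close> permits by the Pinsker-type bound, the other absorbs the
  \<open>1 / n\<close> lost at the last rank.\<close>

lemma TrGoF_type2_upper_bound:
  assumes card: "Pstar_len \<Delta> + 1 \<le> CARD('w::finite)" and n: "n > 0" and d: "0 < d" "d \<le> 1"
    and \<gamma>: "\<gamma> n \<le> (d / 2)\<^sup>2 / 4" and nd: "1 / real n \<le> d / 2"
  shows "sup_type2 TYPE('w) \<epsilon> \<Delta> (GoF s) \<gamma> n
    \<le> exp (real n * (\<integral>r. ln (pstar_dens (r + d)) \<partial>mu0))"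
proof (rule sup_type2_upper[OF _ card])
  fix M :: "'w traj measure"
  assume gw: "gw_model \<epsilon> \<Delta> M"
  interpret M: watermark_model \<epsilon> \<Delta> M by unfold_locales (rule gw)
  interpret M: prob_space M by (rule M.gw_prob_space)
  let ?g = "\<lambda>r. ln (pstar_dens r)"
  let ?A = "{u\<in>space M. GoF s n (Ys n u) \<le> \<gamma> n}"
  define I where "I = (\<integral>r. ?g (r + d) \<partial>mu0)"
  have A: "?A \<in> sets M" by (rule M.gw_measurable_event[OF measurable_statistic_TrGoF])
  have "(\<integral>\<^sup>+u. ennreal (exp (- (real n * I))) * indicator ?A u \<partial>M)
      \<le> (\<integral>\<^sup>+u. (\<Prod>k<n. inv_dens (Yv k u)) \<partial>M)"
  proof (rule nn_integral_mono_AE, use M.gw_AE_Y in eventually_elim)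
    case (elim u)
    show ?case
    proof (cases "u \<in> ?A")
      case True
      define y where "y = Ys n u"
      have y: "0 < y i \<and> y i < 1" if "i < n" for i using elim that by (simp add: y_def)
      have le: "GoF s n y \<le> (d / 2)\<^sup>2 / 4" using True \<gamma> by (simp add: y_def)
      have d2: "0 \<le> d / 2" using d by simp
      have "(\<Sum>i<n. ?g (y i)) \<le> real n * (\<integral>r. ?g (r + d) \<partial>mu0)"
      proof (rule sum_le_integral_shift[OF n d(1)])
        show "?g x \<le> ?g x'" if "0 < x" "x \<le> x'" for x x'
          using that by (rule ln_pstar_dens_mono)
        show "integrable mu0 (\<lambda>r. ?g (r + d))"
          using d by (intro integrable_ln_pstar_dens_shift(1)) auto
        fix t assume t: "t \<in> {1..n}"
        show "p_ord n y t < 1 \<and> real t / real n - d \<le> p_ord n y t"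
        proof
          show "p_ord n y t < 1" by (rule TrGoF_le_imp_p_ord_ge(1)[OF n s y le d2 t])
          have "real t / real n - (d / 2 + 1 / real n) \<le> p_ord n y t"
            by (rule TrGoF_le_imp_p_ord_ge(3)[OF n s y le d2 t])
          then show "real t / real n - d \<le> p_ord n y t" using nd by linarith
        qed
      qed
      then have "exp (- (real n * I)) \<le> exp (- (\<Sum>i<n. ?g (y i)))" by (simp add: I_def)
      also have "\<dots> = (\<Prod>i<n. exp (- ?g (y i)))" by (simp add: exp_sum[symmetric] sum_negf)
      also have "\<dots> = (\<Prod>i<n. 1 / pstar_dens (y i))"
        using y by (intro prod.cong refl)
          (simp add: exp_minus inverse_eq_divide pstar_dens_pos)
      finally have "ennreal (exp (- (real n * I))) \<le> ennreal (\<Prod>i<n. 1 / pstar_dens (y i))"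
        by (rule ennreal_leI)
      also have "\<dots> = (\<Prod>i<n. ennreal (1 / pstar_dens (y i)))"
        using y pstar_dens_pos by (intro prod_ennreal[symmetric]) (auto intro: less_imp_le)
      also have "\<dots> = (\<Prod>k<n. inv_dens (Yv k u))"
        using elim by (intro prod.cong refl) (auto simp: inv_dens_def y_def not_le[symmetric])
      finally show ?thesis using True by simp
    qed simp
  qed
  also have "\<dots> \<le> 1" by (rule M.gw_prod_inv_dens_le_1)
  finally have "ennreal (exp (- (real n * I)) * measure M ?A) \<le> 1"
    using A by (simp add: nn_integral_cmult_indicator M.emeasure_eq_measure ennreal_mult)
  then have "exp (- (real n * I)) * measure M ?A \<le> 1" by simp
  then have "measure M ?A \<le> exp (real n * I)" by (simp add: exp_minus field_simps)
  then show "measure M ?A \<le> exp (real n * (\<integral>r. ?g (r + d) \<partial>mu0))" by (simp add: I_def)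
qed

text \<open>The factor \<open>(1 - \<alpha>) / 2\<close> costs only order \<open>1 / n\<close> in
  the exponent, for which half of \<open>c\<close> is reserved. Positivity is recorded because
  monotonicity of \<open>ln\<close> is applied to the error later.\<close>

lemma ln_type2_lower_bound:
  assumes S: "measurable_statistic S" and crit: "critical_values \<alpha> S \<gamma>"
    and card: "Pstar_len \<Delta> + 1 \<le> CARD('w::finite)" and c: "0 < c"
  shows "eventually (\<lambda>n. 0 < sup_type2 TYPE('w) \<epsilon> \<Delta> S \<gamma> n \<and>
    mean_log - c < ln (sup_type2 TYPE('w) \<epsilon> \<Delta> S \<gamma> n) / real n) sequentially"
proof -
  define \<mu> where "\<mu> = mean_log"
  have "(\<lambda>n. ln ((1 - \<alpha>) / 2) * (1 / real n)) \<longlonglongrightarrow> ln ((1 - \<alpha>) / 2) * 0"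
    by (intro tendsto_mult tendsto_const lim_1_over_n)
  then have "eventually (\<lambda>n. - c / 2 < ln ((1 - \<alpha>) / 2) * (1 / real n)) sequentially"
    using c by (intro order_tendstoD(1)) auto
  moreover have "eventually (\<lambda>n. exp (real n * (\<mu> - c / 2)) * ((1 - \<alpha>) / 2) \<le> sup_type2 TYPE('w) \<epsilon> \<Delta> S \<gamma> n) sequentially"
    unfolding \<mu>_def using c by (intro type2_lower_bound[OF S crit card]) simp
  ultimately show ?thesis unfolding \<mu>_def[symmetric] using eventually_gt_at_top[of 0]
  proof eventually_elim
    case (elim n)
    let ?b = "sup_type2 TYPE('w) \<epsilon> \<Delta> S \<gamma> n"
    have pos: "0 < exp (real n * (\<mu> - c / 2)) * ((1 - \<alpha>) / 2)" using alpha by simp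
    then have b: "0 < ?b" using elim(2) by linarith
    have "ln (exp (real n * (\<mu> - c / 2)) * ((1 - \<alpha>) / 2)) \<le> ln ?b"
      using elim(2) pos b by simp
    then have "real n * (\<mu> - c / 2) + ln ((1 - \<alpha>) / 2) \<le> ln ?b"
      using alpha by (subst (asm) ln_mult) auto
    then have "(real n * (\<mu> - c / 2) + ln ((1 - \<alpha>) / 2)) / real n \<le> ln ?b / real n"
      by (intro divide_right_mono) auto
    then have "(\<mu> - c / 2) + ln ((1 - \<alpha>) / 2) * (1 / real n) \<le> ln ?b / real n"
      using elim(3) by (simp add: add_divide_distrib)
    then show ?case using b elim(1) by linarith
  qed
qed

lemma TrGoF_efficiency_rate:
  assumes crit: "critical_values \<alpha> (GoF s) \<gamma>"
    and card: "Pstar_len \<Delta> + 1 \<le> CARD('w::finite)"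
  shows "efficiency_rate TYPE('w) \<epsilon> \<Delta> (GoF s) \<gamma> (- mean_log)"
proof -
  define \<mu> where "\<mu> = mean_log"
  let ?b = "\<lambda>n. sup_type2 TYPE('w) \<epsilon> \<Delta> (GoF s) \<gamma> n"
  have "(\<lambda>n. ln (?b n) / real n) \<longlonglongrightarrow> \<mu>"
  proof (rule order_tendstoI)
    fix a assume a: "a < \<mu>"
    have "eventually (\<lambda>n. 0 < ?b n \<and> \<mu> - (\<mu> - a) < ln (?b n) / real n) sequentially"
      unfolding \<mu>_def using a by (intro ln_type2_lower_bound[OF measurable_statistic_TrGoF crit card]) (simp add: \<mu>_def)
    then show "eventually (\<lambda>n. a < ln (?b n) / real n) sequentially"
      by eventually_elim simp
  next
    fix a assume a: "\<mu> < a"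
    \<comment> \<open>The shift may use up half of the gap, which leaves a strict inequality at the
      end.\<close>
    obtain d where d: "0 < d" "d \<le> 1" "(\<integral>r. ln (pstar_dens (r + d)) \<partial>mu0) \<le> \<mu> + (a - \<mu>) / 2"
      unfolding \<mu>_def using a integral_ln_pstar_dens_shift[of "(a - \<mu>) / 2"] by (auto simp: \<mu>_def)
    have "0 < (d / 2)\<^sup>2 / 4" using d by simp
    from critical_value_TrGoF_small[OF s this alpha(1) crit]
    have "eventually (\<lambda>n. \<gamma> n \<le> (d / 2)\<^sup>2 / 4) sequentially" .
    moreover have "eventually (\<lambda>n. 1 / real n < d / 2) sequentially"
      using d by (intro order_tendstoD(2)[OF lim_1_over_n]) simp
    \<comment> \<open>Supplies the positivity needed to take logarithms; the constant 1 is
      arbitrary.\<close>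
    moreover have "eventually (\<lambda>n. 0 < ?b n \<and> \<mu> - 1 < ln (?b n) / real n) sequentially"
      unfolding \<mu>_def by (intro ln_type2_lower_bound[OF measurable_statistic_TrGoF crit card]) simp
    ultimately show "eventually (\<lambda>n. ln (?b n) / real n < a) sequentially"
      using eventually_gt_at_top[of 0]
    proof eventually_elim
      case (elim n)
      let ?I = "\<integral>r. ln (pstar_dens (r + d)) \<partial>mu0"
      have "?b n \<le> exp (real n * ?I)"
        using elim d by (intro TrGoF_type2_upper_bound[OF card]) auto
      then have "ln (?b n) \<le> ln (exp (real n * ?I))" using elim by (subst ln_le_cancel_iff) auto
      then have "ln (?b n) / real n \<le> ?I" using elim by (simp add: divide_le_eq mult.commute)
      also have "?I < a" using d(3) a by (simp add: field_simps)
      finally show ?case .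
    qed
  qed
  then show ?thesis by (simp add: efficiency_rate_def \<mu>_def)
qed

end

end

text \<open>The supremum is rendered as an upper bound for every measurable statistic that has a
  rate, together with attainment by Tr-GoF for every choice of critical values; their existence
  keeps the attainment from being vacuous. The assumption on the vocabulary gives
  \<open>Pstar\<close> room among the admissible vectors.\<close>

theorem theorem4p5:
  fixes \<epsilon> \<Delta> s \<alpha> :: real
  assumes eps: "0 < \<epsilon>" "\<epsilon> \<le> 1"
    and Delta: "0 < \<Delta>" "\<Delta> < 1"
    and s: "0 < s" "s < 1"
    and alpha: "0 < \<alpha>" "\<alpha> < 1"
    and vocab: "Pstar_len \<Delta> + 1 \<le> CARD('w::finite)"
  defines "D \<equiv> D_KL mu0 (mix_measure \<epsilon> (Pstar \<Delta>) {..Pstar_len \<Delta>})"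
  shows "(\<forall>S \<gamma> R. measurable_statistic S \<and> critical_values \<alpha> S \<gamma> \<and>
                    efficiency_rate TYPE('w) \<epsilon> \<Delta> S \<gamma> R \<longrightarrow> R \<le> D)
         \<and> measurable_statistic (TrGoF s (\<lambda>_. 0))
         \<and> (\<exists>\<gamma>. critical_values \<alpha> (TrGoF s (\<lambda>_. 0)) \<gamma>)
         \<and> (\<forall>\<gamma>. critical_values \<alpha> (TrGoF s (\<lambda>_. 0)) \<gamma> \<longrightarrow>
                 efficiency_rate TYPE('w) \<epsilon> \<Delta> (TrGoF s (\<lambda>_. 0)) \<gamma> D)"
proof (intro conjI allI impI)
  interpret watermark_params \<epsilon> \<Delta> by unfold_locales (fact eps Delta)+
  define \<mu> where "\<mu> = mean_log"
  have D: "D = - \<mu>"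
    unfolding D_def \<mu>_def pstar_mix_eq by (rule D_KL_eq)
  show "R \<le> D" if "measurable_statistic S \<and> critical_values \<alpha> S \<gamma> \<and> efficiency_rate TYPE('w) \<epsilon> \<Delta> S \<gamma> R"
    for S \<gamma> R
  proof (rule field_le_epsilon)
    fix c :: real assume c: "0 < c"
    have S: "measurable_statistic S" "critical_values \<alpha> S \<gamma>"
      and lim: "(\<lambda>n. ln (sup_type2 TYPE('w) \<epsilon> \<Delta> S \<gamma> n) / real n) \<longlonglongrightarrow> - R"
      using that by (auto simp: efficiency_rate_def)
    have "eventually (\<lambda>n. \<mu> - c \<le> ln (sup_type2 TYPE('w) \<epsilon> \<Delta> S \<gamma> n) / real n) sequentially"
      using ln_type2_lower_bound[OF s alpha S vocab c]
      by eventually_elim (simp add: \<mu>_def)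
    then have "\<mu> - c \<le> - R"
      by (rule tendsto_lowerbound[OF lim _ trivial_limit_sequentially])
    then show "R \<le> D + c" by (simp add: D)
  qed
  show "measurable_statistic (TrGoF s (\<lambda>_. 0))" by (rule measurable_statistic_TrGoF)
  show "\<exists>\<gamma>. critical_values \<alpha> (TrGoF s (\<lambda>_. 0)) \<gamma>"
    by (rule critical_values_TrGoF_exist[OF s alpha])
  show "efficiency_rate TYPE('w) \<epsilon> \<Delta> (TrGoF s (\<lambda>_. 0)) \<gamma> D" if "critical_values \<alpha> (TrGoF s (\<lambda>_. 0)) \<gamma>" for \<gamma>
    using TrGoF_efficiency_rate[OF s alpha that vocab] by (simp add: D \<mu>_def)
qed

end
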